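(* Let $r\ge n$ and let $I=(F_1,\dots,F_r)\subset R=k[x_1,\dots,x_n]$ be an ideal of generally chosen forms of degrees $d_1,\dots,d_r$, where $F_1,\dots,F_r$ are all minimal generators of $I$. Assume that any ideal of fewer than $r$ general forms in $R$ has the Maximal Rank property. Consider a minimal graded free resolution \[ 0\to\mathbb F_n\to\mathbb F_{n-1}\to\dots\to\mathbb F_2\to\mathbb F_1\to I\to 0 . \] Let $c$ be the maximal socle degree of $R/I$. Then \[ \mathbb F_1=\bigoplus_{i=1}^r R(-d_i),\qquad \mathbb F_i=R(-c-i)^\bullet\oplus R(-c-i+1)^\bullet\oplus\mathbb K_i\quad\text{for } i\ge 2, \] where $R(-t)^\bullet$ denotes an unspecified (possibly zero) number of copies of $R(-t)$ and $\mathbb K_i$ is the module of $i$-th Koszul syzygies of degree $\le c+i-2$. In particular, the only possible non-Koszul ghost terms correspond to copies of $R(-c-i)$ between the $i$-th and the $(i+1)$-st free modules for $i\ge 2$, and there are no non-Koszul ghost terms between the first and second free modules.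
   Context: $k$ is an infinite field and $R$ is standard graded. "General" forms of prescribed degrees means: the statement holds for all tuples of forms in a nonempty Zariski open subset of the product of the corresponding spaces of forms. The maximal socle degree of the Artinian algebra $R/I$ is the last degree in which $R/I$ is non-zero. Maximal Rank property: a standard graded quotient $A=R/\mathfrak a$ (or the ideal $\mathfrak a$) has it if for every $e\ge 1$ and a general form $F\in R_e$, the multiplication map $\times F:A_i\to A_{i+e}$ has maximal rank (is injective or surjective) for every $i$. The assumption means that for all $s<r$ and all degrees, the ideal generated by $s$ general forms of these degrees has the Maximal Rank property. Let $K_\bullet$ be the Koszul complex on $F_1,\dots,F_r$, so $K_i=\bigoplus_{j_1<\dots<j_i}R(-(d_{j_1}+\dots+d_{j_i}))$. The module $\mathbb K_i$ of $i$-th Koszul syzygies of degree $\le c+i-2$ is the direct sum of those summands $R(-(d_{j_1}+\dots+d_{j_i}))$ of $K_i$ with $d_{j_1}+\dots+d_{j_i}\le c+i-2$, included in $\mathbb F_i$ via a comparison map from $K_\bullet$ to the minimal resolution $\dots\to\mathbb F_2\to\mathbb F_1\to R$ of $R/I$. $\mathbb F_i$ is called the $i$-th free module. A ghost term $R(-t)$ between the $i$-th and the $(i+1)$-st free modules means that $R(-t)$ occurs as a direct summand of both $\mathbb F_i$ and $\mathbb F_{i+1}$. It is Koszul if the copies of $R(-t)$ in $\mathbb F_{i+1}$ are Koszul, meaning that the map $(K_{i+1}\otimes_R k)_t\to(\mathbb F_{i+1}\otimes_R k)_t=\mathrm{Tor}^R_{i+1}(R/I,k)_t$ induced by the comparison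 map is surjective; otherwise it is non-Koszul. *)

theory Defs
  imports
    "HOL-Library.Cardinality"
    "HOL-Library.Poly_Mapping"
    "Jordan_Normal_Form.Matrix_Kernel"
begin

section \<open>The standard graded polynomial ring\<close>

text \<open>The variables are indexed by a finite type \<open>'v\<close>, so that \<open>('v, 'k) mpoly\<close> is
  $k[x_1,\dots,x_n]$ with \<open>n = CARD('v)\<close>.\<close>

type_synonym 'v monomial = "'v \<Rightarrow>\<^sub>0 nat"
type_synonym ('v, 'k) mpoly = "'v monomial \<Rightarrow>\<^sub>0 'k"

definition monomial_degree :: "'v monomial \<Rightarrow> nat" where
  "monomial_degree m = (\<Sum>v\<in>Poly_Mapping.keys m. Poly_Mapping.lookup m v)"

text \<open>The graded piece $R_t$, which is \<open>{0}\<close> for negative \<open>t\<close>.\<close>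

definition forms :: "int \<Rightarrow> ('v, 'k::zero) mpoly set" where
  "forms t = {f. \<forall>m\<in>Poly_Mapping.keys f. int (monomial_degree m) = t}"

definition irrelevant_ideal :: "('v, 'k::zero) mpoly set" where
  "irrelevant_ideal = {f. Poly_Mapping.lookup f 0 = 0}"

definition ideal_generated :: "('v, 'k::comm_ring_1) mpoly set \<Rightarrow> ('v, 'k) mpoly set" where
  "ideal_generated S = Modules.module.span (*) S"

definition minimal_generators :: "('v, 'k::comm_ring_1) mpoly list \<Rightarrow> bool" where
  "minimal_generators Fs \<longleftrightarrow>
     (\<forall>j<length Fs. Fs ! j \<notin> ideal_generated {Fs ! l |l. l < length Fs \<and> l \<noteq> j})"

text \<open>The last degree in which $R/I$ is nonzero.\<close>

definition max_socle_degree :: "('v, 'k::zero) mpoly set \<Rightarrow> nat" where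
  "max_socle_degree I = (GREATEST j. \<exists>f\<in>forms (int j). f \<notin> I)"


section \<open>General forms\<close>

definition mpoly_eval :: "('c \<Rightarrow> 'k::comm_semiring_1) \<Rightarrow> ('c, 'k) mpoly \<Rightarrow> 'k" where
  "mpoly_eval x p = (\<Sum>m\<in>Poly_Mapping.keys p. Poly_Mapping.lookup p m *
     (\<Prod>v\<in>Poly_Mapping.keys m. x v ^ Poly_Mapping.lookup m v))"

definition form_tuples :: "nat list \<Rightarrow> ('v, 'k::zero) mpoly list set" where
  "form_tuples ds = {Fs. list_all2 (\<lambda>f d. f \<in> forms (int d)) Fs ds}"

text \<open>\<open>form_tuples ds\<close> is an affine space: the coordinate \<open>(j, m)\<close> of a tuple is the coefficient
  of the monomial \<open>m\<close> in its \<open>j\<close>-th entry. The Zariski open sets are the loci where some member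
  of a set of polynomials in these coordinates does not vanish.\<close>

definition form_coordinates :: "nat list \<Rightarrow> (nat \<times> 'v monomial) set" where
  "form_coordinates ds = {(j, m). j < length ds \<and> monomial_degree m = ds ! j}"

definition zariski_open :: "nat list \<Rightarrow> ('v, 'k::comm_semiring_1) mpoly list set \<Rightarrow> bool" where
  "zariski_open ds U \<longleftrightarrow>
     (\<exists>P :: (nat \<times> 'v monomial, 'k) mpoly set.
        (\<forall>p\<in>P. \<forall>m\<in>Poly_Mapping.keys p. Poly_Mapping.keys m \<subseteq> form_coordinates ds) \<and>
        U = {Fs\<in>form_tuples ds.
               \<exists>p\<in>P. mpoly_eval (\<lambda>(j, m). Poly_Mapping.lookup (Fs ! j) m) p \<noteq> 0})"

definition for_general_forms ::
    "nat list \<Rightarrow> (('v, 'k::comm_semiring_1) mpoly list \<Rightarrow> bool) \<Rightarrow> bool" where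
  "for_general_forms ds Q \<longleftrightarrow> (\<exists>U. zariski_open ds U \<and> U \<noteq> {} \<and> (\<forall>Fs\<in>U. Q Fs))"

text \<open>Injectivity and surjectivity of multiplication by \<open>f\<close>, $(R/\mathfrak{a})_i \to
  (R/\mathfrak{a})_{i+e}$, written out on representatives.\<close>

definition mult_injective ::
    "('v, 'k::comm_ring_1) mpoly set \<Rightarrow> ('v, 'k) mpoly \<Rightarrow> nat \<Rightarrow> bool" where
  "mult_injective \<aa> f i \<longleftrightarrow> (\<forall>g\<in>forms (int i). f * g \<in> \<aa> \<longrightarrow> g \<in> \<aa>)"

definition mult_surjective ::
    "('v, 'k::comm_ring_1) mpoly set \<Rightarrow> ('v, 'k) mpoly \<Rightarrow> nat \<Rightarrow> nat \<Rightarrow> bool" where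
  "mult_surjective \<aa> f e i \<longleftrightarrow> (\<forall>h\<in>forms (int (i + e)). \<exists>g\<in>forms (int i). h - f * g \<in> \<aa>)"

definition maximal_rank_property :: "('v, 'k::comm_ring_1) mpoly set \<Rightarrow> bool" where
  "maximal_rank_property \<aa> \<longleftrightarrow>
     (\<forall>e\<ge>1. for_general_forms [e]
        (\<lambda>Fs. \<forall>i. mult_injective \<aa> (Fs ! 0) i \<or> mult_surjective \<aa> (Fs ! 0) e i))"


section \<open>Graded free modules and minimal free resolutions\<close>

text \<open>A list of integers \<open>a\<close> stands for the graded free module $\bigoplus_q R(-a_q)$, with
  underlying set \<open>carrier_vec (length a)\<close> and \<open>q\<close>-th basis vector in degree \<open>a ! q\<close>.
  Homomorphisms of degree 0 are given by matrices.\<close>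

definition homogeneous_elements :: "int list \<Rightarrow> int \<Rightarrow> ('v, 'k::zero) mpoly vec set" where
  "homogeneous_elements a t =
     {v\<in>carrier_vec (length a). \<forall>q<length a. v $ q \<in> forms (t - a ! q)}"

definition graded_hom :: "int list \<Rightarrow> int list \<Rightarrow> ('v, 'k::zero) mpoly mat \<Rightarrow> bool" where
  "graded_hom a b M \<longleftrightarrow> M \<in> carrier_mat (length b) (length a) \<and>
     (\<forall>p<length b. \<forall>q<length a. M $$ (p, q) \<in> forms (a ! q - b ! p))"

definition graded_iso :: "int list \<Rightarrow> int list \<Rightarrow> ('v, 'k::comm_ring_1) mpoly mat \<Rightarrow> bool" where
  "graded_iso a b M \<longleftrightarrow> graded_hom a b M \<and>
     bij_betw (\<lambda>v. M *\<^sub>v v) (carrier_vec (length a)) (carrier_vec (length b))"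

definition mat_image :: "('v, 'k::comm_ring_1) mpoly mat \<Rightarrow> ('v, 'k) mpoly vec set" where
  "mat_image M = (\<lambda>v. M *\<^sub>v v) ` carrier_vec (dim_col M)"

text \<open>\<open>a i\<close> is the \<open>i\<close>-th free module and \<open>D (Suc i)\<close> the map from the \<open>Suc i\<close>-th to the
  \<open>i\<close>-th one, the 0-th one being \<open>R\<close> itself.\<close>

definition minimal_free_resolution ::
    "('v::finite, 'k::comm_ring_1) mpoly set \<Rightarrow> (nat \<Rightarrow> int list) \<Rightarrow>
       (nat \<Rightarrow> ('v, 'k) mpoly mat) \<Rightarrow> bool" where
  "minimal_free_resolution I a D \<longleftrightarrow>
     a 0 = [0] \<and> (\<forall>i>CARD('v). a i = []) \<and>
     (\<forall>i. graded_hom (a (Suc i)) (a i) (D (Suc i))) \<and>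
     (\<lambda>v. v $ 0) ` mat_image (D 1) = I \<and>
     (\<forall>i\<ge>1. mat_kernel (D i) = mat_image (D (Suc i))) \<and>
     (\<forall>i. \<forall>p<length (a i). \<forall>q<length (a (Suc i)). D (Suc i) $$ (p, q) \<in> irrelevant_ideal)"


section \<open>The Koszul complex\<close>

text \<open>The basis element $e_{j_1} \wedge \dots \wedge e_{j_i}$ of $K_i$ is the increasing list
  \<open>[j\<^sub>1, \<dots>, j\<^sub>i]\<close>.\<close>

definition koszul_basis :: "nat \<Rightarrow> nat \<Rightarrow> nat list list" where
  "koszul_basis r i = filter (\<lambda>S. length S = i) (subseqs [0..<r])"

definition koszul_module :: "nat list \<Rightarrow> nat \<Rightarrow> int list" where
  "koszul_module ds i = map (\<lambda>S. \<Sum>j\<leftarrow>S. int (ds ! j)) (koszul_basis (length ds) i)"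

text \<open>The matrix of $K_{i+1} \to K_i$, $e_{j_0} \wedge \dots \wedge e_{j_i} \mapsto
  \sum_l (-1)^l F_{j_l}\, e_{j_0} \wedge \dots \widehat{e_{j_l}} \dots \wedge e_{j_i}$.\<close>

definition koszul_map ::
    "('v, 'k::comm_ring_1) mpoly list \<Rightarrow> nat \<Rightarrow> ('v, 'k) mpoly mat" where
  "koszul_map Fs i =
     (let B = koszul_basis (length Fs) i; B' = koszul_basis (length Fs) (Suc i)
      in mat (length B) (length B') (\<lambda>(p, q). \<Sum>l<Suc i.
           if B ! p = take l (B' ! q) @ drop (Suc l) (B' ! q)
           then (-1) ^ l * Fs ! (B' ! q ! l) else 0))"

definition comparison_map ::
    "nat list \<Rightarrow> ('v, 'k::comm_ring_1) mpoly list \<Rightarrow> (nat \<Rightarrow> int list) \<Rightarrow>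
       (nat \<Rightarrow> ('v, 'k) mpoly mat) \<Rightarrow> (nat \<Rightarrow> ('v, 'k) mpoly mat) \<Rightarrow> bool" where
  "comparison_map ds Fs a D \<phi> \<longleftrightarrow>
     \<phi> 0 = 1\<^sub>m 1 \<and>
     (\<forall>i. graded_hom (koszul_module ds i) (a i) (\<phi> i)) \<and>
     (\<forall>i. D (Suc i) * \<phi> (Suc i) = \<phi> i * koszul_map Fs i)"

text \<open>The sum of the summands $R(-t)$ of $K_i$ with $t \le b$, as a submodule of $K_i$.\<close>

definition koszul_syzygies :: "nat list \<Rightarrow> nat \<Rightarrow> int \<Rightarrow> ('v, 'k::zero) mpoly vec set" where
  "koszul_syzygies ds i b =
     {u\<in>carrier_vec (length (koszul_module ds i)).
        \<forall>q<length (koszul_module ds i). u $ q \<noteq> 0 \<longrightarrow> koszul_module ds i ! q \<le> b}"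

text \<open>$\mathbb{F}_i = R(-c-i)^\bullet \oplus R(-c-i+1)^\bullet \oplus \mathbb{K}_i$, where
  $\mathbb{K}_i$ sits in $\mathbb{F}_i$ via \<open>\<phi>\<close> and the other summands via \<open>B\<close>.\<close>

definition koszul_decomposition ::
    "nat list \<Rightarrow> int \<Rightarrow> nat \<Rightarrow> int list \<Rightarrow> ('v, 'k::comm_ring_1) mpoly mat \<Rightarrow> bool" where
  "koszul_decomposition ds c i a \<phi> \<longleftrightarrow>
     (\<exists>x y (B :: ('v, 'k) mpoly mat).
        let L = replicate x (c + int i) @ replicate y (c + int i - 1)
        in graded_hom L a B \<and>
           bij_betw (\<lambda>(w, u). B *\<^sub>v w + \<phi> *\<^sub>v u)
             (carrier_vec (length L) \<times> koszul_syzygies ds i (c + int i - 2))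
             (carrier_vec (length a)))"


section \<open>Ghost terms\<close>

definition ghost_term :: "(nat \<Rightarrow> int list) \<Rightarrow> nat \<Rightarrow> int \<Rightarrow> bool" where
  "ghost_term a i t \<longleftrightarrow> t \<in> set (a i) \<and> t \<in> set (a (Suc i))"

text \<open>Surjectivity of $(K_j \otimes_R k)_t \to (\mathbb{F}_j \otimes_R k)_t$, using
  $M \otimes_R k = M / \mathfrak{m} M$.\<close>

definition koszul_surjective ::
    "nat list \<Rightarrow> (nat \<Rightarrow> int list) \<Rightarrow> (nat \<Rightarrow> ('v, 'k::comm_ring_1) mpoly mat) \<Rightarrow>
       nat \<Rightarrow> int \<Rightarrow> bool" where
  "koszul_surjective ds a \<phi> j t \<longleftrightarrow>
     (\<forall>v\<in>homogeneous_elements (a j) t. \<exists>u\<in>homogeneous_elements (koszul_module ds j) t.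
        \<forall>p<length (a j). (v - \<phi> j *\<^sub>v u) $ p \<in> irrelevant_ideal)"

definition non_koszul_ghost_term ::
    "nat list \<Rightarrow> (nat \<Rightarrow> int list) \<Rightarrow> (nat \<Rightarrow> ('v, 'k::comm_ring_1) mpoly mat) \<Rightarrow>
       nat \<Rightarrow> int \<Rightarrow> bool" where
  "non_koszul_ghost_term ds a \<phi> i t \<longleftrightarrow>
     ghost_term a i t \<and> \<not> koszul_surjective ds a \<phi> (Suc i) t"

end

theory Submission
  imports Defs
begin

text \<open>
  Let \<open>c\<close> be the last degree in which \<open>R/I\<close> is nonzero. Multiplication by $F_{s+1}$ on
  $R/(F_1,\dots,F_s)$ has maximal rank, and it is not surjective onto a degree at most \<open>c\<close>, because
  \<open>R/I\<close> is nonzero there; so it is injective. By induction on \<open>s\<close> the Koszul homology $H_i$ of the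
  forms vanishes in degrees at most $c+i-1$ for all $i \ge 1$. A comparison of the Koszul complex with
  the minimal resolution, one homological degree after the other, shows that the comparison map is an
  isomorphism between the summands of $K_i$ and of $\mathbb{F}_i$ generated in degrees at most
  $c+i-2$. The Koszul complex of the variables with coefficients in \<open>R/I\<close> lives in degrees at most
  $c+i$ in homological degree \<open>i\<close>, which bounds the degrees of the generators of $\mathbb{F}_i$ from
  above. Between $\mathbb{F}_1$ and $\mathbb{F}_2$ only the degree $c+1$ remains. If some form has this
  degree, then it may be put last; it is a minimal generator, so the quotient by the other forms is
  nonzero in degree $c+1$, and $H_1$ vanishes in degree $c+1$ as well.

  Only finitely many degrees matter, since \<open>R/I\<close> vanishes in a fixed degree for all general forms:
  this is an open condition, satisfied by the powers of the variables.
\<close>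

section \<open>Polynomials and forms\<close>

text \<open>The 2 in \<open>c + i - 2\<close> comes from the comparison. For i at least 2, a
  generator of F_i in degree t is pushed down to F_{i-1} and carried over to K_{i-1}; the resulting
  cycle must be a boundary, so H_{i-1} has to vanish in degree t, which is known for t up to c + i -
  2. The induction needs an isomorphism of the submodules generated in low degrees, not just of
  their generators. It goes through because both complexes are minimal: a differential lowers the
  degrees of the basis vectors by at least one, so the range for i is sent into the range for i - 1.
  For F_2 the degree c + 1 lies exactly one step beyond the range, hence the separate argument
  there.

  The other obstacle is the order of choices. The number c belongs to a tuple, while the order of
  the forms and the finite list of rank conditions must be fixed before a tuple is chosen. So the
  order puts a form of largest degree last, and the sum of all degrees, which exceeds c, bounds the
  list.\<close>

abbreviation coef :: "('v, 'k::zero) mpoly \<Rightarrow> 'v monomial \<Rightarrow> 'k" where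
  "coef \<equiv> Poly_Mapping.lookup"

abbreviation mterm :: "'v monomial \<Rightarrow> 'k \<Rightarrow> ('v, 'k::zero) mpoly" where
  "mterm \<equiv> Poly_Mapping.single"

section \<open>Degrees of monomials\<close>

lemma monomial_degree_UNIV:
  "monomial_degree (m :: 'v::finite monomial) = (\<Sum>v\<in>UNIV. Poly_Mapping.lookup m v)"
  unfolding monomial_degree_def
  by (rule sum.mono_neutral_left) (auto simp: in_keys_iff)

lemma monomial_degree_add [simp]:
  "monomial_degree ((m :: 'v::finite monomial) + m') = monomial_degree m + monomial_degree m'"
  by (simp add: monomial_degree_UNIV lookup_add sum.distrib)

lemma monomial_degree_zero [simp]: "monomial_degree 0 = 0"
  by (simp add: monomial_degree_def)

lemma monomial_degree_eq_0_iff [simp]: "monomial_degree (m :: 'v::finite monomial) = 0 \<longleftrightarrow> m = 0"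
  by (auto simp: monomial_degree_UNIV intro: poly_mapping_eqI)

lemma monomial_degree_single [simp]: "monomial_degree (Poly_Mapping.single v k) = k"
  by (simp add: monomial_degree_def)

lemma finite_monomials: "finite {m :: 'v::finite monomial. monomial_degree m = d}"
proof -
  have "Poly_Mapping.lookup ` {m :: 'v monomial. monomial_degree m = d} \<subseteq> (UNIV :: 'v set) \<rightarrow>\<^sub>E {..d}"
  proof -
    have "Poly_Mapping.lookup m v \<le> monomial_degree m" for m :: "'v monomial" and v
      unfolding monomial_degree_UNIV by (rule member_le_sum) auto
    then show ?thesis by (auto simp: PiE_def)
  qed
  moreover have "finite ((UNIV :: 'v set) \<rightarrow>\<^sub>E {..d})" by (intro finite_PiE) auto
  ultimately show ?thesis
    by (meson finite_imageD finite_subset inj_onI poly_mapping_eq_iff)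
qed

lemma mpoly_expand: "(f :: ('v, 'k::comm_monoid_add) mpoly) = (\<Sum>m\<in>Poly_Mapping.keys f. mterm m (coef f m))"
proof (rule poly_mapping_eqI)
  fix m
  have "(\<Sum>m'\<in>Poly_Mapping.keys f. coef (mterm m' (coef f m')) m) =
      (\<Sum>m'\<in>Poly_Mapping.keys f. if m' = m then coef f m else 0)"
    by (intro sum.cong) (auto simp: lookup_single when_def)
  then show "coef f m = coef (\<Sum>m\<in>Poly_Mapping.keys f. mterm m (coef f m)) m"
    by (simp add: lookup_sum in_keys_iff)
qed

lemma coef_mterm_mult:
  fixes f :: "('v, 'k::comm_semiring_1) mpoly"
  shows "coef (mterm m c * f) (m + m') = c * coef f m'"
proof -
  have "mterm m c * f = (\<Sum>n\<in>Poly_Mapping.keys f. mterm (m + n) (c * coef f n))"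
    by (subst mpoly_expand[of f]) (simp add: sum_distrib_left mult_single)
  then have "coef (mterm m c * f) (m + m') = (\<Sum>n\<in>Poly_Mapping.keys f. coef (mterm (m + n) (c * coef f n)) (m + m'))"
    by (simp add: lookup_sum)
  also have "\<dots> = (\<Sum>n\<in>Poly_Mapping.keys f. if n = m' then c * coef f m' else 0)"
    by (intro sum.cong) (auto simp: lookup_single when_def)
  finally show ?thesis by (auto simp: in_keys_iff)
qed

lemma coef_mterm_mult_0:
  fixes f :: "('v, 'k::comm_semiring_1) mpoly"
  assumes "\<And>m'. n \<noteq> m + m'"
  shows "coef (mterm m c * f) n = 0"
proof (rule ccontr)
  assume "coef (mterm m c * f) n \<noteq> 0"
  then have "n \<in> Poly_Mapping.keys (mterm m c * f)" by (simp add: in_keys_iff)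
  then obtain a b where "n = a + b" "a \<in> Poly_Mapping.keys (mterm m c)"
    using keys_mult[of "mterm m c" f] by blast
  then show False using assms by (auto split: if_splits)
qed

lemma coef_const_mult: "coef (mterm 0 c * f) m = c * coef (f :: ('v, 'k::comm_semiring_1) mpoly) m"
  using coef_mterm_mult[of 0 c f m] by simp

section \<open>Forms and the irrelevant ideal\<close>

lemma in_forms_iff: "f \<in> forms t \<longleftrightarrow> (\<forall>m. coef f m \<noteq> 0 \<longrightarrow> int (monomial_degree m) = t)"
  by (auto simp: forms_def in_keys_iff)

lemma forms_0 [simp]: "0 \<in> forms t"
  by (simp add: in_forms_iff)

lemma forms_add: "f \<in> forms t \<Longrightarrow> g \<in> forms t \<Longrightarrow> f + g \<in> forms t"
  for f :: "('v, 'k::comm_ring_1) mpoly"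
  by (auto simp: in_forms_iff lookup_add) (metis add.right_neutral)

lemma forms_uminus: "f \<in> forms t \<Longrightarrow> - f \<in> forms t"
  for f :: "('v, 'k::comm_ring_1) mpoly"
  by (auto simp: in_forms_iff)

lemma forms_diff: "f \<in> forms t \<Longrightarrow> g \<in> forms t \<Longrightarrow> f - g \<in> forms t"
  for f :: "('v, 'k::comm_ring_1) mpoly"
  using forms_add[of f t "- g"] forms_uminus[of g t] by simp

lemma forms_sum: "(\<And>x. x \<in> A \<Longrightarrow> f x \<in> forms t) \<Longrightarrow> sum f A \<in> forms t"
  for f :: "'a \<Rightarrow> ('v, 'k::comm_ring_1) mpoly"
  by (induction A rule: infinite_finite_induct) (auto intro: forms_add)

lemma forms_mult: "f \<in> forms s \<Longrightarrow> g \<in> forms t \<Longrightarrow> f * g \<in> forms (s + t)"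
  for f :: "('v::finite, 'k::comm_ring_1) mpoly"
  unfolding forms_def using keys_mult[of f g] by fastforce

lemma forms_1 [simp]: "1 \<in> forms 0"
  by (simp add: in_forms_iff lookup_one when_def)

lemma forms_mterm: "t = int (monomial_degree m) \<Longrightarrow> mterm m c \<in> forms t"
  by (simp add: forms_def)

lemma forms_neg: "f \<in> forms t \<Longrightarrow> t < 0 \<Longrightarrow> f = 0"
  by (rule poly_mapping_eqI) (auto simp: in_forms_iff)

lemma forms_zero_const: "f \<in> forms 0 \<Longrightarrow> f = mterm 0 (coef f 0)"
  for f :: "('v::finite, 'k::comm_ring_1) mpoly"
  by (rule poly_mapping_eqI) (auto simp: in_forms_iff lookup_single when_def)

lemma forms_irrelevant: "f \<in> forms t \<Longrightarrow> t \<noteq> 0 \<Longrightarrow> f \<in> irrelevant_ideal"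
  by (force simp: in_forms_iff irrelevant_ideal_def)

lemma irrelevant_0 [simp]: "0 \<in> irrelevant_ideal"
  by (simp add: irrelevant_ideal_def)

lemma irrelevant_add: "f \<in> irrelevant_ideal \<Longrightarrow> g \<in> irrelevant_ideal \<Longrightarrow> f + g \<in> irrelevant_ideal"
  for f :: "('v, 'k::comm_ring_1) mpoly"
  by (simp add: irrelevant_ideal_def lookup_add)

lemma irrelevant_sum: "(\<And>x. x \<in> A \<Longrightarrow> f x \<in> irrelevant_ideal) \<Longrightarrow> sum f A \<in> irrelevant_ideal"
  for f :: "'a \<Rightarrow> ('v, 'k::comm_ring_1) mpoly"
  by (induction A rule: infinite_finite_induct) (auto intro: irrelevant_add)

lemma irrelevant_mult: "f \<in> irrelevant_ideal \<Longrightarrow> f * g \<in> irrelevant_ideal"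
  for f :: "('v::finite, 'k::comm_ring_1) mpoly"
proof -
  assume f: "f \<in> irrelevant_ideal"
  have "0 \<notin> Poly_Mapping.keys (f * g)"
  proof
    assume "0 \<in> Poly_Mapping.keys (f * g)"
    then obtain a b where ab: "0 = a + b" "a \<in> Poly_Mapping.keys f" using keys_mult[of f g] by blast
    then have "monomial_degree a = 0" using monomial_degree_add[of a b] by (metis add_is_0 monomial_degree_zero)
    then show False using ab f by (simp add: irrelevant_ideal_def in_keys_iff)
  qed
  then show ?thesis by (simp add: irrelevant_ideal_def in_keys_iff)
qed

lemma irrelevant_mult2: "g \<in> irrelevant_ideal \<Longrightarrow> f * g \<in> irrelevant_ideal"
  for f :: "('v::finite, 'k::comm_ring_1) mpoly"
  using irrelevant_mult[of g f] by (simp add: mult.commute)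

lemma one_not_irrelevant: "(1 :: ('v, 'k::comm_ring_1) mpoly) \<notin> irrelevant_ideal"
  by (simp add: irrelevant_ideal_def)

section \<open>Homogeneous components\<close>

definition hcomp :: "int \<Rightarrow> ('v, 'k::comm_ring_1) mpoly \<Rightarrow> ('v, 'k) mpoly" where
  "hcomp t f = (\<Sum>m\<in>{m\<in>Poly_Mapping.keys f. int (monomial_degree m) = t}. mterm m (coef f m))"

lemma coef_hcomp: "coef (hcomp t f) m = (if int (monomial_degree m) = t then coef f m else 0)"
proof -
  have "coef (hcomp t f) m =
      (\<Sum>m'\<in>{m\<in>Poly_Mapping.keys f. int (monomial_degree m) = t}. if m' = m then coef f m else 0)"
    unfolding hcomp_def lookup_sum by (intro sum.cong) (auto simp: lookup_single when_def)
  then show ?thesis by (auto simp: in_keys_iff)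
qed

lemma hcomp_forms [simp]: "hcomp t f \<in> forms t"
  by (simp add: in_forms_iff coef_hcomp)

lemma hcomp_id: "f \<in> forms t \<Longrightarrow> hcomp t f = f"
  by (rule poly_mapping_eqI) (auto simp: in_forms_iff coef_hcomp)

lemma hcomp_add: "hcomp t (f + g) = hcomp t f + hcomp t g"
  by (rule poly_mapping_eqI) (simp add: coef_hcomp lookup_add)

lemma hcomp_0 [simp]: "hcomp t 0 = 0"
  by (rule poly_mapping_eqI) (simp add: coef_hcomp)

lemma hcomp_sum: "hcomp t (sum f A) = (\<Sum>x\<in>A. hcomp t (f x))"
  by (induction A rule: infinite_finite_induct) (auto simp: hcomp_add)

text \<open>What \<open>g\<close> has outside degree \<open>t\<close> only produces monomials
  outside degree \<open>s + t\<close>. Consequently linear equations with homogeneous data have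
  homogeneous solutions as soon as they have solutions.\<close>

lemma hcomp_mult:
  fixes f :: "('v::finite, 'k::comm_ring_1) mpoly"
  assumes f: "f \<in> forms s"
  shows "hcomp (s + t) (f * g) = f * hcomp t g"
proof (rule poly_mapping_eqI)
  fix m
  have s: "f * g = f * hcomp t g + f * (g - hcomp t g)" by (simp add: algebra_simps)
  show "coef (hcomp (s + t) (f * g)) m = coef (f * hcomp t g) m"
  proof (cases "int (monomial_degree m) = s + t")
    case True
    have "m \<notin> Poly_Mapping.keys (f * (g - hcomp t g))"
    proof
      assume "m \<in> Poly_Mapping.keys (f * (g - hcomp t g))"
      then obtain a b where "m = a + b" "a \<in> Poly_Mapping.keys f" "b \<in> Poly_Mapping.keys (g - hcomp t g)"
        using keys_mult by blast
      then show False using f True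
        by (auto simp: in_forms_iff in_keys_iff lookup_minus coef_hcomp split: if_splits)
    qed
    then have "coef (f * (g - hcomp t g)) m = 0" by (simp add: in_keys_iff)
    then show ?thesis using True by (subst s) (simp add: coef_hcomp lookup_add)
  next
    case False
    then show ?thesis using forms_mult[OF f hcomp_forms[of t g]]
      by (auto simp: coef_hcomp in_forms_iff)
  qed
qed

lemma hcomp_mult':
  fixes f :: "('v::finite, 'k::comm_ring_1) mpoly"
  assumes "f \<in> forms s"
  shows "hcomp t (g * f) = hcomp (t - s) g * f"
  using hcomp_mult[OF assms, of "t - s" g] by (simp add: mult.commute)

lemma forms_expand:
  assumes "f \<in> forms (int d)"
  shows "f = (\<Sum>m\<in>{m :: 'v::finite monomial. monomial_degree m = d}. mterm m (coef f m))"
  by (subst mpoly_expand, rule sum.mono_neutral_left)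
    (use assms in \<open>auto simp: finite_monomials in_forms_iff in_keys_iff\<close>)

text \<open>This is the ideal generated by the \<open>F j\<close>. Indexing by positions keeps equal
  forms apart and lets a subfamily of a tuple be named by a set of numbers.\<close>

definition lincombs :: "('i \<Rightarrow> 'a::comm_ring_1) \<Rightarrow> 'i set \<Rightarrow> 'a set" where
  "lincombs F A = {f. \<exists>c. f = (\<Sum>j\<in>A. c j * F j)}"

lemma lincombsI: "f = (\<Sum>j\<in>A. c j * F j) \<Longrightarrow> f \<in> lincombs F A"
  unfolding lincombs_def by (rule CollectI) (rule exI)

lemma module_mult: "Modules.module ((*) :: 'a::comm_ring_1 \<Rightarrow> 'a \<Rightarrow> 'a)"
  by unfold_locales (auto simp: algebra_simps)

lemma ideal_generated_image:
  fixes F :: "'i \<Rightarrow> ('v, 'k::comm_ring_1) mpoly"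
  assumes "finite A"
  shows "ideal_generated (F ` A) = lincombs F A"
proof -
  interpret Modules.module "(*) :: ('v, 'k) mpoly \<Rightarrow> ('v, 'k) mpoly \<Rightarrow> ('v, 'k) mpoly" by (rule module_mult)
  show ?thesis unfolding ideal_generated_def
  proof (rule span_unique)
    show "F ` A \<subseteq> lincombs F A"
    proof clarify
      fix a assume "a \<in> A"
      then have "F a = (\<Sum>j\<in>A. (if j = a then 1 else 0) * F j)" 
        using assms by (simp add: if_distrib[of "\<lambda>x. x * _"] cong: if_cong)
      then show "F a \<in> lincombs F A" by (rule lincombsI)
    qed
    show "subspace (lincombs F A)"
    proof (rule subspaceI)
      show "0 \<in> lincombs F A" by (rule lincombsI[where c = "\<lambda>_. 0"]) simp
    next
      fix x y assume "x \<in> lincombs F A" "y \<in> lincombs F A"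
      then obtain c d where "x = (\<Sum>j\<in>A. c j * F j)" "y = (\<Sum>j\<in>A. d j * F j)" by (auto simp: lincombs_def)
      then have "x + y = (\<Sum>j\<in>A. (c j + d j) * F j)" by (simp add: algebra_simps sum.distrib)
      then show "x + y \<in> lincombs F A" by (rule lincombsI)
    next
      fix c x assume "x \<in> lincombs F A"
      then obtain d where "x = (\<Sum>j\<in>A. d j * F j)" by (auto simp: lincombs_def)
      then have "c * x = (\<Sum>j\<in>A. (c * d j) * F j)" by (simp only: sum_distrib_left mult.assoc)
      then show "c * x \<in> lincombs F A" by (rule lincombsI)
    qed
    fix T assume "F ` A \<subseteq> T" "subspace T"
    then show "lincombs F A \<subseteq> T" unfolding lincombs_def
      by (auto intro!: subspace_sum subspace_scale)
  qed
qed

lemma lincombs_0 [simp]: "0 \<in> lincombs F A"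
  by (rule lincombsI[where c = "\<lambda>_. 0"]) simp

lemma lincombs_add: "f \<in> lincombs F A \<Longrightarrow> g \<in> lincombs F A \<Longrightarrow> f + g \<in> lincombs F A"
proof -
  assume "f \<in> lincombs F A" "g \<in> lincombs F A"
  then obtain c d where "f = (\<Sum>j\<in>A. c j * F j)" "g = (\<Sum>j\<in>A. d j * F j)" by (auto simp: lincombs_def)
  then have "f + g = (\<Sum>j\<in>A. (c j + d j) * F j)" by (simp add: algebra_simps sum.distrib)
  then show "f + g \<in> lincombs F A" by (rule lincombsI)
qed

lemma lincombs_mult: "f \<in> lincombs F A \<Longrightarrow> g * f \<in> lincombs F A"
proof -
  assume "f \<in> lincombs F A"
  then obtain d where "f = (\<Sum>j\<in>A. d j * F j)" by (auto simp: lincombs_def)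
  then have "g * f = (\<Sum>j\<in>A. (g * d j) * F j)" by (simp add: sum_distrib_left mult.assoc)
  then show "g * f \<in> lincombs F A" by (rule lincombsI)
qed

lemma lincombs_diff: "f \<in> lincombs F A \<Longrightarrow> g \<in> lincombs F A \<Longrightarrow> f - g \<in> lincombs F A"
  using lincombs_add[of f F A "-1 * g"] lincombs_mult[of g F A "-1"] by simp

lemma lincombs_sum: "(\<And>x. x \<in> B \<Longrightarrow> f x \<in> lincombs F A) \<Longrightarrow> sum f B \<in> lincombs F A"
  by (induction B rule: infinite_finite_induct) (auto intro: lincombs_add)

lemma lincombs_gen:
  assumes "finite A" "a \<in> A"
  shows "F a \<in> lincombs F A"
proof -
  have "F a = (\<Sum>j\<in>A. (if j = a then 1 else 0) * F j)" 
    using assms by (simp add: if_distrib[of "\<lambda>x. x * _"] cong: if_cong)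
  then show "F a \<in> lincombs F A" by (rule lincombsI)
qed

lemma lincombs_mono:
  assumes "finite B" "A \<subseteq> B"
  shows "lincombs F A \<subseteq> lincombs F B"
proof
  fix f assume "f \<in> lincombs F A"
  then obtain c where "f = (\<Sum>j\<in>A. c j * F j)" by (auto simp: lincombs_def)
  then show "f \<in> lincombs F B" using assms by (auto intro!: lincombs_sum lincombs_mult lincombs_gen)
qed

text \<open>Taking components of degree \<open>t\<close> on both sides replaces arbitrary
  coefficients by homogeneous ones.\<close>

lemma lincombs_homogeneous:
  fixes F :: "'i \<Rightarrow> ('v::finite, 'k::comm_ring_1) mpoly"
  assumes "f \<in> lincombs F A" "f \<in> forms t" "\<And>j. j \<in> A \<Longrightarrow> F j \<in> forms (d j)"
  obtains c where "f = (\<Sum>j\<in>A. c j * F j)" "\<And>j. j \<in> A \<Longrightarrow> c j \<in> forms (t - d j)"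
proof -
  obtain c where c: "f = (\<Sum>j\<in>A. c j * F j)" using assms(1) by (auto simp: lincombs_def)
  have "f = hcomp t f" using assms(2) by (simp add: hcomp_id)
  also have "\<dots> = (\<Sum>j\<in>A. hcomp (t - d j) (c j) * F j)"
    unfolding c hcomp_sum using assms(3) by (intro sum.cong) (auto simp: hcomp_mult')
  finally show thesis by (rule that) auto
qed

section \<open>Ideals generated by variables\<close>

definition var :: "'v \<Rightarrow> ('v, 'k::comm_ring_1) mpoly" where
  "var v = mterm (Poly_Mapping.single v 1) 1"

lemma var_forms [simp]: "var v \<in> forms 1"
  by (simp add: var_def forms_mterm)

lemma single_le_split: "Poly_Mapping.lookup m v \<ge> k \<Longrightarrow> \<exists>m'. m = Poly_Mapping.single v k + (m' :: 'v monomial)"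
  by (rule exI[of _ "m - Poly_Mapping.single v k"], rule poly_mapping_eqI)
    (auto simp: lookup_add lookup_minus lookup_single when_def)

text \<open>Membership in a monomial ideal is decided monomial by monomial. This turns the
  regularity of the variables into a statement about exponents.\<close>

lemma lincombs_var:
  fixes f :: "('v::finite, 'k::comm_ring_1) mpoly"
  assumes "finite A"
  shows "f \<in> lincombs (\<lambda>j. var (\<nu> j)) A \<longleftrightarrow>
    (\<forall>m\<in>Poly_Mapping.keys f. \<exists>j\<in>A. Poly_Mapping.lookup m (\<nu> j) \<noteq> 0)"
proof
  assume "f \<in> lincombs (\<lambda>j. var (\<nu> j)) A"
  then obtain c where c: "f = (\<Sum>j\<in>A. c j * var (\<nu> j))" by (auto simp: lincombs_def)
  show "\<forall>m\<in>Poly_Mapping.keys f. \<exists>j\<in>A. Poly_Mapping.lookup m (\<nu> j) \<noteq> 0"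
  proof
    fix m assume "m \<in> Poly_Mapping.keys f"
    then have "coef f m \<noteq> 0" by (simp add: in_keys_iff)
    then obtain j where j: "j \<in> A" "coef (c j * var (\<nu> j)) m \<noteq> 0" 
      unfolding c lookup_sum by (meson sum.neutral)
    then have "m \<in> Poly_Mapping.keys (c j * var (\<nu> j))" by (simp add: in_keys_iff)
    then obtain a b where "m = a + b" "b \<in> Poly_Mapping.keys (var (\<nu> j) :: ('v, 'k) mpoly)"
      using keys_mult by blast
    then show "\<exists>j\<in>A. Poly_Mapping.lookup m (\<nu> j) \<noteq> 0" using j(1)
      by (intro bexI[of _ j]) (auto simp: var_def lookup_add)
  qed
next
  assume *: "\<forall>m\<in>Poly_Mapping.keys f. \<exists>j\<in>A. Poly_Mapping.lookup m (\<nu> j) \<noteq> 0"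
  have "mterm m (coef f m) \<in> lincombs (\<lambda>j. var (\<nu> j)) A" if "m \<in> Poly_Mapping.keys f" for m
  proof -
    obtain j where j: "j \<in> A" "Poly_Mapping.lookup m (\<nu> j) \<noteq> 0" using * \<open>m \<in> _\<close> by blast
    then obtain m' where "m = Poly_Mapping.single (\<nu> j) 1 + m'" using single_le_split[of 1 m "\<nu> j"] by auto
    then have "mterm m (coef f m) = mterm m' (coef f m) * var (\<nu> j)"
      by (simp add: var_def mult_single add.commute)
    then show ?thesis using lincombs_mult lincombs_gen[OF assms j(1)] by metis
  qed
  then show "f \<in> lincombs (\<lambda>j. var (\<nu> j)) A"
    by (subst mpoly_expand) (rule lincombs_sum)
qed

text \<open>Multiplication by a variable outside the set leaves the exponents of the variables in
  the set unchanged.\<close>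

lemma var_regular:
  fixes g :: "('v::finite, 'k::comm_ring_1) mpoly"
  assumes "finite A" "\<nu> i \<notin> \<nu> ` A" "var (\<nu> i) * g \<in> lincombs (\<lambda>j. var (\<nu> j)) A"
  shows "g \<in> lincombs (\<lambda>j. var (\<nu> j)) A"
  unfolding lincombs_var[OF assms(1)]
proof
  fix m assume "m \<in> Poly_Mapping.keys g"
  then have "Poly_Mapping.single (\<nu> i) 1 + m \<in> Poly_Mapping.keys (var (\<nu> i) * g)"
    by (simp add: in_keys_iff var_def coef_mterm_mult)
  then obtain j where "j \<in> A" "Poly_Mapping.lookup (Poly_Mapping.single (\<nu> i) 1 + m) (\<nu> j) \<noteq> 0"
    using assms(3) unfolding lincombs_var[OF assms(1)] by blast
  then show "\<exists>j\<in>A. Poly_Mapping.lookup m (\<nu> j) \<noteq> 0"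
    using assms(2) by (intro bexI[of _ j]) (auto simp: lookup_add lookup_single when_def split: if_splits)
qed

lemma irrelevant_lincombs:
  fixes f :: "('v::finite, 'k::comm_ring_1) mpoly"
  assumes "\<nu> ` A = UNIV" "finite A" "f \<in> irrelevant_ideal"
  shows "f \<in> lincombs (\<lambda>j. var (\<nu> j)) A"
  unfolding lincombs_var[OF assms(2)]
proof
  fix m assume m: "m \<in> Poly_Mapping.keys f"
  then have "m \<noteq> 0" using assms(3) by (auto simp: irrelevant_ideal_def in_keys_iff)
  then obtain v where "Poly_Mapping.lookup m v \<noteq> 0" by (metis lookup_zero poly_mapping_eqI)
  then show "\<exists>j\<in>A. Poly_Mapping.lookup m (\<nu> j) \<noteq> 0" using assms(1) by (metis UNIV_I imageE)
qed

section \<open>Koszul homology\<close>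

text \<open>The value of a chain \<open>u\<close> at a set \<open>S\<close> is the coefficient of the exterior product of the basis
  vectors indexed by \<open>S\<close> in increasing order, whence the sign.\<close>

definition koszul_sign :: "nat \<Rightarrow> nat set \<Rightarrow> 'a::comm_ring_1" where
  "koszul_sign j T = (-1) ^ card {t\<in>T. t < j}"

definition koszul_diff :: "(nat \<Rightarrow> 'a::comm_ring_1) \<Rightarrow> nat set \<Rightarrow> (nat set \<Rightarrow> 'a) \<Rightarrow> nat set \<Rightarrow> 'a" where
  "koszul_diff f A u T = (\<Sum>j\<in>A - T. koszul_sign j T * f j * u (insert j T))"

lemma koszul_sign_square: "koszul_sign j T * (koszul_sign j T * x) = x"
  unfolding koszul_sign_def by (simp add: mult.assoc [symmetric] power_add [symmetric] mult_2 [symmetric])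

lemma koszul_sign_empty [simp]: "koszul_sign j {} = 1"
  by (simp add: koszul_sign_def)

lemma koszul_sign_insert:
  assumes "finite T" "j \<notin> T"
  shows "koszul_sign l (insert j T) = (if j < l then - koszul_sign l T else koszul_sign l T)"
proof -
  have "{t \<in> insert j T. t < l} = (if j < l then insert j {t\<in>T. t < l} else {t\<in>T. t < l})" by auto
  then show ?thesis using assms by (simp add: koszul_sign_def)
qed

text \<open>Exactly one of \<open>j < l\<close> and \<open>l < j\<close> holds, so exactly one of
  the two insertions reverses a sign.\<close>

lemma koszul_sign_swap:
  assumes "finite T" "j \<notin> T" "l \<notin> T" "j \<noteq> l"
  shows "koszul_sign l (insert j T) * koszul_sign j T = - (koszul_sign j (insert l T) * koszul_sign l T)"
  using assms by (auto simp: koszul_sign_insert)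

text \<open>Together with the next formula this presents the Koszul complex on
  \<open>insert j A\<close> as the mapping cone of multiplication by \<open>f j\<close> on the
  complex on \<open>A\<close>. A chain splits into its values on subsets of \<open>A\<close> and its
  signed values on sets containing \<open>j\<close>.\<close>

lemma koszul_diff_insert:
  assumes "finite A" "j \<notin> A" "T \<subseteq> A"
  shows "koszul_diff f (insert j A) u T =
    koszul_diff f A u T + f j * (koszul_sign j T * u (insert j T))"
proof -
  have "insert j A - T = insert j (A - T)" using assms by auto
  then show ?thesis using assms by (simp add: koszul_diff_def algebra_simps)
qed

text \<open>The component along \<open>j\<close> is again differentiated over \<open>A\<close>; the
  minus sign is that of the cone and comes from \<open>koszul_sign_swap\<close>.\<close>

lemma koszul_diff_insert2:
  assumes "finite A" "j \<notin> A" "T \<subseteq> A"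
  shows "koszul_diff f (insert j A) u (insert j T) =
    - koszul_sign j T * koszul_diff f A (\<lambda>S. koszul_sign j S * u (insert j S)) T"
proof -
  have T: "finite T" "j \<notin> T" using assms finite_subset by auto
  have "insert j A - insert j T = A - T" using assms by auto
  then have "koszul_diff f (insert j A) u (insert j T) =
      (\<Sum>l\<in>A - T. koszul_sign l (insert j T) * f l * u (insert l (insert j T)))"
    by (simp add: koszul_diff_def)
  also have "\<dots> = (\<Sum>l\<in>A - T. - koszul_sign j T * (koszul_sign l T * f l *
      (koszul_sign j (insert l T) * u (insert j (insert l T)))))"
  proof (rule sum.cong)
    fix l assume l: "l \<in> A - T"
    then have "j \<noteq> l" using assms by auto
    have "koszul_sign l (insert j T) = koszul_sign j T * (koszul_sign l (insert j T) * koszul_sign j T :: 'a)"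
      using koszul_sign_square[of j T "koszul_sign l (insert j T)"]
      by (metis mult.commute mult.assoc)
    also have "\<dots> = - koszul_sign j T * (koszul_sign j (insert l T) * koszul_sign l T)"
      using l T \<open>j \<noteq> l\<close> by (subst koszul_sign_swap) auto
    finally show "koszul_sign l (insert j T) * f l * u (insert l (insert j T)) =
      - koszul_sign j T * (koszul_sign l T * f l * (koszul_sign j (insert l T) * u (insert j (insert l T))))"
      by (simp add: ac_simps insert_commute)
  qed simp
  finally show ?thesis by (simp add: koszul_diff_def sum_distrib_left)
qed

lemma koszul_diff_cong:
  "(\<And>j. j \<in> A - T \<Longrightarrow> u (insert j T) = w (insert j T)) \<Longrightarrow> koszul_diff f A u T = koszul_diff f A w T"
  by (simp add: koszul_diff_def)

lemma koszul_diff_add: "koszul_diff f A (\<lambda>S. u S + w S) T = koszul_diff f A u T + koszul_diff f A w T"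
  by (simp add: koszul_diff_def algebra_simps sum.distrib)

lemma koszul_diff_scale: "koszul_diff f A (\<lambda>S. c * u S) T = c * koszul_diff f A u T"
  by (simp add: koszul_diff_def algebra_simps sum_distrib_left)

lemma koszul_diff_uminus: "koszul_diff f A (\<lambda>S. - u S) T = - koszul_diff f A u T"
  by (simp add: koszul_diff_def sum_negf)

lemma koszul_diff_0 [simp]: "koszul_diff f A (\<lambda>S. 0) T = 0"
  by (simp add: koszul_diff_def)

text \<open>Induction on \<open>A\<close> through the cone formulas. If \<open>j\<close> is not in
  \<open>T\<close>, the two mixed terms containing \<open>f j\<close> cancel because of the minus
  sign; if \<open>j\<close> is in \<open>T\<close>, the claim reduces to the complex on
  \<open>A\<close>.\<close>

lemma koszul_diff_diff:
  assumes "finite A" "T \<subseteq> A"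
  shows "koszul_diff f A (koszul_diff f A u) T = 0"
  using assms
proof (induction A arbitrary: u T rule: finite_induct)
  case empty
  then show ?case by (simp add: koszul_diff_def)
next
  case (insert j A)
  let ?w = "\<lambda>S. koszul_sign j S * u (insert j S)"
  let ?d = "koszul_diff f (insert j A)" and ?e = "koszul_diff f A"
  have 1: "?d (?d u) T = 0" if T: "T \<subseteq> A" for T u
  proof -
    let ?w = "\<lambda>S. koszul_sign j S * u (insert j S)"
    have "?e (?d u) T = ?e (\<lambda>S. ?e u S + f j * ?w S) T"
      by (rule koszul_diff_cong) (use insert T in \<open>auto intro: koszul_diff_insert\<close>)
    then have "?d (?d u) T = f j * ?e ?w T + f j * (koszul_sign j T * ?d u (insert j T))"
      using insert T by (simp add: koszul_diff_insert koszul_diff_add koszul_diff_scale)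
    also have "koszul_sign j T * ?d u (insert j T) = - ?e ?w T"
      using insert T by (simp add: koszul_diff_insert2 koszul_sign_square)
    finally show ?thesis by simp
  qed
  show ?case
  proof (cases "j \<in> T")
    case False
    then show ?thesis using 1 insert.prems by auto
  next
    case True
    define T' where "T' = T - {j}"
    have T': "T = insert j T'" "j \<notin> T'" "T' \<subseteq> A"
      using True insert.prems by (auto simp: T'_def)
    have "?d (?d u) T = - koszul_sign j T' * ?e (\<lambda>S. koszul_sign j S * ?d u (insert j S)) T'"
      using T' insert by (simp add: koszul_diff_insert2)
    also have "?e (\<lambda>S. koszul_sign j S * ?d u (insert j S)) T' = ?e (\<lambda>S. - ?e ?w S) T'"
      by (rule koszul_diff_cong) (use insert T' in \<open>simp add: koszul_diff_insert2 koszul_sign_square\<close>)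
    also have "\<dots> = 0" using insert.IH[OF T'(3)] by (simp add: koszul_diff_uminus)
    finally show ?thesis by simp
  qed
qed

definition koszul_homogeneous ::
    "(nat \<Rightarrow> int) \<Rightarrow> nat set \<Rightarrow> nat \<Rightarrow> int \<Rightarrow> (nat set \<Rightarrow> ('v, 'k::zero) mpoly) \<Rightarrow> bool" where
  "koszul_homogeneous d A i t u \<longleftrightarrow> (\<forall>S\<subseteq>A. card S = i \<longrightarrow> u S \<in> forms (t - (\<Sum>j\<in>S. d j)))"

text \<open>Vanishing of the Koszul homology $H_i$ in degree \<open>t\<close>; only the values of a chain on the
  subsets of \<open>A\<close> with \<open>i\<close> elements matter.\<close>

definition koszul_exact ::
    "(nat \<Rightarrow> int) \<Rightarrow> (nat \<Rightarrow> ('v, 'k::comm_ring_1) mpoly) \<Rightarrow> nat set \<Rightarrow> nat \<Rightarrow> int \<Rightarrow> bool" where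
  "koszul_exact d f A i t \<longleftrightarrow>
     (\<forall>u. koszul_homogeneous d A i t u \<longrightarrow>
        (\<forall>T\<subseteq>A. Suc (card T) = i \<longrightarrow> koszul_diff f A u T = 0) \<longrightarrow>
        (\<exists>w. koszul_homogeneous d A (Suc i) t w \<and> (\<forall>S\<subseteq>A. card S = i \<longrightarrow> u S = koszul_diff f A w S)))"

lemma koszul_exact_empty: "i \<ge> 1 \<Longrightarrow> koszul_exact d f {} i t"
  by (auto simp: koszul_exact_def koszul_homogeneous_def)

lemma forms_koszul_sign: "u \<in> forms t \<Longrightarrow> koszul_sign j S * u \<in> forms t"
  for u :: "('v, 'k::comm_ring_1) mpoly"
  by (cases "even (card {s\<in>S. s < j})") (auto simp: koszul_sign_def forms_uminus)

text \<open>This is the long exact sequence of the cone, chased by hand: H_i on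
  \<open>insert j A\<close> sits between H_i and the shifted H_{i-1} on \<open>A\<close>. For
  \<open>i = 1\<close> the latter is H_0, the quotient by the ideal, which does not vanish; there
  the injectivity of \<open>f j\<close> on the quotient takes over.\<close>

lemma koszul_exact_insert:
  fixes f :: "nat \<Rightarrow> ('v::finite, 'k::comm_ring_1) mpoly"
  assumes A: "finite A" "j \<notin> A" and f: "\<And>l. l \<in> insert j A \<Longrightarrow> f l \<in> forms (d l)"
    and ex: "koszul_exact d f A i t"
    and ex': "i \<ge> 2 \<Longrightarrow> koszul_exact d f A (i - 1) (t - d j)"
    and inj: "\<And>g. i = 1 \<Longrightarrow> g \<in> forms (t - d j) \<Longrightarrow> f j * g \<in> lincombs f A \<Longrightarrow> g \<in> lincombs f A"
    and i: "i \<ge> 1"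
  shows "koszul_exact d f (insert j A) i t"
  unfolding koszul_exact_def
proof (intro allI impI)
  fix u
  let ?B = "insert j A"
  assume hom: "koszul_homogeneous d ?B i t u"
    and cycle: "\<forall>T\<subseteq>?B. Suc (card T) = i \<longrightarrow> koszul_diff f ?B u T = 0"
  \<comment> \<open>The component of \<open>u\<close> along \<open>j\<close>. It is a cycle over
    \<open>A\<close>, one homological degree lower, and its degree drops by
    \<open>d j\<close>.\<close>
  define w where "w S = koszul_sign j S * u (insert j S)" for S
  have fin: "finite T" "j \<notin> T" if "T \<subseteq> A" for T using that A finite_subset by auto
  have cycle1: "koszul_diff f A u T + f j * w T = 0" if "T \<subseteq> A" "Suc (card T) = i" for T
    using cycle that koszul_diff_insert[OF A that(1), of f u] by (auto simp: w_def)
  have w_hom: "koszul_homogeneous d A (i - 1) (t - d j) w"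
    unfolding koszul_homogeneous_def
  proof (intro allI impI)
    fix S assume S: "S \<subseteq> A" "card S = i - 1"
    have "u (insert j S) \<in> forms (t - (\<Sum>l\<in>insert j S. d l))"
      using hom[unfolded koszul_homogeneous_def, rule_format, of "insert j S"] S i fin[OF S(1)] by auto
    then show "w S \<in> forms (t - d j - (\<Sum>l\<in>S. d l))"
      using fin[OF S(1)] by (simp add: w_def forms_koszul_sign algebra_simps)
  qed
  have w_cycle: "koszul_diff f A w T = 0" if T: "T \<subseteq> A" "Suc (Suc (card T)) = i" for T
  proof -
    have "insert j T \<subseteq> ?B" "Suc (card (insert j T)) = i" using T fin[OF T(1)] by auto
    then have "koszul_diff f ?B u (insert j T) = 0" using cycle by blast
    then have "koszul_sign j T * (koszul_sign j T * koszul_diff f A w T) = 0"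
      unfolding koszul_diff_insert2[OF A T(1)] w_def by simp
    then show ?thesis by (simp add: koszul_sign_square)
  qed
  \<comment> \<open>A chain bounding \<open>w\<close>. For \<open>i = 1\<close> the cycle condition
    says that \<open>f j * w {}\<close> lies in the ideal of \<open>A\<close>; by injectivity so
    does \<open>w {}\<close>, and the coefficients of such a representation form
    \<open>w'\<close>.\<close>
  obtain w' where w': "koszul_homogeneous d A i (t - d j) w'"
    "\<And>S. S \<subseteq> A \<Longrightarrow> Suc (card S) = i \<Longrightarrow> w S = koszul_diff f A w' S"
  proof (cases "i = 1")
    case True
    have "w {} \<in> forms (t - d j)"
      using w_hom[unfolded koszul_homogeneous_def, rule_format, of "{}"] True by simp
    moreover have "f j * w {} \<in> lincombs f A"
    proof -
      have "f j * w {} = (\<Sum>l\<in>A. (- u {l}) * f l)"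
        using cycle1[of "{}"] True
        by (simp add: koszul_diff_def add_eq_0_iff sum_negf mult.commute)
      then show ?thesis by (rule lincombsI)
    qed
    ultimately obtain c where c: "w {} = (\<Sum>l\<in>A. c l * f l)" "\<And>l. l \<in> A \<Longrightarrow> c l \<in> forms (t - d j - d l)"
      using inj[OF True, of "w {}"] lincombs_homogeneous[of "w {}" f A "t - d j" d] f by blast
    show ?thesis
    proof (rule that[of "\<lambda>S. c (the_elem S)"])
      show "koszul_homogeneous d A i (t - d j) (\<lambda>S. c (the_elem S))"
        unfolding koszul_homogeneous_def True using c(2) by (auto simp: card_1_singleton_iff)
      show "w S = koszul_diff f A (\<lambda>S. c (the_elem S)) S" if "S \<subseteq> A" "Suc (card S) = i" for S
        using that True fin[of S] c(1) by (simp add: koszul_diff_def mult.commute)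
    qed
  next
    case False
    then obtain i' where i': "i = Suc i'" "koszul_exact d f A i' (t - d j)"
      using ex' i by (cases i) auto
    have "\<forall>T\<subseteq>A. Suc (card T) = i' \<longrightarrow> koszul_diff f A w T = 0"
      using w_cycle i'(1) by blast
    then obtain w' where w': "koszul_homogeneous d A (Suc i') (t - d j) w'"
      "\<forall>S\<subseteq>A. card S = i' \<longrightarrow> w S = koszul_diff f A w' S"
      using i'(2)[unfolded koszul_exact_def, rule_format, of w] w_hom i'(1) by auto
    show ?thesis
    proof (rule that)
      show "koszul_homogeneous d A i (t - d j) w'" using w'(1) i'(1) by simp
      show "w S = koszul_diff f A w' S" if "S \<subseteq> A" "Suc (card S) = i" for S
        using w'(2) that i'(1) by simp
    qed
  qed
  \<comment> \<open>Since \<open>w'\<close> bounds \<open>w\<close>, adding \<open>f j * w'\<close>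
    turns the part of \<open>u\<close> over \<open>A\<close> into a cycle over
    \<open>A\<close>.\<close>
  have "koszul_homogeneous d A i t (\<lambda>S. u S + f j * w' S)"
    unfolding koszul_homogeneous_def
  proof (intro allI impI)
    fix S assume S: "S \<subseteq> A" "card S = i"
    have "f j * w' S \<in> forms (d j + (t - d j - (\<Sum>j\<in>S. d j)))"
      using S w'(1) f by (intro forms_mult) (auto simp: koszul_homogeneous_def)
    moreover have "u S \<in> forms (t - (\<Sum>j\<in>S. d j))"
      using S hom by (auto simp: koszul_homogeneous_def)
    ultimately show "u S + f j * w' S \<in> forms (t - (\<Sum>j\<in>S. d j))" by (simp add: forms_add)
  qed
  moreover have "koszul_diff f A (\<lambda>S. u S + f j * w' S) T = 0" if "T \<subseteq> A" "Suc (card T) = i" for T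
    using cycle1[OF that] w'(2)[OF that] by (simp add: koszul_diff_add koszul_diff_scale)
  ultimately obtain v where v: "koszul_homogeneous d A (Suc i) t v"
    "\<And>S. S \<subseteq> A \<Longrightarrow> card S = i \<Longrightarrow> u S + f j * w' S = koszul_diff f A v S"
    using ex unfolding koszul_exact_def by blast
  \<comment> \<open>The bounding chain of the cone is put together from \<open>v\<close> on subsets
    of \<open>A\<close> and from \<open>- w'\<close>, with sign, along \<open>j\<close>.\<close>
  define y where "y S = (if j \<in> S then - (koszul_sign j (S - {j}) * w' (S - {j})) else v S)" for S
  show "\<exists>y. koszul_homogeneous d ?B (Suc i) t y \<and> (\<forall>S\<subseteq>?B. card S = i \<longrightarrow> u S = koszul_diff f ?B y S)"
  proof (intro exI[of _ y] conjI allI impI)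
    show "koszul_homogeneous d ?B (Suc i) t y"
      unfolding koszul_homogeneous_def
    proof (intro allI impI)
      fix S assume S: "S \<subseteq> ?B" "card S = Suc i"
      show "y S \<in> forms (t - (\<Sum>j\<in>S. d j))"
      proof (cases "j \<in> S")
        case True
        have fS: "finite S" using S A(1) by (metis card.infinite nat.simps(3))
        have "S - {j} \<subseteq> A" "card (S - {j}) = i" using S True fS by auto
        then have "w' (S - {j}) \<in> forms (t - d j - (\<Sum>j\<in>S - {j}. d j))"
          using w'(1) by (auto simp: koszul_homogeneous_def)
        moreover have "(\<Sum>j\<in>S. d j) = d j + (\<Sum>j\<in>S - {j}. d j)" using True fS by (rule sum.remove[rotated])
        ultimately show ?thesis using True
          by (auto simp: y_def diff_diff_add intro!: forms_uminus forms_koszul_sign)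
      next
        case False
        then show ?thesis using S v(1) by (auto simp: y_def koszul_homogeneous_def)
      qed
    qed
    fix S assume S: "S \<subseteq> ?B" "card S = i"
    have y1: "y (insert j T) = - (koszul_sign j T * w' T)" if "T \<subseteq> A" for T
      using fin[OF that] by (simp add: y_def)
    show "u S = koszul_diff f ?B y S"
    proof (cases "j \<in> S")
      case False
      then have SA: "S \<subseteq> A" using S by auto
      have "koszul_diff f A y S = koszul_diff f A v S"
        by (rule koszul_diff_cong) (use False A in \<open>auto simp: y_def\<close>)
      then have "koszul_diff f ?B y S = koszul_diff f A v S - f j * w' S"
        by (simp add: koszul_diff_insert[OF A SA] y1[OF SA] koszul_sign_square)
      then show ?thesis using v(2)[OF SA S(2)] by (metis add_diff_cancel_right')
    next
      case True
      define T where "T = S - {j}"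
      have T: "S = insert j T" "j \<notin> T" "T \<subseteq> A"
        using True S by (auto simp: T_def)
      have cT: "Suc (card T) = i" using S T fin[OF T(3)] by auto
      have "koszul_diff f A (\<lambda>S. koszul_sign j S * y (insert j S)) T = koszul_diff f A (\<lambda>S. - w' S) T"
        by (rule koszul_diff_cong, subst y1) (use T in \<open>auto simp: koszul_sign_square\<close>)
      then have "koszul_diff f ?B y S = koszul_sign j T * koszul_diff f A w' T"
        unfolding T(1) koszul_diff_insert2[OF A T(3)] by (simp add: koszul_diff_uminus)
      also have "\<dots> = u S"
        using w'(2)[OF T(3) cT] by (simp add: w_def T(1) flip: w'(2)[OF T(3) cT]) (simp add: koszul_sign_square)
      finally show ?thesis by simp
    qed
  qed
qed

text \<open>The bound on the degrees grows with the homological index because every form has positive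
  degree.\<close>

lemma koszul_exact_le:
  fixes f :: "nat \<Rightarrow> ('v::finite, 'k::comm_ring_1) mpoly"
  assumes js: "distinct js" and f: "\<And>l. l \<in> set js \<Longrightarrow> f l \<in> forms (d l)"
    and d: "\<And>l. l \<in> set js \<Longrightarrow> d l \<ge> 1"
    and inj: "\<And>s t g. s < length js \<Longrightarrow> t \<le> c \<Longrightarrow> g \<in> forms (t - d (js ! s)) \<Longrightarrow>
      f (js ! s) * g \<in> lincombs f (set (take s js)) \<Longrightarrow> g \<in> lincombs f (set (take s js))"
    and i: "i \<ge> 1" "t \<le> c + int i - 1"
  shows "koszul_exact d f (set js) i t"
  using assms
proof (induction js arbitrary: i t rule: rev_induct)
  case Nil
  then show ?case by (simp add: koszul_exact_empty)
next
  case (snoc j js)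
  have IH: "koszul_exact d f (set js) i t" if "i \<ge> 1" "t \<le> c + int i - 1" for i t
  proof (rule snoc.IH[OF _ _ _ _ that])
    fix s t g
    assume s: "s < length js" "t \<le> c" "g \<in> forms (t - d (js ! s))"
      "f (js ! s) * g \<in> lincombs f (set (take s js))"
    then show "g \<in> lincombs f (set (take s js))"
      using snoc.prems(4)[of s t g] by (simp add: nth_append)
  qed (use snoc.prems in auto)
  have "koszul_exact d f (insert j (set js)) i t"
  proof (rule koszul_exact_insert)
    show "koszul_exact d f (set js) i t" by (rule IH) (use snoc.prems in auto)
    show "koszul_exact d f (set js) (i - 1) (t - d j)" if "i \<ge> 2"
      by (rule IH) (use that snoc.prems(3)[of j] snoc.prems(5,6) in auto)
    show "g \<in> lincombs f (set js)"
      if "i = 1" "g \<in> forms (t - d j)" "f j * g \<in> lincombs f (set js)" for g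
      using snoc.prems(4)[of "length js" t g] that snoc.prems(6) by simp
  qed (use snoc.prems in auto)
  then show ?case by simp
qed

lemma koszul_exact_var:
  fixes \<nu> :: "nat \<Rightarrow> 'v::finite"
  assumes "inj_on \<nu> {..<n}" "i \<ge> 1"
  shows "koszul_exact (\<lambda>_. 1) (\<lambda>j. var (\<nu> j) :: ('v, 'k::comm_ring_1) mpoly) {..<n} i t"
proof -
  have "koszul_exact (\<lambda>_. 1) (\<lambda>j. var (\<nu> j) :: ('v, 'k) mpoly) (set [0..<n]) i t"
  \<comment> \<open>Variables are regular in every degree, so the bound \<open>c\<close> may be
    chosen as \<open>t\<close> itself.\<close>
  proof (rule koszul_exact_le[where c = t])
    fix s t' and g :: "('v, 'k) mpoly"
    let ?L = "lincombs (\<lambda>j. var (\<nu> j)) (set (take s [0..<n])) :: ('v, 'k) mpoly set"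
    assume s: "s < length [0..<n]" "var (\<nu> ([0..<n] ! s)) * g \<in> ?L"
    then have "\<nu> s \<notin> \<nu> ` set (take s [0..<n])"
      using assms(1) by (fastforce simp: take_upt inj_on_def)
    then show "g \<in> ?L" using s var_regular[of "set (take s [0..<n])" \<nu> s g] by simp
  qed (use assms in auto)
  then show ?thesis by (simp add: atLeast_upt)
qed

section \<open>Linear independence of families\<close>

text \<open>Vectors are coordinate functions, so the coefficients of a polynomial form a vector as
  they stand. Families are indexed: a vector that occurs twice makes the family dependent.\<close>

definition indep_family :: "('b \<Rightarrow> 'm \<Rightarrow> 'k::field) \<Rightarrow> 'b set \<Rightarrow> bool" where
  "indep_family v B \<longleftrightarrow> (\<forall>c. (\<forall>m. (\<Sum>b\<in>B. c b * v b m) = 0) \<longrightarrow> (\<forall>b\<in>B. c b = 0))"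

definition in_span :: "('b \<Rightarrow> 'm \<Rightarrow> 'k::field) \<Rightarrow> 'b set \<Rightarrow> ('m \<Rightarrow> 'k) \<Rightarrow> bool" where
  "in_span v B x \<longleftrightarrow> (\<exists>c. \<forall>m. x m = (\<Sum>b\<in>B. c b * v b m))"

lemma indep_familyD: "indep_family v B \<Longrightarrow> (\<And>m. (\<Sum>b\<in>B. c b * v b m) = 0) \<Longrightarrow> b \<in> B \<Longrightarrow> c b = 0"
  by (auto simp: indep_family_def)

lemma in_spanI: "(\<And>m. x m = (\<Sum>b\<in>B. c b * v b m)) \<Longrightarrow> in_span v B x"
  unfolding in_span_def by (rule exI, rule allI)

lemma indep_family_empty [simp]: "indep_family v {}"
  by (simp add: indep_family_def)

lemma indep_family_cong:
  "(\<And>b. b \<in> B \<Longrightarrow> v b = w b) \<Longrightarrow> indep_family v B \<longleftrightarrow> indep_family w B"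
  by (simp add: indep_family_def)

text \<open>One step of Gaussian elimination with pivot \<open>v b0 m0\<close>. Cross-multiplying
  instead of dividing keeps the new entries polynomial in the old ones, on which the openness of
  independence rests.\<close>

lemma indep_family_eliminate:
  assumes B: "finite B" "b0 \<in> B" "v b0 m0 \<noteq> 0"
  shows "indep_family v B \<longleftrightarrow> indep_family (\<lambda>b m. v b0 m0 * v b m - v b m0 * v b0 m) (B - {b0})"
    (is "_ \<longleftrightarrow> indep_family ?w ?B")
proof
  have split: "(\<Sum>b\<in>B. c b * v b m) = c b0 * v b0 m + (\<Sum>b\<in>?B. c b * v b m)" for c m
    using B by (simp add: sum.remove)
  have sw: "(\<Sum>b\<in>?B. c b * ?w b m) =
      v b0 m0 * (\<Sum>b\<in>?B. c b * v b m) - (\<Sum>b\<in>?B. c b * v b m0) * v b0 m" for c m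
    by (simp add: sum_distrib_left sum_distrib_right sum_subtractf algebra_simps)
  {
    assume ind: "indep_family v B"
    show "indep_family ?w ?B"
      unfolding indep_family_def
    proof (intro allI impI ballI)
      fix c b assume c: "\<forall>m. (\<Sum>b\<in>?B. c b * ?w b m) = 0" and b: "b \<in> ?B"
      define c' where "c' b = (if b = b0 then - (\<Sum>b\<in>?B. c b * v b m0) else v b0 m0 * c b)" for b
      have "(\<Sum>b\<in>B. c' b * v b m) = 0" for m
      proof -
        have "(\<Sum>b\<in>?B. c' b * v b m) = v b0 m0 * (\<Sum>b\<in>?B. c b * v b m)"
          unfolding sum_distrib_left by (intro sum.cong) (auto simp: c'_def)
        then show ?thesis using c sw[of c m] by (simp add: split c'_def)
      qed
      then have "c' b = 0" using ind b indep_familyD[of v B c' b] by simp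
      then show "c b = 0" using b B by (simp add: c'_def)
    qed
  next
    assume ind: "indep_family ?w ?B"
    show "indep_family v B"
      unfolding indep_family_def
    proof (intro allI impI)
      fix c assume c: "\<forall>m. (\<Sum>b\<in>B. c b * v b m) = 0"
      have 1: "(\<Sum>b\<in>?B. c b * v b m) = - (c b0 * v b0 m)" for m
        using c split[of c m] by (simp add: add_eq_0_iff)
      have "(\<Sum>b\<in>?B. c b * ?w b m) = 0" for m by (simp add: sw 1)
      then have 2: "c b = 0" if "b \<in> ?B" for b using indep_familyD[OF ind, of c] that by blast
      then have "c b0 = 0" using 1[of m0] B by simp
      then show "\<forall>b\<in>B. c b = 0" using 2 by auto
    qed
  }
qed

text \<open>Induction on the coordinates: either all vectors vanish at \<open>m0\<close>, or one of
  them serves as pivot and is removed together with the coordinate.\<close>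

lemma indep_family_card_le:
  assumes "finite M" "finite B" "indep_family v B" "\<And>b m. b \<in> B \<Longrightarrow> m \<notin> M \<Longrightarrow> v b m = 0"
  shows "card B \<le> card M"
  using assms
proof (induction M arbitrary: v B rule: finite_induct)
  case empty
  then have "\<forall>b\<in>B. (1 :: 'c) = 0" 
    by (intro ballI indep_familyD[OF empty.prems(2), of "\<lambda>_. 1"]) auto
  then show ?case by auto
next
  case (insert m0 M)
  show ?case
  proof (cases "\<forall>b\<in>B. v b m0 = 0")
    case True
    have "v b m = 0" if "b \<in> B" "m \<notin> M" for b m
      using True insert.prems(3)[of b m] that by (cases "m = m0") auto
    then have "card B \<le> card M" using insert.prems by (intro insert.IH[of B v]) auto
    then show ?thesis using insert by simp
  next
    case False
    then obtain b0 where b0: "b0 \<in> B" "v b0 m0 \<noteq> 0" by auto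
    have "v b0 m0 * v b m - v b m0 * v b0 m = 0" if "b \<in> B - {b0}" "m \<notin> M" for b m
      using insert.prems(3)[of b m] insert.prems(3)[of b0 m] b0 that by (cases "m = m0") auto
    then have "card (B - {b0}) \<le> card M"
      using insert.prems b0
      by (intro insert.IH[OF _ iffD1[OF indep_family_eliminate[of B b0 v m0]]]) blast+
    then show ?thesis using insert b0 by simp
  qed
qed

lemma indep_family_insert:
  assumes B: "finite B" "indep_family v B" "b \<notin> B" "\<not> in_span v B (v b)"
  shows "indep_family v (insert b B)"
  unfolding indep_family_def
proof (intro allI impI)
  fix c assume c: "\<forall>m. (\<Sum>b\<in>insert b B. c b * v b m) = 0"
  then have c': "c b * v b m + (\<Sum>b\<in>B. c b * v b m) = 0" for m using B by simp
  have "c b = 0"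
  proof (rule ccontr)
    assume nz: "c b \<noteq> 0"
    have "v b m = (\<Sum>b'\<in>B. (- c b' / c b) * v b' m)" for m
    proof -
      have "c b * (\<Sum>b'\<in>B. (- c b' / c b) * v b' m) = - (\<Sum>b\<in>B. c b * v b m)"
        unfolding sum_distrib_left sum_negf [symmetric] by (intro sum.cong) (use nz in auto)
      also have "\<dots> = c b * v b m" using c'[of m] by (simp add: add_eq_0_iff2)
      finally show ?thesis using nz by simp
    qed
    then have "in_span v B (v b)" by (rule in_spanI)
    then show False using B(4) by simp
  qed
  moreover have "c b' = 0" if "b' \<in> B" for b'
    by (rule indep_familyD[OF B(2) _ that]) (use c' \<open>c b = 0\<close> in simp)
  ultimately show "\<forall>b\<in>insert b B. c b = 0" by auto
qed

lemma indep_family_image: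
  assumes "inj_on h B"
  shows "indep_family v (h ` B) \<longleftrightarrow> indep_family (\<lambda>b. v (h b)) B"
proof
  assume *: "indep_family v (h ` B)"
  show "indep_family (\<lambda>b. v (h b)) B"
    unfolding indep_family_def
  proof (intro allI impI ballI)
    fix c b assume c: "\<forall>m. (\<Sum>b\<in>B. c b * v (h b) m) = 0" "b \<in> B"
    have "(\<Sum>b\<in>h ` B. c (the_inv_into B h b) * v b m) = 0" for m
      using c assms by (simp add: sum.reindex the_inv_into_f_f)
    from indep_familyD[OF *, of "\<lambda>b. c (the_inv_into B h b)", OF this, of "h b"]
    show "c b = 0" using c(2) assms by (simp add: the_inv_into_f_f)
  qed
next
  assume *: "indep_family (\<lambda>b. v (h b)) B"
  show "indep_family v (h ` B)"
    unfolding indep_family_def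
  proof (intro allI impI ballI)
    fix c b assume c: "\<forall>m. (\<Sum>b\<in>h ` B. c b * v b m) = 0" "b \<in> h ` B"
    then obtain b' where b': "b = h b'" "b' \<in> B" by blast
    have "(\<Sum>b\<in>B. c (h b) * v (h b) m) = 0" for m using c(1) assms by (simp add: sum.reindex)
    from indep_familyD[OF *, of "\<lambda>b. c (h b)", OF this b'(2)] show "c b = 0" by (simp add: b'(1))
  qed
qed

text \<open>Otherwise \<open>x\<close> could be joined to the family, with index
  \<open>None\<close>, and there would be more independent vectors than coordinates.\<close>

lemma in_span_full:
  assumes M: "finite M" and B: "finite B" "indep_family v B" "card M \<le> card B"
    and supp: "\<And>b m. b \<in> B \<Longrightarrow> m \<notin> M \<Longrightarrow> v b m = 0" "\<And>m. m \<notin> M \<Longrightarrow> x m = 0"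
  shows "in_span v B x"
proof (rule ccontr)
  assume n: "\<not> in_span v B x"
  let ?v = "case_option x v"
  have i: "indep_family ?v (Some ` B)" using B by (simp add: indep_family_image)
  have "\<not> in_span ?v (Some ` B) (?v None)"
  proof
    assume "in_span ?v (Some ` B) (?v None)"
    then obtain c where "x m = (\<Sum>b\<in>B. c (Some b) * v b m)" for m
      by (auto simp: in_span_def sum.reindex)
    then have "in_span v B x" by (rule in_spanI)
    then show False using n by simp
  qed
  then have "indep_family ?v (insert None (Some ` B))"
    using i B by (intro indep_family_insert) auto
  then have "card (insert None (Some ` B)) \<le> card M"
    by (rule indep_family_card_le[OF M, rotated]) (use B supp in \<open>auto split: option.splits\<close>)
  then show False using B by (simp add: card_image)
qed

text \<open>The rows of coefficients that express the unit vectors are independent, because a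
  relation among these rows is a relation among the unit vectors. The rows live on the index set
  \<open>B\<close>.\<close>

lemma in_span_card_ge:
  fixes v :: "'b \<Rightarrow> 'm \<Rightarrow> 'k::field"
  assumes M: "finite M" and B: "finite B"
    and sp: "\<And>m0. m0 \<in> M \<Longrightarrow> in_span v B (\<lambda>m. if m = m0 then 1 else 0)"
  shows "card M \<le> card B"
proof -
  have "\<forall>m0\<in>M. \<exists>c. \<forall>m. (if m = m0 then 1 else 0) = (\<Sum>b\<in>B. c b * v b m)"
    using sp unfolding in_span_def by blast
  from bchoice[OF this]
  obtain c where c: "\<And>m0 m. m0 \<in> M \<Longrightarrow> (if m = m0 then 1 else 0) = (\<Sum>b\<in>B. c m0 b * v b m)"
    by blast
  have "indep_family (\<lambda>m0 b. if b \<in> B then c m0 b else 0) M"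
    unfolding indep_family_def
  proof (intro allI impI ballI)
    fix d m assume d: "\<forall>b. (\<Sum>m0\<in>M. d m0 * (if b \<in> B then c m0 b else 0)) = 0" and m: "m \<in> M"
    have "d m = (\<Sum>m0\<in>M. if m = m0 then d m0 else 0)" using m M by simp
    also have "\<dots> = (\<Sum>m0\<in>M. d m0 * (if m = m0 then 1 else 0))" by (rule sum.cong) auto
    also have "\<dots> = (\<Sum>m0\<in>M. \<Sum>b\<in>B. d m0 * (c m0 b * v b m))"
      using c by (simp add: sum_distrib_left)
    also have "\<dots> = (\<Sum>b\<in>B. (\<Sum>m0\<in>M. d m0 * (if b \<in> B then c m0 b else 0)) * v b m)"
      by (subst sum.swap) (simp add: sum_distrib_right mult.assoc)
    also have "\<dots> = 0"
    proof (rule sum.neutral, rule ballI)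
      fix b assume "b \<in> B"
      then show "(\<Sum>m0\<in>M. d m0 * (if b \<in> B then c m0 b else 0)) * v b m = 0"
        using d[rule_format, of b] by (metis mult_zero_left)
    qed
    finally show "d m = 0" .
  qed
  then show ?thesis by (rule indep_family_card_le[OF B M]) auto
qed

lemma in_span_trans:
  assumes "\<And>b. b \<in> C \<Longrightarrow> in_span v B (v b)" "in_span v C x"
  shows "in_span v B x"
proof -
  have "\<forall>b\<in>C. \<exists>c. \<forall>m. v b m = (\<Sum>b'\<in>B. c b' * v b' m)"
    using assms(1) unfolding in_span_def by blast
  from bchoice[OF this]
  obtain e where e: "\<And>b m. b \<in> C \<Longrightarrow> v b m = (\<Sum>b'\<in>B. e b b' * v b' m)"
    by blast
  obtain c where c: "\<And>m. x m = (\<Sum>b\<in>C. c b * v b m)" using assms(2) unfolding in_span_def by auto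
  have "x m = (\<Sum>b'\<in>B. (\<Sum>b\<in>C. c b * e b b') * v b' m)" for m
    unfolding c sum_distrib_right
    by (subst sum.swap) (simp add: e[symmetric] sum_distrib_left [symmetric] mult.assoc)
  then show ?thesis by (rule in_spanI)
qed

lemma in_span_self: "finite B \<Longrightarrow> b \<in> B \<Longrightarrow> in_span v B (v b)"
  unfolding in_span_def by (rule exI[of _ "\<lambda>b'. if b' = b then 1 else 0"])
    (simp add: if_distrib[of "\<lambda>x. x * _"] cong: if_cong)

lemma maximal_indep_family:
  assumes "finite C" "B \<subseteq> C" "indep_family v B"
  obtains B' where "B \<subseteq> B'" "B' \<subseteq> C" "indep_family v B'" "\<And>b. b \<in> C \<Longrightarrow> in_span v B' (v b)"
proof -
  let ?P = "\<lambda>B'. B \<subseteq> B' \<and> B' \<subseteq> C \<and> indep_family v B'"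
  obtain B' where B': "?P B'" "\<And>B''. ?P B'' \<Longrightarrow> card B'' \<le> card B'"
    using ex_has_greatest_nat[of ?P B card "Suc (card C)"] assms
    by (metis card_mono less_Suc_eq_le order.refl)
  have fin: "finite B'" using B' assms finite_subset by auto
  have "in_span v B' (v b)" if "b \<in> C" for b
  proof (rule ccontr)
    assume n: "\<not> in_span v B' (v b)"
    then have "b \<notin> B'" using in_span_self[OF fin] by blast
    moreover have "?P (insert b B')" using indep_family_insert[OF fin _ \<open>b \<notin> B'\<close> n] B' that by auto
    ultimately show False using B'(2)[of "insert b B'"] fin by simp
  qed
  then show thesis using that B' by blast
qed

section \<open>Regular functions on the space of tuples of forms\<close>

lemma mpoly_eval_superset:
  assumes "finite M" "Poly_Mapping.keys p \<subseteq> M"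
  shows "mpoly_eval x p = (\<Sum>m\<in>M. Poly_Mapping.lookup p m *
     (\<Prod>v\<in>Poly_Mapping.keys m. x v ^ Poly_Mapping.lookup m v))"
  unfolding mpoly_eval_def by (rule sum.mono_neutral_left) (use assms in \<open>auto simp: in_keys_iff\<close>)

lemma mpoly_eval_add: "mpoly_eval x (p + q) = mpoly_eval x p + mpoly_eval x q"
proof -
  let ?M = "Poly_Mapping.keys p \<union> Poly_Mapping.keys q"
  have "Poly_Mapping.keys (p + q) \<subseteq> ?M" by (rule keys_add)
  then show ?thesis
    by (simp add: mpoly_eval_superset[of ?M] lookup_add algebra_simps sum.distrib)
qed

lemma mpoly_eval_0 [simp]: "mpoly_eval x 0 = 0"
  by (simp add: mpoly_eval_def)

lemma mpoly_eval_sum: "mpoly_eval x (sum p A) = (\<Sum>a\<in>A. mpoly_eval x (p a))"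
  by (induction A rule: infinite_finite_induct) (auto simp: mpoly_eval_add)

lemma mpoly_eval_single:
  "mpoly_eval x (mterm m c) = c * (\<Prod>v\<in>Poly_Mapping.keys m. x v ^ Poly_Mapping.lookup m v)"
  by (simp add: mpoly_eval_def)

lemma monomial_eval_add:
  "(\<Prod>v\<in>Poly_Mapping.keys (m + m'). x v ^ Poly_Mapping.lookup (m + m') v) =
   (\<Prod>v\<in>Poly_Mapping.keys m. x v ^ Poly_Mapping.lookup m v) *
   (\<Prod>v\<in>Poly_Mapping.keys m'. (x v :: 'k::comm_semiring_1) ^ Poly_Mapping.lookup m' v)"
proof -
  let ?V = "Poly_Mapping.keys m \<union> Poly_Mapping.keys m'"
  have *: "(\<Prod>v\<in>Poly_Mapping.keys a. x v ^ Poly_Mapping.lookup a v) = (\<Prod>v\<in>?V. x v ^ Poly_Mapping.lookup a v)"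
    if "Poly_Mapping.keys a \<subseteq> ?V" for a
    by (rule prod.mono_neutral_left) (use that in \<open>auto simp: in_keys_iff\<close>)
  show ?thesis
    unfolding *[OF keys_add] *[OF Un_upper1] *[OF Un_upper2]
    by (simp add: lookup_add power_add prod.distrib)
qed

lemma mpoly_eval_mult: "mpoly_eval x (p * q) = mpoly_eval x p * mpoly_eval x q"
proof -
  have "p * q = (\<Sum>m\<in>Poly_Mapping.keys p. \<Sum>m'\<in>Poly_Mapping.keys q.
      mterm (m + m') (coef p m * coef q m'))"
    by (subst (1) mpoly_expand[of p], subst (1) mpoly_expand[of q]) (simp add: sum_product mult_single)
  then have "mpoly_eval x (p * q) = (\<Sum>m\<in>Poly_Mapping.keys p. \<Sum>m'\<in>Poly_Mapping.keys q.
      mpoly_eval x (mterm m (coef p m)) * mpoly_eval x (mterm m' (coef q m')))"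
    by (simp add: mpoly_eval_sum mpoly_eval_single monomial_eval_add ac_simps)
  also have "\<dots> = mpoly_eval x p * mpoly_eval x q"
    by (simp add: sum_product [symmetric] mpoly_eval_sum [symmetric] mpoly_expand [symmetric])
  finally show ?thesis .
qed

text \<open>Values are compared on \<open>form_tuples ds\<close> only. There a coefficient outside
  the prescribed degree is zero, so it counts as a regular function although it is not a
  coordinate.\<close>

definition regular :: "nat list \<Rightarrow> (('v, 'k::comm_ring_1) mpoly list \<Rightarrow> 'k) \<Rightarrow> bool" where
  "regular ds f \<longleftrightarrow> (\<exists>P :: (nat \<times> 'v monomial, 'k) mpoly.
     (\<forall>m\<in>Poly_Mapping.keys P. Poly_Mapping.keys m \<subseteq> form_coordinates ds) \<and>
     (\<forall>Fs\<in>form_tuples ds. f Fs = mpoly_eval (\<lambda>(j, m). coef (Fs ! j) m) P))"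

lemma form_tuples_length: "Fs \<in> form_tuples ds \<Longrightarrow> length Fs = length ds"
  by (simp add: form_tuples_def list_all2_lengthD)

lemma form_tuples_nth: "Fs \<in> form_tuples ds \<Longrightarrow> j < length ds \<Longrightarrow> Fs ! j \<in> forms (int (ds ! j))"
  by (simp add: form_tuples_def list_all2_conv_all_nth)

lemma form_tuplesI:
  "length Fs = length ds \<Longrightarrow> (\<And>j. j < length ds \<Longrightarrow> Fs ! j \<in> forms (int (ds ! j))) \<Longrightarrow> Fs \<in> form_tuples ds"
  by (simp add: form_tuples_def list_all2_conv_all_nth)

lemma regular_const [simp]: "regular ds (\<lambda>_. c)"
  unfolding regular_def
  by (rule exI[of _ "mterm 0 c"]) (auto simp: mpoly_eval_single)

lemma regular_coef:
  assumes "j < length ds"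
  shows "regular ds (\<lambda>Fs. coef (Fs ! j) m)"
proof (cases "monomial_degree m = ds ! j")
  case True
  then show ?thesis unfolding regular_def using assms
    by (intro exI[of _ "mterm (Poly_Mapping.single (j, m) 1) 1"])
      (auto simp: mpoly_eval_single form_coordinates_def)
next
  case False
  then have "coef (Fs ! j) m = 0" if "Fs \<in> form_tuples ds" for Fs :: "('a, 'b) mpoly list"
    using form_tuples_nth[OF that assms] by (auto simp: in_forms_iff)
  then show ?thesis unfolding regular_def by (intro exI[of _ 0]) auto
qed

lemma regular_add: "regular ds f \<Longrightarrow> regular ds g \<Longrightarrow> regular ds (\<lambda>Fs. f Fs + g Fs)"
  unfolding regular_def
proof clarify
  fix P Q :: "(nat \<times> 'a monomial, 'b) mpoly"
  assume P: "\<forall>m\<in>Poly_Mapping.keys P. Poly_Mapping.keys m \<subseteq> form_coordinates ds"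
    "\<forall>Fs\<in>form_tuples ds. f Fs = mpoly_eval (\<lambda>(j, m). coef (Fs ! j) m) P"
  and Q: "\<forall>m\<in>Poly_Mapping.keys Q. Poly_Mapping.keys m \<subseteq> form_coordinates ds"
    "\<forall>Fs\<in>form_tuples ds. g Fs = mpoly_eval (\<lambda>(j, m). coef (Fs ! j) m) Q"
  have "\<forall>m\<in>Poly_Mapping.keys (P + Q). Poly_Mapping.keys m \<subseteq> form_coordinates ds"
    using P(1) Q(1) keys_add[of P Q] by blast
  then show "\<exists>P. (\<forall>m\<in>Poly_Mapping.keys P. Poly_Mapping.keys m \<subseteq> form_coordinates ds) \<and>
     (\<forall>Fs\<in>form_tuples ds. f Fs + g Fs = mpoly_eval (\<lambda>(j, m). coef (Fs ! j) m) P)"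
    using P(2) Q(2) by (intro exI[of _ "P + Q"]) (auto simp: mpoly_eval_add)
qed

lemma regular_mult: "regular ds f \<Longrightarrow> regular ds g \<Longrightarrow> regular ds (\<lambda>Fs. f Fs * g Fs)"
  unfolding regular_def
proof clarify
  fix P Q :: "(nat \<times> 'a monomial, 'b) mpoly"
  assume P: "\<forall>m\<in>Poly_Mapping.keys P. Poly_Mapping.keys m \<subseteq> form_coordinates ds"
    "\<forall>Fs\<in>form_tuples ds. f Fs = mpoly_eval (\<lambda>(j, m). coef (Fs ! j) m) P"
  and Q: "\<forall>m\<in>Poly_Mapping.keys Q. Poly_Mapping.keys m \<subseteq> form_coordinates ds"
    "\<forall>Fs\<in>form_tuples ds. g Fs = mpoly_eval (\<lambda>(j, m). coef (Fs ! j) m) Q"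
  have "Poly_Mapping.keys m \<subseteq> form_coordinates ds" if m: "m \<in> Poly_Mapping.keys (P * Q)" for m
  proof -
    obtain a b where "m = a + b" "a \<in> Poly_Mapping.keys P" "b \<in> Poly_Mapping.keys Q"
      using m keys_mult[of P Q] by blast
    then show ?thesis using P(1) Q(1) keys_add[of a b] by blast
  qed
  then show "\<exists>P. (\<forall>m\<in>Poly_Mapping.keys P. Poly_Mapping.keys m \<subseteq> form_coordinates ds) \<and>
     (\<forall>Fs\<in>form_tuples ds. f Fs * g Fs = mpoly_eval (\<lambda>(j, m). coef (Fs ! j) m) P)"
    using P(2) Q(2) by (intro exI[of _ "P * Q"]) (auto simp: mpoly_eval_mult)
qed

lemma regular_diff: "regular ds f \<Longrightarrow> regular ds g \<Longrightarrow> regular ds (\<lambda>Fs. f Fs - g Fs)"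
  using regular_add[of ds f "\<lambda>Fs. - 1 * g Fs"] regular_mult[of ds "\<lambda>_. - 1" g] by simp

lemma regular_sum: "(\<And>a. a \<in> A \<Longrightarrow> regular ds (f a)) \<Longrightarrow> regular ds (\<lambda>Fs. \<Sum>a\<in>A. f a Fs)"
  by (induction A rule: infinite_finite_induct) (auto intro: regular_add)

lemma regular_prod: "(\<And>a. a \<in> A \<Longrightarrow> regular ds (f a)) \<Longrightarrow> regular ds (\<lambda>Fs. \<Prod>a\<in>A. f a Fs)"
  by (induction A rule: infinite_finite_induct) (auto intro: regular_mult)

lemma regular_power: "regular ds f \<Longrightarrow> regular ds (\<lambda>Fs. f Fs ^ n)"
  by (induction n) (auto intro: regular_mult)

lemma mpoly_eval_line:
  fixes x :: "'k::field \<Rightarrow> 'c \<Rightarrow> 'k"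
  assumes "\<And>v. \<exists>q. \<forall>t. x t v = poly q t"
  shows "\<exists>q. \<forall>t. mpoly_eval (x t) P = poly q t"
proof -
  obtain Q where Q: "\<And>v t. x t v = poly (Q v) t" using assms by metis
  have "mpoly_eval (x t) P = poly (\<Sum>m\<in>Poly_Mapping.keys P. [:Poly_Mapping.lookup P m:] *
     (\<Prod>v\<in>Poly_Mapping.keys m. Q v ^ Poly_Mapping.lookup m v)) t" for t
    by (simp add: mpoly_eval_def Q poly_sum poly_prod)
  then show ?thesis by blast
qed

text \<open>The neighbourhood is a principal open set. With the point fixed, finitely many
  conditions are combined by multiplying the functions that define their neighbourhoods.\<close>

definition near :: "nat list \<Rightarrow> ('v, 'k::comm_ring_1) mpoly list \<Rightarrow> (('v, 'k) mpoly list \<Rightarrow> bool) \<Rightarrow> bool" where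
  "near ds Fs Q \<longleftrightarrow> (\<exists>f. regular ds f \<and> f Fs \<noteq> 0 \<and> (\<forall>Gs\<in>form_tuples ds. f Gs \<noteq> 0 \<longrightarrow> Q Gs))"

text \<open>An open set contains a principal one around each of its points, so generic truth is
  truth near a single well-chosen tuple.\<close>

lemma for_general_forms_iff:
  "for_general_forms ds (Q :: ('v, 'k::comm_ring_1) mpoly list \<Rightarrow> bool) \<longleftrightarrow> (\<exists>Fs\<in>form_tuples ds. near ds Fs Q)"
proof
  assume "for_general_forms ds Q"
  then obtain Ps :: "(nat \<times> 'v monomial, 'k) mpoly set" and U where
    P: "\<forall>p\<in>Ps. \<forall>m\<in>Poly_Mapping.keys p. Poly_Mapping.keys m \<subseteq> form_coordinates ds"
    and U: "U = {Fs\<in>form_tuples ds. \<exists>p\<in>Ps. mpoly_eval (\<lambda>(j, m). coef (Fs ! j) m) p \<noteq> 0}"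
      "U \<noteq> {}" "\<forall>Fs\<in>U. Q Fs"
    unfolding for_general_forms_def zariski_open_def by auto
  then obtain Fs p where Fs: "Fs \<in> form_tuples ds" "p \<in> Ps" "mpoly_eval (\<lambda>(j, m). coef (Fs ! j) m) p \<noteq> 0"
    by blast
  have "regular ds (\<lambda>Fs. mpoly_eval (\<lambda>(j, m). coef (Fs ! j) m) p)"
    unfolding regular_def using P Fs by blast
  then have "near ds Fs Q" unfolding near_def using Fs U 
    by (intro exI[of _ "\<lambda>Fs. mpoly_eval (\<lambda>(j, m). coef (Fs ! j) m) p"]) blast
  then show "\<exists>Fs\<in>form_tuples ds. near ds Fs Q" using Fs by blast
next
  assume "\<exists>Fs\<in>form_tuples ds. near ds Fs Q"
  then obtain Fs f where Fs: "Fs \<in> form_tuples ds" and f: "regular ds f" "f Fs \<noteq> 0"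
    "\<forall>Gs\<in>form_tuples ds. f Gs \<noteq> 0 \<longrightarrow> Q Gs" unfolding near_def by blast
  obtain p where p: "\<forall>m\<in>Poly_Mapping.keys p. Poly_Mapping.keys m \<subseteq> form_coordinates ds"
     "\<forall>Fs\<in>form_tuples ds. f Fs = mpoly_eval (\<lambda>(j, m). coef (Fs ! j) m) p" 
    using f(1) unfolding regular_def by blast
  let ?U = "{Fs\<in>form_tuples ds. \<exists>p\<in>{p}. mpoly_eval (\<lambda>(j, m). coef (Fs ! j) m) p \<noteq> 0}"
  have "zariski_open ds ?U" unfolding zariski_open_def using p(1) by (intro exI[of _ "{p}"]) auto
  moreover have "Fs \<in> ?U" using Fs f p by auto
  moreover have "\<forall>Fs\<in>?U. Q Fs" using f p by auto
  ultimately show "for_general_forms ds Q" unfolding for_general_forms_def by blast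
qed

lemma near_mono: "near ds Fs Q \<Longrightarrow> (\<And>Gs. Gs \<in> form_tuples ds \<Longrightarrow> Q Gs \<Longrightarrow> Q' Gs) \<Longrightarrow> near ds Fs Q'"
  unfolding near_def by blast

lemma near_point: "near ds Fs Q \<Longrightarrow> Fs \<in> form_tuples ds \<Longrightarrow> Q Fs"
  unfolding near_def by blast

lemma near_True: "(\<And>Gs. Gs \<in> form_tuples ds \<Longrightarrow> Q Gs) \<Longrightarrow> near ds Fs Q"
  unfolding near_def by (intro exI[of _ "\<lambda>_. 1"]) auto

lemma near_conj:
  fixes Fs :: "('v, 'k::field) mpoly list"
  assumes "near ds Fs Q" "near ds Fs Q'"
  shows "near ds Fs (\<lambda>Fs. Q Fs \<and> Q' Fs)"
proof -
  obtain f g where "regular ds f" "f Fs \<noteq> 0" "\<forall>Gs\<in>form_tuples ds. f Gs \<noteq> 0 \<longrightarrow> Q Gs"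
    "regular ds g" "g Fs \<noteq> 0" "\<forall>Gs\<in>form_tuples ds. g Gs \<noteq> 0 \<longrightarrow> Q' Gs"
    using assms unfolding near_def by blast
  then show ?thesis unfolding near_def by (intro exI[of _ "\<lambda>Fs. f Fs * g Fs"]) (auto intro: regular_mult)
qed

lemma near_ball:
  fixes Fs :: "('v, 'k::field) mpoly list"
  assumes "finite A" "\<And>a. a \<in> A \<Longrightarrow> near ds Fs (Q a)"
  shows "near ds Fs (\<lambda>Fs. \<forall>a\<in>A. Q a Fs)"
  using assms
proof (induction A rule: finite_induct)
  case empty
  then show ?case by (auto intro: near_True)
next
  case (insert a A)
  then have "near ds Fs (\<lambda>Fs. Q a Fs \<and> (\<forall>a\<in>A. Q a Fs))" by (intro near_conj) auto
  then show ?case by (rule near_mono) auto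
qed

lemma for_general_forms_mono:
  fixes Q :: "('v, 'k::comm_ring_1) mpoly list \<Rightarrow> bool"
  shows "for_general_forms ds Q \<Longrightarrow> (\<And>Fs. Fs \<in> form_tuples ds \<Longrightarrow> Q Fs \<Longrightarrow> Q' Fs) \<Longrightarrow> for_general_forms ds Q'"
  unfolding for_general_forms_iff using near_mono by blast

text \<open>Two nonempty open sets meet: restrict to a line through a point of each of them.\<close>

lemma for_general_forms_conj:
  fixes Q :: "('v, 'k::field) mpoly list \<Rightarrow> bool"
  assumes inf: "infinite (UNIV :: 'k set)" and QQ: "for_general_forms ds Q" "for_general_forms ds Q'"
  shows "for_general_forms ds (\<lambda>Fs. Q Fs \<and> Q' Fs)"
proof -
  obtain Fs Gs where Fs: "Fs \<in> form_tuples ds" "near ds Fs Q" and Gs: "Gs \<in> form_tuples ds" "near ds Gs Q'"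
    using QQ unfolding for_general_forms_iff by blast
  obtain f g where f: "regular ds f" "f Fs \<noteq> 0" "\<forall>Gs\<in>form_tuples ds. f Gs \<noteq> 0 \<longrightarrow> Q Gs"
    and g: "regular ds g" "g Gs \<noteq> 0" "\<forall>Gs\<in>form_tuples ds. g Gs \<noteq> 0 \<longrightarrow> Q' Gs"
    using Fs(2) Gs(2) unfolding near_def by blast
  define L where "L t = map (\<lambda>j. Fs ! j + mterm 0 t * (Gs ! j - Fs ! j)) [0..<length ds]" for t
  have L: "L t \<in> form_tuples ds" for t
  proof (rule form_tuplesI)
    fix j assume j: "j < length ds"
    then have "mterm 0 t * (Gs ! j - Fs ! j) \<in> forms (int (ds ! j))"
      using form_tuples_nth[OF Fs(1) j] form_tuples_nth[OF Gs(1) j]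
      unfolding in_forms_iff coef_const_mult lookup_minus
      by (metis diff_self mult_zero_right)
    then show "L t ! j \<in> forms (int (ds ! j))" using j form_tuples_nth[OF Fs(1) j]
      by (simp add: L_def forms_add)
  qed (simp add: L_def)
  have line: "\<exists>q. \<forall>t. h (L t) = poly q t" if h: "regular ds h" for h
  proof -
    obtain P where P: "\<forall>m\<in>Poly_Mapping.keys P. Poly_Mapping.keys m \<subseteq> form_coordinates ds"
       "\<forall>Fs\<in>form_tuples ds. h Fs = mpoly_eval (\<lambda>(j, m). coef (Fs ! j) m) P" 
      using h unfolding regular_def by blast
    \<comment> \<open>Positions beyond the tuple get the value 0, so that every coordinate, and not
      only those occurring in \<open>P\<close>, is a polynomial in \<open>t\<close>.\<close>
    define x where "x t = (\<lambda>(j, m). if j < length ds then coef (L t ! j) m else 0)" for t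
    have "h (L t) = mpoly_eval (x t) P" for t
      using P(1) L P(2) unfolding mpoly_eval_def x_def
      by (auto intro!: sum.cong prod.cong arg_cong2[of _ _ _ _ "(*)"] simp: form_coordinates_def)
        (metis (mono_tags, lifting) form_coordinates_def case_prodD mem_Collect_eq subsetD)
    moreover have "\<exists>q. \<forall>t. x t v = poly q t" for v
    proof (cases v)
      case (Pair j m)
      have "x t v = poly (if j < length ds then [:coef (Fs ! j) m, coef (Gs ! j) m - coef (Fs ! j) m:] else 0) t" for t
        by (simp add: Pair x_def L_def lookup_add coef_const_mult lookup_minus)
      then show ?thesis by blast
    qed
    ultimately show ?thesis using mpoly_eval_line[of x P] by auto
  qed
  obtain p q where p: "\<And>t. f (L t) = poly p t" and q: "\<And>t. g (L t) = poly q t"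
    using line f(1) g(1) by metis
  have L0: "L 0 = Fs" by (rule nth_equalityI) (use form_tuples_length[OF Fs(1)] in \<open>auto simp: L_def\<close>)
  have L1: "L 1 = Gs" by (rule nth_equalityI) (use form_tuples_length[OF Gs(1)] in \<open>auto simp: L_def\<close>)
  have "p \<noteq> 0" "q \<noteq> 0" using p[of 0] q[of 1] f g L0 L1 by auto
  then have "finite {t. poly (p * q) t = 0}" by (intro poly_roots_finite) simp
  then obtain t where "poly (p * q) t \<noteq> 0" using inf by (metis (mono_tags, lifting) UNIV_eq_I mem_Collect_eq)
  then have "f (L t) * g (L t) \<noteq> 0" by (simp add: p q)
  then have "near ds (L t) (\<lambda>Fs. Q Fs \<and> Q' Fs)" unfolding near_def using f g
    by (intro exI[of _ "\<lambda>Fs. f Fs * g Fs"]) (auto intro: regular_mult)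
  then show ?thesis unfolding for_general_forms_iff using L by blast
qed

lemma for_general_forms_ball:
  fixes Q :: "'a \<Rightarrow> ('v, 'k::field) mpoly list \<Rightarrow> bool"
  assumes inf: "infinite (UNIV :: 'k set)" and "finite A" "\<And>a. a \<in> A \<Longrightarrow> for_general_forms ds (Q a)"
  shows "for_general_forms ds (\<lambda>Fs. \<forall>a\<in>A. Q a Fs)"
  using assms(2,3)
proof (induction A rule: finite_induct)
  case empty
  have "replicate (length ds) 0 \<in> form_tuples ds" by (rule form_tuplesI) auto
  then show ?case unfolding for_general_forms_iff by (auto intro: near_True)
next
  case (insert a A)
  then have "for_general_forms ds (\<lambda>Fs. Q a Fs \<and> (\<forall>a\<in>A. Q a Fs))"
    by (intro for_general_forms_conj inf) auto
  then show ?case by (rule for_general_forms_mono) auto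
qed

lemma regular_reindex:
  assumes f: "regular (map ((!) ds) js) f" and js: "set js \<subseteq> {..<length ds}"
  shows "\<exists>g. regular ds g \<and> (\<forall>Fs\<in>form_tuples ds. g Fs = f (map ((!) Fs) js))"
proof -
  obtain P where P: "\<forall>m\<in>Poly_Mapping.keys P. Poly_Mapping.keys m \<subseteq> form_coordinates (map ((!) ds) js)"
     "\<forall>Fs\<in>form_tuples (map ((!) ds) js). f Fs = mpoly_eval (\<lambda>(j, m). coef (Fs ! j) m) P" 
    using f unfolding regular_def by blast
  let ?g = "\<lambda>Fs. mpoly_eval (\<lambda>(j, m). coef (map ((!) Fs) js ! j) m) P"
  have "map ((!) Fs) js \<in> form_tuples (map ((!) ds) js)" if "Fs \<in> form_tuples ds" for Fs :: "('a, 'b) mpoly list"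
    by (rule form_tuplesI) (use form_tuples_nth[OF that] js in \<open>auto simp: subset_iff\<close>)
  then have "?g Fs = f (map ((!) Fs) js)" if "Fs \<in> form_tuples ds" for Fs using P(2) that by simp
  moreover have "regular ds ?g"
    unfolding mpoly_eval_def
  proof (intro regular_sum regular_mult regular_const regular_prod regular_power)
    fix m v assume m: "m \<in> Poly_Mapping.keys P" "v \<in> Poly_Mapping.keys m"
    then obtain j m' where v: "v = (j, m')" "j < length js" using P(1) by (fastforce simp: form_coordinates_def)
    then have "js ! j \<in> {..<length ds}" using js nth_mem[of j js] by blast
    then have "js ! j < length ds" by simp
    then have "regular ds (\<lambda>Fs. coef (Fs ! (js ! j)) m' :: 'b)" by (rule regular_coef)
    then show "regular ds (\<lambda>Fs. (case v of (j, m) \<Rightarrow> coef (map ((!) Fs) js ! j) m) :: 'b)" using v by simp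
  qed
  ultimately show ?thesis by blast
qed

text \<open>Selecting distinct entries is a linear projection, so the preimage of an open set is
  open. It is nonempty because a tuple of the selected entries can be completed by zero
  forms.\<close>

lemma for_general_forms_reindex:
  fixes Q :: "('v, 'k::field) mpoly list \<Rightarrow> bool"
  assumes Q: "for_general_forms (map ((!) ds) js) Q" and js: "distinct js" "set js \<subseteq> {..<length ds}"
  shows "for_general_forms ds (\<lambda>Fs. Q (map ((!) Fs) js))"
proof -
  obtain Gs f where Gs: "Gs \<in> form_tuples (map ((!) ds) js)" and f: "regular (map ((!) ds) js) f" "f Gs \<noteq> 0"
    "\<forall>Gs\<in>form_tuples (map ((!) ds) js). f Gs \<noteq> 0 \<longrightarrow> Q Gs"
    using Q unfolding for_general_forms_iff near_def by blast
  define Fs where "Fs = map (\<lambda>i. case map_of (zip js Gs) i of None \<Rightarrow> 0 | Some F \<Rightarrow> F) [0..<length ds]"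
  have len: "length Gs = length js" using form_tuples_length[OF Gs] by simp
  have Fs_js: "Fs ! (js ! p) = Gs ! p" if "p < length js" for p
  proof -
    have "map_of (zip js Gs) (js ! p) = Some (Gs ! p)" using that js len by (intro map_of_zip_nth) auto
    moreover have "js ! p < length ds" using js that by (auto simp: subset_iff)
    ultimately show ?thesis by (simp add: Fs_def)
  qed
  have Fs: "Fs \<in> form_tuples ds"
  proof (rule form_tuplesI)
    fix j assume j: "j < length ds"
    show "Fs ! j \<in> forms (int (ds ! j))"
    proof (cases "j \<in> set js")
      case True
      then obtain p where p: "p < length js" "j = js ! p" by (auto simp: in_set_conv_nth)
      then show ?thesis using form_tuples_nth[OF Gs, of p] Fs_js[OF p(1)] by simp
    next
      case False
      then have "map_of (zip js Gs) j = None" using len 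
        by (auto simp: map_of_eq_None_iff dest: set_zip_leftD)
      then show ?thesis using j by (simp add: Fs_def)
    qed
  qed (simp add: Fs_def)
  have GsFs: "map ((!) Fs) js = Gs" by (rule nth_equalityI) (auto simp: len Fs_js)
  obtain g where g: "regular ds g" "\<forall>Fs\<in>form_tuples ds. g Fs = f (map ((!) Fs) js)"
    using regular_reindex[OF f(1) js(2)] by blast
  have "map ((!) Fs) js \<in> form_tuples (map ((!) ds) js)" if "Fs \<in> form_tuples ds" for Fs :: "('v, 'k) mpoly list"
    by (rule form_tuplesI) (use form_tuples_nth[OF that] js in \<open>auto simp: subset_iff\<close>)
  then have "near ds Fs (\<lambda>Fs. Q (map ((!) Fs) js))"
    unfolding near_def using g f(2,3) Fs GsFs by (intro exI[of _ g]) auto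
  then show ?thesis unfolding for_general_forms_iff using Fs by blast
qed

text \<open>A nonzero pivot stays nonzero near \<open>Fs\<close>. After elimination the remaining
  family is again regular and has one member less, so induction on the size applies.\<close>

lemma near_indep_family:
  fixes v :: "('v, 'k::field) mpoly list \<Rightarrow> 'b \<Rightarrow> 'm \<Rightarrow> 'k"
  assumes "finite B" "\<And>b m. b \<in> B \<Longrightarrow> regular ds (\<lambda>Fs. v Fs b m)" "indep_family (v Fs) B"
  shows "near ds Fs (\<lambda>Fs. indep_family (v Fs) B)"
  using assms
proof (induction "card B" arbitrary: B v)
  case 0
  then show ?case by (auto intro: near_True)
next
  case (Suc n)
  then obtain b0 where b0: "b0 \<in> B" by (metis card.empty ex_in_conv nat.distinct(1))
  have "\<exists>m0. v Fs b0 m0 \<noteq> 0"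
  proof (rule ccontr)
    assume "\<not> ?thesis"
    then have "(\<Sum>b\<in>B. (if b = b0 then 1 else 0) * v Fs b m) = 0" for m
      by (intro sum.neutral) auto
    from indep_familyD[OF Suc.prems(3), of "\<lambda>b. if b = b0 then 1 else 0", OF this b0] show False by simp
  qed
  then obtain m0 where m0: "v Fs b0 m0 \<noteq> 0" by blast
  define w where "w Gs b m = v Gs b0 m0 * v Gs b m - v Gs b m0 * v Gs b0 m" for Gs b m
  have "near ds Fs (\<lambda>Fs. indep_family (w Fs) (B - {b0}))"
  proof (rule Suc.hyps(1))
    show "n = card (B - {b0})" using Suc b0 by simp
    show "indep_family (w Fs) (B - {b0})"
      using indep_family_eliminate[of B b0 "v Fs" m0] Suc.prems b0 m0 unfolding w_def by blast
    show "regular ds (\<lambda>Fs. w Fs b m)" if "b \<in> B - {b0}" for b m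
      unfolding w_def using that b0 Suc.prems(2) by (intro regular_diff regular_mult) auto
  qed (use Suc in auto)
  moreover have "near ds Fs (\<lambda>Fs. v Fs b0 m0 \<noteq> 0)"
    unfolding near_def using m0 Suc.prems(2)[OF b0] by blast
  ultimately have "near ds Fs (\<lambda>Fs. indep_family (w Fs) (B - {b0}) \<and> v Fs b0 m0 \<noteq> 0)" by (rule near_conj)
  then show ?case
  proof (rule near_mono)
    fix Gs
    assume "indep_family (w Gs) (B - {b0}) \<and> v Gs b0 m0 \<noteq> 0"
    then show "indep_family (v Gs) B"
      using indep_family_eliminate[OF Suc.prems(1) b0, of "v Gs" m0] by (simp add: w_def [abs_def])
  qed
qed

section \<open>Openness of the maximal rank condition\<close>

text \<open>The pair of \<open>Some j\<close> and \<open>m\<close> stands for \<open>m\<close> times the \<open>j\<close>-th form, and the pair of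
  \<open>None\<close> and \<open>m\<close> for \<open>m\<close> itself.\<close>

definition gen_elem :: "('v, 'k::comm_ring_1) mpoly list \<Rightarrow> nat option \<times> 'v monomial \<Rightarrow> ('v, 'k) mpoly" where
  "gen_elem Fs b = (case b of (None, m) \<Rightarrow> mterm m 1 | (Some j, m) \<Rightarrow> mterm m 1 * Fs ! j)"

text \<open>Indices of a spanning family, over the field, of the degree \<open>i\<close> part of the
  ideal of the forms at the positions \<open>J\<close>.\<close>

definition gens :: "nat list \<Rightarrow> nat set \<Rightarrow> nat \<Rightarrow> (nat option \<times> 'v monomial) set" where
  "gens ds J i = {(Some j, m) |j m. j \<in> J \<and> monomial_degree m + ds ! j = i}"

definition monomials :: "nat \<Rightarrow> (nat option \<times> 'v monomial) set" where
  "monomials i = Pair None ` {m. monomial_degree m = i}"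

definition const_span :: "('v, 'k::field) mpoly list \<Rightarrow> (nat option \<times> 'v monomial) set \<Rightarrow> ('v, 'k) mpoly set" where
  "const_span Fs B = {f. in_span (\<lambda>b. coef (gen_elem Fs b)) B (coef f)}"

lemma finite_gens:
  assumes "finite J"
  shows "finite (gens ds J i :: (nat option \<times> 'v::finite monomial) set)"
proof -
  have "gens ds J i \<subseteq> (\<lambda>(j, m). (Some j, m)) ` (SIGMA j:J. {m :: 'v monomial. monomial_degree m = i - ds ! j})"
    by (force simp: gens_def)
  then show ?thesis by (rule finite_subset) (auto intro: assms finite_monomials)
qed

lemma finite_none_monomials: "finite (monomials i :: (nat option \<times> 'v::finite monomial) set)"
  by (simp add: monomials_def finite_monomials)

lemma const_span_iff: "f \<in> const_span Fs B \<longleftrightarrow> (\<exists>c. f = (\<Sum>b\<in>B. mterm 0 (c b) * gen_elem Fs b))"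
  by (simp add: const_span_def in_span_def poly_mapping_eq_iff fun_eq_iff lookup_sum coef_const_mult)

lemma const_spanI: "f = (\<Sum>b\<in>B. mterm 0 (c b) * gen_elem Fs b) \<Longrightarrow> f \<in> const_span Fs B"
  unfolding const_span_iff by (rule exI)

lemma lincombs_nth: "finite J \<Longrightarrow> j \<in> J \<Longrightarrow> g * Fs ! j \<in> lincombs ((!) Fs) J"
  by (intro lincombs_mult lincombs_gen)

lemma indep_family_gen_elem_iff:
  "indep_family (\<lambda>b. coef (gen_elem Fs b)) B \<longleftrightarrow>
    (\<forall>c. (\<Sum>b\<in>B. mterm 0 (c b) * gen_elem Fs b) = 0 \<longrightarrow> (\<forall>b\<in>B. c b = 0))"
  by (simp add: indep_family_def poly_mapping_eq_iff fun_eq_iff lookup_sum coef_const_mult)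

lemma const_span_add: "f \<in> const_span Fs B \<Longrightarrow> g \<in> const_span Fs B \<Longrightarrow> f + g \<in> const_span Fs B"
proof -
  assume "f \<in> const_span Fs B" "g \<in> const_span Fs B"
  then obtain c d where "f = (\<Sum>b\<in>B. mterm 0 (c b) * gen_elem Fs b)" "g = (\<Sum>b\<in>B. mterm 0 (d b) * gen_elem Fs b)"
    by (auto simp: const_span_iff)
  then have "f + g = (\<Sum>b\<in>B. mterm 0 (c b + d b) * gen_elem Fs b)"
    by (simp add: single_add algebra_simps sum.distrib)
  then show ?thesis by (rule const_spanI)
qed

lemma const_span_0 [simp]: "0 \<in> const_span Fs B"
  unfolding const_span_iff by (rule exI[of _ "\<lambda>_. 0"]) simp

lemma const_span_sum: "(\<And>a. a \<in> A \<Longrightarrow> f a \<in> const_span Fs B) \<Longrightarrow> sum f A \<in> const_span Fs B"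
  by (induction A rule: infinite_finite_induct) (auto intro: const_span_add)

lemma const_span_gen:
  assumes "finite B" "b \<in> B"
  shows "mterm 0 c * gen_elem Fs b \<in> const_span Fs B"
proof -
  have "mterm 0 c * gen_elem Fs b = (\<Sum>b'\<in>B. if b' = b then mterm 0 c * gen_elem Fs b else 0)"
    using assms by simp
  also have "\<dots> = (\<Sum>b'\<in>B. mterm 0 (if b' = b then c else 0) * gen_elem Fs b')"
    by (rule sum.cong) auto
  finally show ?thesis by (rule const_spanI)
qed

lemma const_span_trans:
  assumes "f \<in> const_span Fs C" "\<And>b. b \<in> C \<Longrightarrow> gen_elem Fs b \<in> const_span Fs B"
  shows "f \<in> const_span Fs B"
  using assms in_span_trans[of C "\<lambda>b. coef (gen_elem Fs b)" B "coef f"] by (simp add: const_span_def)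

lemma mult_term: "mterm m c * f = mterm 0 c * (mterm m 1 * f)" for f :: "('v, 'k::comm_ring_1) mpoly"
  by (simp add: mult.assoc [symmetric] mult_single)

text \<open>Homogeneous coefficients expand into monomials with scalar coefficients. In a fixed
  degree this turns ideal membership into finite-dimensional linear algebra.\<close>

lemma const_span_gens:
  fixes Fs :: "('v::finite, 'k::field) mpoly list"
  assumes Fs: "Fs \<in> form_tuples ds" and J: "J \<subseteq> {..<length ds}" and f: "f \<in> forms (int i)"
  shows "f \<in> const_span Fs (gens ds J i) \<longleftrightarrow> f \<in> lincombs ((!) Fs) J"
proof
  have fin: "finite J" using J finite_subset by blast
  {
    assume "f \<in> const_span Fs (gens ds J i)"
    then obtain c where "f = (\<Sum>b\<in>gens ds J i. mterm 0 (c b) * gen_elem Fs b)" by (auto simp: const_span_iff)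
    moreover have "gen_elem Fs b \<in> lincombs ((!) Fs) J" if "b \<in> gens ds J i" for b
      using that fin by (auto simp: gens_def gen_elem_def intro: lincombs_nth)
    ultimately show "f \<in> lincombs ((!) Fs) J" by (metis (no_types, lifting) lincombs_sum lincombs_mult)
  next
    assume "f \<in> lincombs ((!) Fs) J"
    then obtain c where c: "f = (\<Sum>j\<in>J. c j * Fs ! j)" "\<And>j. j \<in> J \<Longrightarrow> c j \<in> forms (int i - int (ds ! j))"
      using lincombs_homogeneous[of f "(!) Fs" J "int i" "\<lambda>j. int (ds ! j)"] f form_tuples_nth[OF Fs] J by blast
    have "c j * Fs ! j \<in> const_span Fs (gens ds J i)" if j: "j \<in> J" for j
    proof -
      have "c j * Fs ! j = (\<Sum>m\<in>Poly_Mapping.keys (c j). mterm 0 (coef (c j) m) * gen_elem Fs (Some j, m))"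
        by (subst mpoly_expand) (simp add: sum_distrib_right gen_elem_def mult_term[symmetric])
      also have "\<dots> \<in> const_span Fs (gens ds J i)"
      proof (intro const_span_sum const_span_gen finite_gens fin)
        fix m assume "m \<in> Poly_Mapping.keys (c j)"
        then have "int (monomial_degree m) = int i - int (ds ! j)" using c(2)[OF j] by (auto simp: forms_def)
        then show "(Some j, m) \<in> gens ds J i" using j by (auto simp: gens_def)
      qed
      finally show ?thesis .
    qed
    then show "f \<in> const_span Fs (gens ds J i)" unfolding c(1) by (intro const_span_sum)
  }
qed

lemma gens_forms:
  fixes Fs :: "('v::finite, 'k::field) mpoly list"
  assumes Fs: "Fs \<in> form_tuples ds" and J: "J \<subseteq> {..<length ds}" and b: "b \<in> gens ds J i"
  shows "gen_elem Fs b \<in> forms (int i)"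
proof -
  obtain j m where b: "b = (Some j, m)" "j \<in> J" "monomial_degree m + ds ! j = i" using b by (auto simp: gens_def)
  have "mterm m 1 * Fs ! j \<in> forms (int (monomial_degree m) + int (ds ! j))"
    using form_tuples_nth[OF Fs, of j] b J by (intro forms_mult forms_mterm) auto
  then show ?thesis using b by (auto simp: gen_elem_def)
qed

lemma const_span_monomials:
  fixes f :: "('v::finite, 'k::field) mpoly"
  assumes "f \<in> forms (int i)"
  shows "f \<in> const_span Fs (monomials i)"
proof -
  have "f = (\<Sum>m\<in>{m. monomial_degree m = i}. mterm 0 (coef f m) * gen_elem Fs (None, m))"
    by (subst forms_expand[OF assms]) (simp add: gen_elem_def mult_single)
  also have "\<dots> \<in> const_span Fs (monomials i)"
    by (intro const_span_sum const_span_gen finite_none_monomials) (auto simp: monomials_def)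
  finally show ?thesis .
qed

lemma monomials_forms: "b \<in> monomials i \<Longrightarrow> gen_elem Fs b \<in> forms (int i)"
  by (auto simp: monomials_def gen_elem_def intro!: forms_mterm)

lemma const_span_full:
  fixes Fs :: "('v::finite, 'k::field) mpoly list"
  assumes "finite B" "indep_family (\<lambda>b. coef (gen_elem Fs b)) B"
    "card {m :: 'v monomial. monomial_degree m = i} \<le> card B"
    "\<And>b. b \<in> B \<Longrightarrow> gen_elem Fs b \<in> forms (int i)" "f \<in> forms (int i)"
  shows "f \<in> const_span Fs B"
  unfolding const_span_def mem_Collect_eq
  by (rule in_span_full[OF finite_monomials assms(1,2,3)]) (use assms(4,5) in \<open>auto simp: in_forms_iff\<close>)

lemma const_span_card:
  fixes Fs :: "('v::finite, 'k::field) mpoly list"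
  assumes "finite B" "forms (int i) \<subseteq> const_span Fs B"
  shows "card {m :: 'v monomial. monomial_degree m = i} \<le> card B"
proof (rule in_span_card_ge[OF finite_monomials assms(1), of _ "\<lambda>b. coef (gen_elem Fs b)"])
  fix m0 :: "'v monomial" assume "m0 \<in> {m. monomial_degree m = i}"
  then have "mterm m0 1 \<in> forms (int i)" by (auto intro: forms_mterm)
  then have "in_span (\<lambda>b. coef (gen_elem Fs b)) B (coef (mterm m0 1))"
    using assms(2) by (auto simp: const_span_def)
  moreover have "coef (mterm m0 1) = (\<lambda>m. if m = m0 then 1 else 0 :: 'k)"
    by (auto simp: fun_eq_iff lookup_single when_def)
  ultimately show "in_span (\<lambda>b. coef (gen_elem Fs b)) B (\<lambda>m. if m = m0 then 1 else 0)" by simp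
qed

lemma regular_gen_elem:
  fixes n :: "'v monomial"
  assumes "fst b = None \<or> (\<exists>j<length ds. fst b = Some j)"
  shows "regular ds (\<lambda>Fs. coef (gen_elem Fs b) n)"
proof (cases "fst b")
  case None
  then show ?thesis by (cases b) (simp add: gen_elem_def)
next
  case (Some j)
  then obtain m where b: "b = (Some j, m)" by (cases b) auto
  have j: "j < length ds" using Some assms by auto
  show ?thesis
  proof (cases "\<exists>m'. n = m + m'")
    case True
    then obtain m' where "n = m + m'" by blast
    then show ?thesis using regular_coef[OF j, of m'] by (simp add: b gen_elem_def coef_mterm_mult)
  next
    case False
    then show ?thesis by (simp add: b gen_elem_def coef_mterm_mult_0)
  qed
qed

lemma near_indep_gens:
  fixes Fs :: "('v::finite, 'k::field) mpoly list"
  assumes "indep_family (\<lambda>b. coef (gen_elem Fs b)) B" "finite B"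
    "\<And>b. b \<in> B \<Longrightarrow> fst b = None \<or> (\<exists>j<length ds. fst b = Some j)"
  shows "near ds Fs (\<lambda>Gs. indep_family (\<lambda>b. coef (gen_elem Gs b)) B)"
  by (rule near_indep_family[where v = "\<lambda>Fs b. coef (gen_elem Fs b)", OF assms(2) _ assms(1)]) (rule regular_gen_elem, rule assms(3))

text \<open>If the ideal fills degree \<open>i\<close> at \<open>Fs\<close>, some of the products of
  monomials and forms are a basis of all forms of degree \<open>i\<close>. They stay independent
  near \<open>Fs\<close>, and independent forms in this number span by counting monomials.\<close>

lemma near_full:
  fixes Fs :: "('v::finite, 'k::field) mpoly list"
  assumes Fs: "Fs \<in> form_tuples ds" and J: "J \<subseteq> {..<length ds}"
    and full: "forms (int i) \<subseteq> lincombs ((!) Fs) J"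
  shows "near ds Fs (\<lambda>Gs. forms (int i) \<subseteq> lincombs ((!) Gs) J)"
proof -
  have fin: "finite (gens ds J i :: (nat option \<times> 'v monomial) set)"
    using J finite_subset by (intro finite_gens) blast
  obtain B :: "(nat option \<times> 'v monomial) set" where B: "B \<subseteq> gens ds J i"
    "indep_family (\<lambda>b. coef (gen_elem Fs b)) B"
    "\<And>b. b \<in> gens ds J i \<Longrightarrow> in_span (\<lambda>b. coef (gen_elem Fs b)) B (coef (gen_elem Fs b))"
    using maximal_indep_family[OF fin, of "{}" "\<lambda>b. coef (gen_elem Fs b)"] by auto
  have finB: "finite B" using B fin finite_subset by blast
  have "f \<in> const_span Fs B" if "f \<in> forms (int i)" for f
  proof (rule const_span_trans)
    show "f \<in> const_span Fs (gens ds J i)" using that const_span_gens[OF Fs J that] full by auto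
  qed (use B(3) in \<open>simp add: const_span_def\<close>)
  then have card: "card {m :: 'v monomial. monomial_degree m = i} \<le> card B"
    by (intro const_span_card finB) auto
  have "near ds Fs (\<lambda>Gs. indep_family (\<lambda>b. coef (gen_elem Gs b)) B)"
  proof (rule near_indep_gens[OF B(2) finB])
    fix b assume "b \<in> B"
    then have "b \<in> gens ds J i" using B(1) by blast
    then show "fst b = None \<or> (\<exists>j<length ds. fst b = Some j)" using J by (auto simp: gens_def)
  qed
  then show ?thesis
  proof (rule near_mono, intro subsetI)
    fix Gs :: "('v, 'k) mpoly list" and f
    assume Gs: "Gs \<in> form_tuples ds" "indep_family (\<lambda>b. coef (gen_elem Gs b)) B" 
      and f: "f \<in> (forms (int i) :: ('v, 'k) mpoly set)"
    have "f \<in> const_span Gs B"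
      by (rule const_span_full[OF finB Gs(2) card]) (use f B(1) gens_forms[OF Gs(1) J] in auto)
    then have "f \<in> const_span Gs (gens ds J i)"
      by (rule const_span_trans) (use B(1) const_span_gen[OF fin, of _ 1 Gs] in auto)
    then show "f \<in> lincombs ((!) Gs) J" using const_span_gens[OF Gs(1) J f] by simp
  qed
qed

text \<open>The maximum is taken over all tuples, so the size of \<open>B\<close> is the largest
  dimension that the degree \<open>i\<close> part of such an ideal attains.\<close>

lemma max_indep_gens_exists:
  fixes ds :: "nat list"
  shows "\<exists>B \<subseteq> gens ds {..<length ds} i.
    (\<exists>Fs \<in> form_tuples ds. indep_family (\<lambda>b. coef (gen_elem (Fs :: ('v::finite, 'k::field) mpoly list) b)) B) \<and>
    (\<forall>Gs \<in> form_tuples ds. \<forall>C \<subseteq> gens ds {..<length ds} i.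
      indep_family (\<lambda>b. coef (gen_elem (Gs :: ('v, 'k) mpoly list) b)) C \<longrightarrow> card C \<le> card B)"
proof -
  let ?G = "gens ds {..<length ds} i :: (nat option \<times> 'v monomial) set"
  let ?P = "\<lambda>p :: ('v, 'k) mpoly list \<times> _. fst p \<in> form_tuples ds \<and> snd p \<subseteq> ?G \<and>
    indep_family (\<lambda>b. coef (gen_elem (fst p) b)) (snd p)"
  have fin: "finite ?G" by (intro finite_gens) simp
  have 1: "?P (replicate (length ds) 0, {})" by (auto intro: form_tuplesI)
  have 2: "\<forall>y. ?P y \<longrightarrow> card (snd y) < Suc (card ?G)"
    using fin by (auto simp: less_Suc_eq_le card_mono)
  obtain p where p: "?P p" "\<And>q. ?P q \<Longrightarrow> card (snd q) \<le> card (snd p)"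
    using ex_has_greatest_nat[of ?P, OF 1 2] by blast
  show ?thesis
  proof (intro exI[of _ "snd p"] conjI bexI[of _ "fst p"] ballI allI impI)
    fix Gs C
    assume "Gs \<in> form_tuples ds" "C \<subseteq> ?G" "indep_family (\<lambda>b. coef (gen_elem (Gs :: ('v, 'k) mpoly list) b)) C"
    then show "card C \<le> card (snd p)" using p(2)[of "(Gs, C)"] by simp
  qed (use p(1) in auto)
qed

text \<open>The hypothesis only provides, for general \<open>Gs\<close>, some forms \<open>F\<close> of maximal rank that depend on
  \<open>Gs\<close>. At one such pair with all ideals \<open>(Gs)\<close> as large as possible in degrees up to \<open>N\<close>, both
  injectivity and surjectivity amount to the independence of families of the maximal possible size,
  which persists on a neighbourhood of the pair.\<close>

lemma maximal_rank_generic: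
  fixes es :: "nat list"
  assumes inf: "infinite (UNIV :: 'k::field set)" and e: "1 \<le> e"
    and MR: "for_general_forms es (\<lambda>Gs :: ('v::finite, 'k) mpoly list.
      maximal_rank_property (ideal_generated (set Gs)))"
  shows "for_general_forms (es @ [e]) (\<lambda>Gs :: ('v, 'k) mpoly list. \<forall>i\<in>{i. i + e \<le> N}.
    mult_injective (lincombs ((!) Gs) {..<length es}) (Gs ! length es) i \<or>
    mult_surjective (lincombs ((!) Gs) {..<length es}) (Gs ! length es) e i)"
proof -
  let ?s = "length es" and ?J = "{..<length es}" and ?es = "es @ [e]"
  let ?v = "\<lambda>(Gs :: ('v, 'k) mpoly list) b. coef (gen_elem Gs b)"
  let ?Q = "\<lambda>i (Gs :: ('v, 'k) mpoly list). mult_injective (lincombs ((!) Gs) ?J) (Gs ! ?s) i \<or>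
    mult_surjective (lincombs ((!) Gs) ?J) (Gs ! ?s) e i"
  have "\<forall>i. \<exists>B. B \<subseteq> gens es ?J i \<and> (\<exists>Fs \<in> form_tuples es. indep_family (?v Fs) B) \<and>
    (\<forall>Gs \<in> form_tuples es. \<forall>C \<subseteq> gens es ?J i. indep_family (?v Gs) C \<longrightarrow> card C \<le> card B)"
    by (intro allI max_indep_gens_exists)
  from choice[OF this] obtain B where B: "\<And>i. B i \<subseteq> gens es ?J i \<and>
      (\<exists>Fs \<in> form_tuples es. indep_family (?v Fs) (B i)) \<and>
    (\<forall>Gs \<in> form_tuples es. \<forall>C \<subseteq> gens es ?J i. indep_family (?v Gs) C \<longrightarrow> card C \<le> card (B i))"
    by (elim exE) (rule that, erule spec)
  have B_gens: "B i \<subseteq> gens es ?J i" for i by (rule conjunct1[OF B])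
  have finB: "finite (B i)" for i by (rule finite_subset[OF B_gens finite_gens]) simp
  have B_max: "card C \<le> card (B i)"
    if "Gs \<in> form_tuples es" "C \<subseteq> gens es ?J i" "indep_family (?v Gs) C" for Gs C i
    using conjunct2[OF conjunct2[OF B[of i]]] that by simp
  have fst_B: "\<exists>j<length es. fst b = Some j" if "b \<in> B i" for b i
    using B_gens[of i] that by (auto simp: gens_def)
  have B_generic: "for_general_forms es (\<lambda>Gs. indep_family (?v Gs) (B i))" for i
  proof -
    obtain Fs where Fs: "Fs \<in> form_tuples es" "indep_family (?v Fs) (B i)"
      using conjunct1[OF conjunct2[OF B[of i]]] by (elim bexE)
    have "near es Fs (\<lambda>Gs. indep_family (?v Gs) (B i))"
      by (rule near_indep_gens[OF Fs(2) finB]) (rule disjI2, rule fst_B)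
    then show ?thesis unfolding for_general_forms_iff using Fs(1) by (rule bexI)
  qed
  \<comment> \<open>Only degrees up to \<open>N\<close> are imposed, which leaves finitely many open
    conditions to be met by one tuple.\<close>
  have "for_general_forms es (\<lambda>Gs. maximal_rank_property (ideal_generated (set Gs)) \<and>
      (\<forall>i\<in>{..N}. indep_family (?v Gs) (B i)))"
    by (intro for_general_forms_conj for_general_forms_ball inf MR B_generic) auto
  then obtain Gs0 where Gs0: "Gs0 \<in> form_tuples es" "maximal_rank_property (ideal_generated (set Gs0))"
    "\<And>i. i \<le> N \<Longrightarrow> indep_family (?v Gs0) (B i)"
    unfolding for_general_forms_iff using near_point by blast
  have len0: "length Gs0 = ?s" using Gs0 form_tuples_length by blast
  have "for_general_forms [e] (\<lambda>Fs. \<forall>i. mult_injective (ideal_generated (set Gs0)) (Fs ! 0) i \<or>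
      mult_surjective (ideal_generated (set Gs0)) (Fs ! 0) e i)"
    using Gs0(2) e unfolding maximal_rank_property_def by blast
  then obtain F1 where F1: "F1 \<in> form_tuples [e]"
    "\<And>i. mult_injective (ideal_generated (set Gs0)) (F1 ! 0) i \<or>
      mult_surjective (ideal_generated (set Gs0)) (F1 ! 0) e i"
    unfolding for_general_forms_iff using near_point by blast
  define Gs where "Gs = Gs0 @ [F1 ! 0]"
  have Gs_nth: "Gs ! j = Gs0 ! j" if "j < ?s" for j using that len0 by (simp add: Gs_def nth_append)
  have Gs_s: "Gs ! ?s = F1 ! 0" using len0 by (simp add: Gs_def nth_append)
  have Gs: "Gs \<in> form_tuples ?es"
  proof (rule form_tuplesI)
    fix j assume "j < length ?es"
    then show "Gs ! j \<in> forms (int (?es ! j))"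
      using form_tuples_nth[OF Gs0(1), of j] form_tuples_nth[OF F1(1), of 0] Gs_nth[of j] Gs_s
      by (cases "j = ?s") (auto simp: nth_append)
  qed (simp add: Gs_def len0)
  have gens_eq: "gens ?es ?J i = (gens es ?J i :: (nat option \<times> 'v monomial) set)" for i
    by (auto simp: gens_def nth_append)
  have ideal: "ideal_generated (set Gs0) = lincombs ((!) Gs) ?J"
  proof -
    have "(!) Gs ` ?J = set Gs0" using Gs_nth len0 by (auto simp: set_conv_nth)
    then show ?thesis using ideal_generated_image[of ?J "(!) Gs"] by simp
  qed
  have take_tuple: "take ?s Hs \<in> form_tuples es" if "Hs \<in> form_tuples ?es" for Hs :: "('v, 'k) mpoly list"
  proof (rule form_tuplesI)
    fix j assume "j < ?s"
    then show "take ?s Hs ! j \<in> forms (int (es ! j))" using form_tuples_nth[OF that, of j] by (simp add: nth_append)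
  qed (use form_tuples_length[OF that] in simp)
  have gen_take: "gen_elem (take ?s Hs) b = gen_elem Hs b" if "b \<in> gens es ?J i" for b i and Hs :: "('v, 'k) mpoly list"
    using that by (auto simp: gens_def gen_elem_def)
  \<comment> \<open>Wherever \<open>B i\<close> is independent it spans the degree \<open>i\<close>
    part of the ideal: one further product would make an independent family larger than the
    maximum.\<close>
  have B_spans: "const_span Hs (gens es ?J i) \<subseteq> const_span Hs (B i)"
    if Hs: "Hs \<in> form_tuples ?es" and ind: "indep_family (?v Hs) (B i)" for Hs i
  proof
    fix f assume "f \<in> const_span Hs (gens es ?J i)"
    then show "f \<in> const_span Hs (B i)"
    proof (rule const_span_trans)
      fix b :: "nat option \<times> 'v monomial" assume b: "b \<in> gens es ?J i"
      show "gen_elem Hs b \<in> const_span Hs (B i)"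
      proof (rule ccontr)
        assume n: "gen_elem Hs b \<notin> const_span Hs (B i)"
        then have "b \<notin> B i" using const_span_gen[OF finB, of b i 1 Hs] by auto
        have "indep_family (?v Hs) (insert b (B i))"
          by (rule indep_family_insert[OF finB ind \<open>b \<notin> B i\<close>]) (use n in \<open>simp add: const_span_def\<close>)
        moreover have "?v (take ?s Hs) b' = ?v Hs b'" if "b' \<in> insert b (B i)" for b'
        proof -
          have "b' \<in> gens es ?J i" using that b B_gens[of i] by blast
          then show ?thesis using gen_take by simp
        qed
        ultimately have "indep_family (?v (take ?s Hs)) (insert b (B i))"
          using indep_family_cong[of "insert b (B i)" "?v (take ?s Hs)" "?v Hs"] by simp
        from B_max[OF take_tuple[OF Hs] _ this, of i] show False
          using b B_gens \<open>b \<notin> B i\<close> finB by auto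
      qed
    qed
  qed
  have lincombs_span: "f \<in> const_span Hs (B i)"
    if "Hs \<in> form_tuples ?es" "indep_family (?v Hs) (B i)" "f \<in> forms (int i)" "f \<in> lincombs ((!) Hs) ?J" for f Hs i
    using B_spans[OF that(1,2)] const_span_gens[OF that(1) _ that(3), of ?J] that(4) gens_eq by auto
  have span_lincombs: "f \<in> lincombs ((!) Hs) ?J"
    if f: "f \<in> const_span Hs C" and C: "C \<subseteq> gens es ?J i" for f Hs C i
  proof -
    obtain c where c: "f = (\<Sum>b\<in>C. mterm 0 (c b) * gen_elem Hs b)" using f by (auto simp: const_span_iff)
    have "gen_elem Hs b \<in> lincombs ((!) Hs) ?J" if b: "b \<in> C" for b
    proof -
      have "b \<in> gens es ?J i" using b C by blast
      then show ?thesis by (auto simp: gens_def gen_elem_def intro: lincombs_nth)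
    qed
    then show ?thesis unfolding c by (intro lincombs_sum lincombs_mult)
  qed
  have indep0: "indep_family (?v Gs) (B i)" if "i \<le> N" for i
  proof (rule iffD1[OF indep_family_cong Gs0(3)[OF that]])
    fix b assume "b \<in> B i"
    then have "b \<in> gens es ?J i" using B_gens[of i] by blast
    then show "?v Gs0 b = ?v Gs b" using gen_take[of b i Gs] len0 by (simp add: Gs_def)
  qed
  have "near ?es Gs (?Q i)" if i: "i + e \<le> N" for i
    using F1(2)[of i]
  proof
    assume "mult_surjective (ideal_generated (set Gs0)) (F1 ! 0) e i"
    then have surj: "mult_surjective (lincombs ((!) Gs) ?J) (Gs ! ?s) e i" by (simp add: ideal Gs_s)
    have lin_Suc: "f \<in> lincombs ((!) Hs) {..<Suc ?s} \<longleftrightarrow> (\<exists>g. f - Hs ! ?s * g \<in> lincombs ((!) Hs) ?J)"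
      for f and Hs :: "('v, 'k) mpoly list"
    proof
      assume "f \<in> lincombs ((!) Hs) {..<Suc ?s}"
      then obtain c where "f = (\<Sum>j<?s. c j * Hs ! j) + c ?s * Hs ! ?s"
        by (auto simp: lincombs_def lessThan_Suc add.commute)
      then have "f - Hs ! ?s * c ?s = (\<Sum>j<?s. c j * Hs ! j)" by (simp add: mult.commute)
      then show "\<exists>g. f - Hs ! ?s * g \<in> lincombs ((!) Hs) ?J" using lincombsI by blast
    next
      assume "\<exists>g. f - Hs ! ?s * g \<in> lincombs ((!) Hs) ?J"
      then obtain g where "f - Hs ! ?s * g \<in> lincombs ((!) Hs) {..<Suc ?s}"
        using lincombs_mono[of "{..<Suc ?s}" ?J "(!) Hs"] by auto
      moreover have "g * Hs ! ?s \<in> lincombs ((!) Hs) {..<Suc ?s}" by (intro lincombs_mult lincombs_gen) auto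
      ultimately have "f - Hs ! ?s * g + g * Hs ! ?s \<in> lincombs ((!) Hs) {..<Suc ?s}" by (rule lincombs_add)
      then show "f \<in> lincombs ((!) Hs) {..<Suc ?s}" by (simp add: mult.commute)
    qed
    \<comment> \<open>Surjectivity onto degree \<open>i + e\<close> says that the ideal enlarged by
      the last form contains all forms of that degree, which is an open condition.\<close>
    have "near ?es Gs (\<lambda>Hs. forms (int (i + e)) \<subseteq> lincombs ((!) Hs) {..<Suc ?s})"
    proof (rule near_full[OF Gs])
      show "forms (int (i + e)) \<subseteq> lincombs ((!) Gs) {..<Suc ?s}"
        using surj unfolding mult_surjective_def lin_Suc subset_iff by blast
    qed auto
    then show ?thesis
    proof (rule near_mono)
      fix Hs :: "('v, 'k) mpoly list" assume Hs: "Hs \<in> form_tuples ?es" and full: "forms (int (i + e)) \<subseteq> lincombs ((!) Hs) {..<Suc ?s}"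
      have "mult_surjective (lincombs ((!) Hs) ?J) (Hs ! ?s) e i"
        unfolding mult_surjective_def
      proof
        fix h :: "('v, 'k) mpoly" assume h: "h \<in> forms (int (i + e))"
        then have "h \<in> lincombs ((!) Hs) {..<Suc ?s}" using full by blast
        then obtain c where c: "h = (\<Sum>j<Suc ?s. c j * Hs ! j)"
          "\<And>j. j < Suc ?s \<Longrightarrow> c j \<in> forms (int (i + e) - int (?es ! j))"
          using lincombs_homogeneous[of h "(!) Hs" "{..<Suc ?s}" "int (i + e)" "\<lambda>j. int (?es ! j)"] h
            form_tuples_nth[OF Hs] by auto
        have "h - Hs ! ?s * c ?s = (\<Sum>j<?s. c j * Hs ! j)" by (simp add: c(1) mult.commute)
        then have "h - Hs ! ?s * c ?s \<in> lincombs ((!) Hs) ?J" by (rule lincombsI)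
        moreover have "c ?s \<in> forms (int i)" using c(2)[of ?s] by simp
        ultimately show "\<exists>g\<in>forms (int i). h - Hs ! ?s * g \<in> lincombs ((!) Hs) ?J" by blast
      qed
      then show "?Q i Hs" by blast
    qed
  next
    assume "mult_injective (ideal_generated (set Gs0)) (F1 ! 0) i"
    then have inj: "mult_injective (lincombs ((!) Gs) ?J) (Gs ! ?s) i" by (simp add: ideal Gs_s)
    \<comment> \<open>The family \<open>B i\<close> is completed by monomials \<open>M\<close> to a
      basis of the forms of degree \<open>i\<close>; thus \<open>M\<close> represents a basis of the
      quotient in that degree. Injectivity says that the products of \<open>M\<close> with the last
      form are independent modulo the ideal, that is, that \<open>?D\<close> below is an independent
      family.\<close>
    let ?C = "B i \<union> monomials i"
    have iN: "i \<le> N" using i by simp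
    have finC: "finite ?C" using finB finite_none_monomials by blast
    obtain B' where B': "B i \<subseteq> B'" "B' \<subseteq> ?C" "indep_family (?v Gs) B'"
      "\<And>b. b \<in> ?C \<Longrightarrow> in_span (?v Gs) B' (?v Gs b)"
      using maximal_indep_family[OF finC _ indep0[OF iN]] by blast
    have finB': "finite B'" using B'(2) finC finite_subset by blast
    define M where "M = {m. (None, m) \<in> B'}"
    have M: "finite M" "\<And>m. m \<in> M \<Longrightarrow> monomial_degree m = i"
    proof -
      have "Pair None ` M \<subseteq> B'" by (auto simp: M_def)
      then show "finite M" using finB' by (meson finite_imageD finite_subset inj_onI prod.inject)
      show "monomial_degree m = i" if "m \<in> M" for m
        using that B'(2) B_gens[of i] by (auto simp: M_def monomials_def gens_def)
    qed
    have B'_eq: "B' = B i \<union> Pair None ` M"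
      using B'(1,2) by (auto simp: M_def monomials_def)
    have disj: "B i \<inter> Pair None ` M = {}" using B_gens[of i] by (auto simp: gens_def)
    let ?D = "B (i + e) \<union> Pair (Some ?s) ` M"
    have disjD: "B (i + e) \<inter> Pair (Some ?s) ` M = {}" using B_gens[of "i + e"] by (auto simp: gens_def)
    have sumB': "(\<Sum>b\<in>B'. mterm 0 (c b) * gen_elem Hs b) =
      (\<Sum>b\<in>B i. mterm 0 (c b) * gen_elem Hs b) + (\<Sum>m\<in>M. mterm m (c (None, m)))"
      for c and Hs :: "('v, 'k) mpoly list"
      unfolding B'_eq using finB M disj
      by (subst sum.union_disjoint) (auto simp: sum.reindex inj_on_def gen_elem_def mult_single)
    have sumD: "(\<Sum>b\<in>?D. mterm 0 (c b) * gen_elem Hs b) =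
      (\<Sum>b\<in>B (i + e). mterm 0 (c b) * gen_elem Hs b) + Hs ! ?s * (\<Sum>m\<in>M. mterm m (c (Some ?s, m)))"
      for c and Hs :: "('v, 'k) mpoly list"
    proof -
      have "(\<Sum>b\<in>Pair (Some ?s) ` M. mterm 0 (c b) * gen_elem Hs b) =
          (\<Sum>m\<in>M. mterm m (c (Some ?s, m)) * Hs ! ?s)"
        by (simp add: sum.reindex inj_on_def gen_elem_def mult_term[symmetric])
      then show ?thesis using finB M disjD
        by (subst sum.union_disjoint) (auto simp: sum_distrib_left mult.commute)
    qed
    have forms_M: "(\<Sum>m\<in>M. mterm m (c m)) \<in> forms (int i)" for c :: "'v monomial \<Rightarrow> 'k"
      using M by (intro forms_sum forms_mterm) auto
    have forms_FM: "Hs ! ?s * f \<in> forms (int (i + e))" if "Hs \<in> form_tuples ?es" "f \<in> forms (int i)"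
      for Hs and f :: "('v, 'k) mpoly"
    proof -
      have "Hs ! ?s \<in> forms (int e)" using form_tuples_nth[OF that(1), of ?s] by simp
      from forms_mult[OF this that(2)] show ?thesis by (simp add: add.commute)
    qed
    \<comment> \<open>The inequality is read off at \<open>Gs\<close> but mentions no tuple; hence
      \<open>B'\<close> spans the forms of degree \<open>i\<close> at every tuple at which it is
      independent.\<close>
    have card: "card {m :: 'v monomial. monomial_degree m = i} \<le> card B'"
    proof (rule const_span_card[OF finB'])
      show "forms (int i) \<subseteq> const_span Gs B'"
      proof
        fix f :: "('v, 'k) mpoly" assume "f \<in> forms (int i)"
        then have "f \<in> const_span Gs (monomials i)" by (rule const_span_monomials)
        then show "f \<in> const_span Gs B'"
          by (rule const_span_trans) (use B'(4) in \<open>simp add: const_span_def\<close>)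
      qed
    qed
    have indD: "indep_family (?v Gs) ?D"
      unfolding indep_family_gen_elem_iff
    proof (intro allI impI)
      fix c assume "(\<Sum>b\<in>?D. mterm 0 (c b) * gen_elem Gs b) = 0"
      then have 0: "(\<Sum>b\<in>B (i + e). mterm 0 (c b) * gen_elem Gs b) +
          Gs ! ?s * (\<Sum>m\<in>M. mterm m (c (Some ?s, m))) = 0" by (simp only: sumD)
      let ?g = "\<Sum>m\<in>M. mterm m (c (Some ?s, m))" and ?h = "\<Sum>b\<in>B (i + e). mterm 0 (c b) * gen_elem Gs b"
      have "?h \<in> lincombs ((!) Gs) ?J"
        by (rule span_lincombs[OF _ B_gens]) (rule const_spanI, rule refl)
      then have "Gs ! ?s * ?g \<in> lincombs ((!) Gs) ?J"
        using 0 lincombs_diff[OF lincombs_0, of ?h] by (simp add: add_eq_0_iff2)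
      then have "?g \<in> lincombs ((!) Gs) ?J" 
        by (rule inj[unfolded mult_injective_def, rule_format, OF forms_M])
      then have "?g \<in> const_span Gs (B i)"
        by (rule lincombs_span[OF Gs indep0[OF iN] forms_M])
      then obtain a where a: "?g = (\<Sum>b\<in>B i. mterm 0 (a b) * gen_elem Gs b)" by (auto simp: const_span_iff)
      \<comment> \<open>The element \<open>?g\<close> is a combination both of the monomials in
        \<open>M\<close> and of \<open>B i\<close>; the difference of the two is a relation among
        \<open>B'\<close>.\<close>
      define a' where "a' b = (if b \<in> B i then - a b else c (Some ?s, snd b))" for b
      have "(\<Sum>b\<in>B i. mterm 0 (a' b) * gen_elem Gs b) = - ?g"
        unfolding a sum_negf [symmetric] by (intro sum.cong) (auto simp: a'_def single_uminus)
      moreover have "(\<Sum>m\<in>M. mterm m (a' (None, m))) = ?g"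
        using disj by (intro sum.cong) (auto simp: a'_def)
      ultimately have "(\<Sum>b\<in>B'. mterm 0 (a' b) * gen_elem Gs b) = 0" by (simp add: sumB')
      then have a'0: "\<forall>b\<in>B'. a' b = 0" using B'(3) unfolding indep_family_gen_elem_iff by blast
      have cM: "c (Some ?s, m) = 0" if "m \<in> M" for m
      proof -
        have "(None, m) \<in> B'" "(None, m) \<notin> B i" using that disj by (auto simp: M_def)
        then show ?thesis using a'0 by (force simp: a'_def)
      qed
      then have "?h = 0" using 0 by simp
      then have "\<forall>b\<in>B (i + e). c b = 0"
        using indep0[OF i] unfolding indep_family_gen_elem_iff by blast
      then show "\<forall>b\<in>?D. c b = 0" using cM by auto
    qed
    have "near ?es Gs (\<lambda>Hs. indep_family (?v Hs) B' \<and> indep_family (?v Hs) ?D)"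
    proof (intro near_conj near_indep_gens B'(3) indD finB')
      show "finite ?D" using finB M by auto
      show "fst b = None \<or> (\<exists>j<length ?es. fst b = Some j)" if "b \<in> B'" for b
        using that fst_B[of b i] unfolding B'_eq by (fastforce simp: less_Suc_eq)
      show "fst b = None \<or> (\<exists>j<length ?es. fst b = Some j)" if "b \<in> ?D" for b
        using that fst_B[of b "i + e"] by (fastforce simp: less_Suc_eq)
    qed
    then show ?thesis
    proof (rule near_mono)
      fix Hs :: "('v, 'k) mpoly list" assume Hs: "Hs \<in> form_tuples ?es" and "indep_family (?v Hs) B' \<and> indep_family (?v Hs) ?D"
      then have ind: "indep_family (?v Hs) B'" "indep_family (?v Hs) ?D" by auto
      have indB: "indep_family (?v Hs) (B (i + e))"
        unfolding indep_family_gen_elem_iff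
      proof (intro allI impI)
        fix c assume c: "(\<Sum>b\<in>B (i + e). mterm 0 (c b) * gen_elem Hs b) = 0"
        define c' where "c' b = (if b \<in> B (i + e) then c b else 0)" for b
        have "(\<Sum>b\<in>B (i + e). mterm 0 (c' b) * gen_elem Hs b) = 0"
          unfolding c [symmetric] by (intro sum.cong) (auto simp: c'_def)
        moreover have "(\<Sum>m\<in>M. mterm m (c' (Some ?s, m))) = 0"
          using disjD by (intro sum.neutral) (auto simp: c'_def)
        ultimately have "(\<Sum>b\<in>?D. mterm 0 (c' b) * gen_elem Hs b) = 0" by (simp add: sumD)
        then have "\<forall>b\<in>?D. c' b = 0" using ind(2) unfolding indep_family_gen_elem_iff by blast
        then show "\<forall>b\<in>B (i + e). c b = 0" unfolding c'_def by (metis (full_types) UnI1)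
      qed
      have "mult_injective (lincombs ((!) Hs) ?J) (Hs ! ?s) i"
        unfolding mult_injective_def
      proof (intro ballI impI)
        fix g :: "('v, 'k) mpoly" assume g: "g \<in> forms (int i)" and Fg: "Hs ! ?s * g \<in> lincombs ((!) Hs) ?J"
        have "g \<in> const_span Hs B'"
        proof (rule const_span_full[OF finB' ind(1) card _ g])
          fix b assume "b \<in> B'"
          then have "b \<in> gens ?es ?J i \<or> b \<in> monomials i" using B'(2) B_gens[of i] gens_eq by auto
          then show "gen_elem Hs b \<in> forms (int i)" using gens_forms[OF Hs, of ?J b i] monomials_forms[of b i Hs] by auto
        qed
        then obtain c where c: "g = (\<Sum>b\<in>B i. mterm 0 (c b) * gen_elem Hs b) + (\<Sum>m\<in>M. mterm m (c (None, m)))"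
          unfolding const_span_iff sumB' by blast
        let ?h = "\<Sum>b\<in>B i. mterm 0 (c b) * gen_elem Hs b" and ?g = "\<Sum>m\<in>M. mterm m (c (None, m))"
        have h: "?h \<in> lincombs ((!) Hs) ?J"
          by (rule span_lincombs[OF _ B_gens]) (rule const_spanI, rule refl)
        have "Hs ! ?s * ?g = Hs ! ?s * g - Hs ! ?s * ?h" by (simp add: c algebra_simps)
        then have "Hs ! ?s * ?g \<in> lincombs ((!) Hs) ?J"
          using lincombs_diff[OF Fg lincombs_mult[OF h, of "Hs ! ?s"]] by simp
        then have "Hs ! ?s * ?g \<in> const_span Hs (B (i + e))"
          by (rule lincombs_span[OF Hs indB forms_FM[OF Hs forms_M]])
        then obtain a where a: "Hs ! ?s * ?g = (\<Sum>b\<in>B (i + e). mterm 0 (a b) * gen_elem Hs b)"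
          by (auto simp: const_span_iff)
        \<comment> \<open>Similarly, the last form times \<open>?g\<close> lies in the span of
          \<open>B (i + e)\<close>; the difference is a relation among \<open>?D\<close>, which
          forces the coefficients of \<open>?g\<close> to vanish.\<close>
        define a' where "a' b = (if b \<in> B (i + e) then - a b else c (None, snd b))" for b
        have "(\<Sum>b\<in>B (i + e). mterm 0 (a' b) * gen_elem Hs b) = - (Hs ! ?s * ?g)"
          unfolding a sum_negf [symmetric] by (intro sum.cong) (auto simp: a'_def single_uminus)
        moreover have "(\<Sum>m\<in>M. mterm m (a' (Some ?s, m))) = ?g"
          using disjD by (intro sum.cong) (auto simp: a'_def)
        ultimately have "(\<Sum>b\<in>?D. mterm 0 (a' b) * gen_elem Hs b) = 0" by (simp add: sumD)
        then have a'0: "\<forall>b\<in>?D. a' b = 0" using ind(2) unfolding indep_family_gen_elem_iff by blast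
        have "c (None, m) = 0" if "m \<in> M" for m
        proof -
          have "(Some ?s, m) \<in> ?D" "(Some ?s, m) \<notin> B (i + e)" using that disjD by auto
          then show ?thesis using a'0 by (force simp: a'_def)
        qed
        then have "?g = 0" by simp
        then show "g \<in> lincombs ((!) Hs) ?J" using h by (simp add: c)
      qed
      then show "?Q i Hs" by blast
    qed
  qed
  then have "near ?es Gs (\<lambda>Gs. \<forall>i\<in>{i. i + e \<le> N}. ?Q i Gs)"
  proof (intro near_ball)
    show "finite {i. i + e \<le> N}" by (rule finite_subset[of _ "{..N}"]) auto
  qed auto
  then show ?thesis unfolding for_general_forms_iff using Gs by blast
qed

section \<open>Koszul homology of general forms\<close>

lemma lincombs_image_cong:
  fixes F :: "'i \<Rightarrow> ('v, 'k::comm_ring_1) mpoly" and G :: "'j \<Rightarrow> ('v, 'k) mpoly"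
  assumes "finite A" "finite B" "F ` A = G ` B"
  shows "lincombs F A = lincombs G B"
  using assms ideal_generated_image by metis

lemma forms_subset_Suc:
  fixes F :: "'i \<Rightarrow> ('v::finite, 'k::comm_ring_1) mpoly"
  assumes "forms (int i) \<subseteq> lincombs F A"
  shows "forms (int (Suc i)) \<subseteq> lincombs F A"
proof
  fix f :: "('v, 'k) mpoly" assume f: "f \<in> forms (int (Suc i))"
  have "mterm m (coef f m) \<in> lincombs F A" if m: "m \<in> Poly_Mapping.keys f" for m
  proof -
    have deg: "monomial_degree m = Suc i" using f m by (auto simp: forms_def)
    then have "m \<noteq> 0" by auto
    then obtain v where "Poly_Mapping.lookup m v \<noteq> 0" by (metis lookup_zero poly_mapping_eqI)
    then obtain m' where m': "m = Poly_Mapping.single v 1 + m'" using single_le_split[of 1 m v] by auto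
    then have "mterm m' (coef f m) \<in> forms (int i)" using deg by (intro forms_mterm) simp
    then have "mterm (Poly_Mapping.single v 1) 1 * mterm m' (coef f m) \<in> lincombs F A"
      using assms by (intro lincombs_mult) blast
    moreover have "mterm (Poly_Mapping.single v 1) 1 * mterm m' (coef f m) = mterm m (coef f m)"
      unfolding mult_single m'[symmetric] by simp
    ultimately show ?thesis by simp
  qed
  then show "f \<in> lincombs F A" by (subst mpoly_expand) (rule lincombs_sum)
qed

lemma forms_subset_mono:
  fixes F :: "'i \<Rightarrow> ('v::finite, 'k::comm_ring_1) mpoly"
  assumes "forms (int i) \<subseteq> lincombs F A" "i \<le> j"
  shows "forms (int j) \<subseteq> lincombs F A"
  using assms(2,1) by (induction rule: dec_induct) (use forms_subset_Suc in blast)+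

text \<open>For powers of the variables: if every exponent of a monomial were below the degree of
  the corresponding power, its total degree would be less than the sum of the first
  \<open>CARD('v)\<close> degrees. The bound \<open>sum_list ds\<close> does not depend on the
  tuple.\<close>

lemma artinian_generic:
  fixes ds :: "nat list"
  assumes many: "CARD('v::finite) \<le> length ds"
  shows "for_general_forms ds (\<lambda>Fs :: ('v, 'k::field) mpoly list.
    forms (int (sum_list ds)) \<subseteq> lincombs ((!) Fs) {..<length ds})"
proof -
  let ?n = "CARD('v)" and ?r = "length ds"
  obtain \<nu> :: "nat \<Rightarrow> 'v" where \<nu>: "bij_betw \<nu> {..<?n} UNIV"
    using ex_bij_betw_nat_finite[of "UNIV :: 'v set"] by (auto simp: atLeast0LessThan)
  define Fs :: "('v, 'k) mpoly list" where
    "Fs = map (\<lambda>j. if j < ?n then mterm (Poly_Mapping.single (\<nu> j) (ds ! j)) 1 else 0) [0..<?r]"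
  have Fs: "Fs \<in> form_tuples ds"
    by (rule form_tuplesI) (auto simp: Fs_def intro: forms_mterm)
  have "forms (int (sum_list ds)) \<subseteq> lincombs ((!) Fs) {..<?r}"
  proof
    fix f :: "('v, 'k) mpoly" assume f: "f \<in> forms (int (sum_list ds))"
    have "mterm m (coef f m) \<in> lincombs ((!) Fs) {..<?r}" if m: "m \<in> Poly_Mapping.keys f" for m
    proof -
      have deg: "monomial_degree m = sum_list ds" using f m by (auto simp: forms_def)
      have "\<exists>j<?n. ds ! j \<le> Poly_Mapping.lookup m (\<nu> j)"
      proof (rule ccontr)
        assume "\<not> ?thesis"
        then have *: "\<And>j. j < ?n \<Longrightarrow> Poly_Mapping.lookup m (\<nu> j) < ds ! j" by (simp add: not_le)
        have "monomial_degree m = (\<Sum>j<?n. Poly_Mapping.lookup m (\<nu> j))"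
          unfolding monomial_degree_UNIV by (rule sum.reindex_bij_betw[OF \<nu>, symmetric])
        also have "\<dots> < (\<Sum>j<?n. ds ! j)"
        proof (rule sum_strict_mono)
          show "{..<?n} \<noteq> {}" by (metis empty_iff lessThan_iff zero_less_card_finite)
        qed (use * in auto)
        also have "\<dots> \<le> (\<Sum>j<?r. ds ! j)" using many by (intro sum_mono2) auto
        also have "\<dots> = sum_list ds" by (simp add: sum_list_sum_nth atLeast0LessThan)
        finally show False using deg by simp
      qed
      then obtain j where j: "j < ?n" "ds ! j \<le> Poly_Mapping.lookup m (\<nu> j)" by blast
      obtain m' where m': "m = Poly_Mapping.single (\<nu> j) (ds ! j) + m'" using single_le_split[OF j(2)] by blast
      have "mterm m (coef f m) = mterm m' (coef f m) * Fs ! j"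
        using j many by (subst m') (simp add: Fs_def mult_single add.commute)
      then show ?thesis using lincombs_nth[of "{..<?r}" j "mterm m' (coef f m)" Fs] j many by simp
    qed
    then show "f \<in> lincombs ((!) Fs) {..<?r}" by (subst mpoly_expand) (rule lincombs_sum)
  qed
  then have "near ds Fs (\<lambda>Fs. forms (int (sum_list ds)) \<subseteq> lincombs ((!) Fs) {..<?r})"
    by (intro near_full Fs) auto
  then show ?thesis unfolding for_general_forms_iff using Fs by blast
qed

text \<open>The forms are added one at a time in the order \<open>js\<close>, a parameter because
  one of largest degree has to come last. The bound \<open>N\<close> on the target degree leaves
  finitely many conditions.\<close>

definition prefix_maximal_rank :: "nat \<Rightarrow> nat list \<Rightarrow> nat list \<Rightarrow> ('v, 'k::comm_ring_1) mpoly list \<Rightarrow> bool" where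
  "prefix_maximal_rank N ds js Fs \<longleftrightarrow> (\<forall>s<length js. \<forall>i. i + ds ! (js ! s) \<le> N \<longrightarrow>
     mult_injective (lincombs ((!) Fs) (set (take s js))) (Fs ! (js ! s)) i \<or>
     mult_surjective (lincombs ((!) Fs) (set (take s js))) (Fs ! (js ! s)) (ds ! (js ! s)) i)"

text \<open>The condition at \<open>s\<close> involves only the first \<open>s + 1\<close> forms of
  the order. It holds for general tuples of these degrees and is pulled back along the selection of
  these entries.\<close>

lemma prefix_maximal_rank_generic:
  fixes ds :: "nat list"
  assumes inf: "infinite (UNIV :: 'k::field set)" and pos: "\<forall>d\<in>set ds. 1 \<le> d"
    and MR: "\<And>es :: nat list. length es < length ds \<Longrightarrow> \<forall>e\<in>set es. 1 \<le> e \<Longrightarrow>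
         for_general_forms es
           (\<lambda>Gs :: ('v::finite, 'k) mpoly list. maximal_rank_property (ideal_generated (set Gs)))"
    and js: "distinct js" "set js = {..<length ds}"
  shows "for_general_forms ds (\<lambda>Fs :: ('v, 'k) mpoly list. prefix_maximal_rank N ds js Fs)"
proof -
  let ?P = "\<lambda>s (Fs :: ('v, 'k) mpoly list). \<forall>i\<in>{i. i + ds ! (js ! s) \<le> N}.
     mult_injective (lincombs ((!) Fs) (set (take s js))) (Fs ! (js ! s)) i \<or>
     mult_surjective (lincombs ((!) Fs) (set (take s js))) (Fs ! (js ! s)) (ds ! (js ! s)) i"
  have len: "length js = length ds" using js distinct_card by fastforce
  have lt: "js ! s < length ds" if "s < length ds" for s
    using nth_mem[of s js] that js len by auto
  have "for_general_forms ds (?P s)" if s: "s \<in> {..<length ds}" for s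
  proof -
    let ?es = "map ((!) ds) (take s js)" and ?e = "ds ! (js ! s)"
    have take_Suc: "take (Suc s) js = take s js @ [js ! s]"
      using s len by (simp add: take_Suc_conv_app_nth)
    have "set ?es \<subseteq> set ds" using js(2) by (auto dest!: in_set_takeD intro!: nth_mem)
    then have "for_general_forms ?es (\<lambda>Gs :: ('v, 'k) mpoly list. maximal_rank_property (ideal_generated (set Gs)))"
      using pos s len by (intro MR) auto
    then have "for_general_forms (?es @ [?e]) (\<lambda>Gs :: ('v, 'k) mpoly list. \<forall>i\<in>{i. i + ?e \<le> N}.
      mult_injective (lincombs ((!) Gs) {..<length ?es}) (Gs ! length ?es) i \<or>
      mult_surjective (lincombs ((!) Gs) {..<length ?es}) (Gs ! length ?es) ?e i)"
      using pos lt s by (intro maximal_rank_generic inf) auto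
    then have "for_general_forms (map ((!) ds) (take (Suc s) js)) (\<lambda>Gs :: ('v, 'k) mpoly list. \<forall>i\<in>{i. i + ?e \<le> N}.
      mult_injective (lincombs ((!) Gs) {..<s}) (Gs ! s) i \<or>
      mult_surjective (lincombs ((!) Gs) {..<s}) (Gs ! s) ?e i)"
      using s len by (simp add: take_Suc)
    then have "for_general_forms ds (\<lambda>Fs :: ('v, 'k) mpoly list. \<forall>i\<in>{i. i + ?e \<le> N}.
      mult_injective (lincombs ((!) (map ((!) Fs) (take (Suc s) js))) {..<s}) (map ((!) Fs) (take (Suc s) js) ! s) i \<or>
      mult_surjective (lincombs ((!) (map ((!) Fs) (take (Suc s) js))) {..<s}) (map ((!) Fs) (take (Suc s) js) ! s) ?e i)"
      by (rule for_general_forms_reindex) (use js in \<open>auto dest: in_set_takeD\<close>)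
    moreover have "lincombs ((!) (map ((!) Fs) (take (Suc s) js))) {..<s} = lincombs ((!) Fs) (set (take s js))"
      for Fs :: "('v, 'k) mpoly list"
    proof (rule lincombs_image_cong)
      have "(\<lambda>p. map ((!) Fs) (take (Suc s) js) ! p) ` {..<s} = (\<lambda>p. Fs ! (js ! p)) ` {..<s}"
        by (rule image_cong) (use s len in auto)
      also have "\<dots> = (!) Fs ` ((!) js ` {..<s})" by (simp add: image_image)
      also have "(!) js ` {..<s} = set (take s js)" using s len by (simp add: nth_image lessThan_atLeast0)
      finally show "(!) (map ((!) Fs) (take (Suc s) js)) ` {..<s} = (!) Fs ` set (take s js)" .
    qed auto
    moreover have "map ((!) Fs) (take (Suc s) js) ! s = Fs ! (js ! s)" for Fs :: "('v, 'k) mpoly list"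
      using s len by (simp add: nth_append)
    ultimately show ?thesis by simp
  qed
  then have "for_general_forms ds (\<lambda>Fs. \<forall>s\<in>{..<length ds}. ?P s Fs)"
    by (intro for_general_forms_ball[where Q = ?P] inf) blast+
  then show ?thesis
    by (rule for_general_forms_mono) (auto simp: prefix_maximal_rank_def len)
qed

lemma koszul_exact_prefix:
  fixes Fs :: "('v::finite, 'k::field) mpoly list"
  assumes Fs: "Fs \<in> form_tuples ds" and pos: "\<forall>d\<in>set ds. 1 \<le> d"
    and js: "distinct js" "set js \<subseteq> {..<length ds}" and rank: "prefix_maximal_rank N ds js Fs"
    and c: "\<not> forms (int c) \<subseteq> lincombs ((!) Fs) (set js)" "c \<le> N"
    and i: "i \<ge> 1" "t \<le> int c + int i - 1"
  shows "koszul_exact (\<lambda>j. int (ds ! j)) ((!) Fs) (set js) i t"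
proof (rule koszul_exact_le[OF js(1) _ _ _ i])
  fix s t and g :: "('v, 'k) mpoly"
  let ?L = "lincombs ((!) Fs) (set (take s js))" and ?j = "js ! s"
  assume s: "s < length js" and t: "t \<le> int c" and g: "g \<in> forms (t - int (ds ! ?j))" and Fg: "Fs ! ?j * g \<in> ?L"
  show "g \<in> ?L"
  proof (cases "t - int (ds ! ?j) < 0")
    case True
    then show ?thesis using forms_neg[OF g] by simp
  next
    case False
    define i where "i = nat (t - int (ds ! ?j))"
    have i: "t - int (ds ! ?j) = int i" "i + ds ! ?j \<le> c" using False t by (auto simp: i_def)
    then have "mult_injective ?L (Fs ! ?j) i \<or> mult_surjective ?L (Fs ! ?j) (ds ! ?j) i"
      using rank s c(2) by (auto simp: prefix_maximal_rank_def)
    then show ?thesis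
    proof
      assume "mult_injective ?L (Fs ! ?j) i"
      then show ?thesis using g Fg i(1) by (auto simp: mult_injective_def)
    next
      assume surj: "mult_surjective ?L (Fs ! ?j) (ds ! ?j) i"
      \<comment> \<open>Surjectivity onto a degree at most \<open>c\<close> would put all forms of
        that degree, and then all forms of degree \<open>c\<close>, into the ideal.\<close>
      have "forms (int (i + ds ! ?j)) \<subseteq> lincombs ((!) Fs) (set js)"
      proof
        fix h :: "('v, 'k) mpoly" assume "h \<in> forms (int (i + ds ! ?j))"
        then obtain g where "h - Fs ! ?j * g \<in> ?L" using surj by (auto simp: mult_surjective_def)
        moreover have "?L \<subseteq> lincombs ((!) Fs) (set js)" by (intro lincombs_mono set_take_subset) simp
        moreover have "g * Fs ! ?j \<in> lincombs ((!) Fs) (set js)" using s by (intro lincombs_nth) auto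
        ultimately show "h \<in> lincombs ((!) Fs) (set js)"
          using lincombs_add[of "h - Fs ! ?j * g" "(!) Fs" "set js" "g * Fs ! ?j"] by (auto simp: mult.commute)
      qed
      then have False using forms_subset_mono[OF _ i(2)] c(1) by blast
      then show ?thesis ..
    qed
  qed
qed (use form_tuples_nth[OF Fs] js pos in \<open>auto simp: subset_iff Suc_le_eq\<close>)

lemma minimal_generatorsD:
  assumes "minimal_generators Fs" "j < length Fs"
  shows "Fs ! j \<notin> lincombs ((!) Fs) ({..<length Fs} - {j})"
proof -
  have "{Fs ! l |l. l < length Fs \<and> l \<noteq> j} = (!) Fs ` ({..<length Fs} - {j})" by auto
  then show ?thesis using assms ideal_generated_image[of "{..<length Fs} - {j}" "(!) Fs"]
    by (auto simp: minimal_generators_def)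
qed

lemma ideal_generated_set: "ideal_generated (set Fs) = lincombs ((!) Fs) {..<length Fs}"
proof -
  have "set Fs = (!) Fs ` {..<length Fs}" by (auto simp: set_conv_nth)
  then show ?thesis by (simp add: ideal_generated_image)
qed

lemma lincombs_irrelevant:
  fixes Fs :: "('v::finite, 'k::comm_ring_1) mpoly list"
  assumes Fs: "Fs \<in> form_tuples ds" and pos: "\<forall>d\<in>set ds. 1 \<le> d" and A: "A \<subseteq> {..<length ds}"
  shows "lincombs ((!) Fs) A \<subseteq> irrelevant_ideal"
proof
  fix f assume "f \<in> lincombs ((!) Fs) A"
  then obtain c where c: "f = (\<Sum>j\<in>A. c j * Fs ! j)" by (auto simp: lincombs_def)
  have "Fs ! j \<in> irrelevant_ideal" if "j \<in> A" for j
  proof (rule forms_irrelevant)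
    show "Fs ! j \<in> forms (int (ds ! j))" using form_tuples_nth[OF Fs] A that by auto
    have "1 \<le> ds ! j" using pos A that by auto
    then show "int (ds ! j) \<noteq> 0" by simp
  qed
  then show "f \<in> irrelevant_ideal" unfolding c by (intro irrelevant_sum irrelevant_mult2)
qed

text \<open>The \<open>GREATEST\<close> in the definition has a meaning because the degrees
  concerned form a nonempty bounded set: degree 0 belongs to it since 1 is not in the ideal, and
  \<open>N\<close> bounds it.\<close>

lemma max_socle_degree:
  fixes Fs :: "('v::finite, 'k::field) mpoly list"
  assumes Fs: "Fs \<in> form_tuples ds" and pos: "\<forall>d\<in>set ds. 1 \<le> d"
    and N: "forms (int N) \<subseteq> lincombs ((!) Fs) {..<length ds}"
  defines "c \<equiv> max_socle_degree (ideal_generated (set Fs))"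
  shows "\<not> forms (int c) \<subseteq> lincombs ((!) Fs) {..<length ds}" "c < N"
    "\<And>j. c < j \<Longrightarrow> forms (int j) \<subseteq> lincombs ((!) Fs) {..<length ds}"
proof -
  let ?I = "lincombs ((!) Fs) {..<length ds}"
  let ?P = "\<lambda>j. \<exists>f\<in>forms (int j). f \<notin> ?I"
  have c: "c = (GREATEST j. ?P j)"
    unfolding c_def max_socle_degree_def ideal_generated_set using form_tuples_length[OF Fs] by simp
  have "1 \<notin> ?I" using lincombs_irrelevant[OF Fs pos, of "{..<length ds}"] one_not_irrelevant by blast
  then have 0: "?P 0" using forms_1 by (metis of_nat_0)
  have bound: "j < N" if "?P j" for j
    using forms_subset_mono[OF N, of j] that by (meson not_le subsetD)
  then have bound': "\<And>j. ?P j \<Longrightarrow> j \<le> N" by (meson less_imp_le)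
  have Pc: "?P c" unfolding c by (rule GreatestI_nat[of ?P, OF 0 bound'])
  then show "\<not> forms (int c) \<subseteq> ?I" "c < N" using bound by blast+
  show "forms (int j) \<subseteq> ?I" if "c < j" for j
    using Greatest_le_nat[of ?P j N, OF _ bound'] that unfolding c by (meson not_le subsetI)
qed

lemma degree_le_Suc_socle:
  fixes Fs :: "('v::finite, 'k::field) mpoly list"
  assumes Fs: "Fs \<in> form_tuples ds" and min: "minimal_generators Fs" and j: "j < length ds"
    and c: "\<And>j. c < j \<Longrightarrow> forms (int j) \<subseteq> lincombs ((!) Fs) {..<length ds}"
  shows "ds ! j \<le> Suc c"
proof (rule ccontr)
  assume "\<not> ?thesis"
  then obtain e where e: "ds ! j = Suc e" "c < e" by (metis Suc_less_eq less_imp_Suc_add not_le Suc_lessE)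
  let ?L = "lincombs ((!) Fs) ({..<length ds} - {j})"
  have "forms (int e) \<subseteq> ?L"
  proof
    fix f :: "('v, 'k) mpoly" assume f: "f \<in> forms (int e)"
    then have "f \<in> lincombs ((!) Fs) {..<length ds}" using c e by blast
    then obtain a where a: "f = (\<Sum>l<length ds. a l * Fs ! l)"
        "\<And>l. l < length ds \<Longrightarrow> a l \<in> forms (int e - int (ds ! l))"
      using lincombs_homogeneous[of f "(!) Fs" "{..<length ds}" "int e" "\<lambda>l. int (ds ! l)"] f
        form_tuples_nth[OF Fs] by auto
    have "a j = 0" using forms_neg[OF a(2)[OF j]] e by simp
    then have "f = (\<Sum>l\<in>{..<length ds} - {j}. a l * Fs ! l)"
      unfolding a(1) using j by (intro sum.mono_neutral_right) auto
    then show "f \<in> ?L" by (rule lincombsI)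
  qed
  then have "forms (int (ds ! j)) \<subseteq> ?L" unfolding e(1) by (rule forms_subset_Suc)
  then show False
    using minimal_generatorsD[OF min, of j] form_tuples_nth[OF Fs j] form_tuples_length[OF Fs] j by auto
qed

lemma koszul_exact_socle:
  fixes Fs :: "('v::finite, 'k::field) mpoly list"
  assumes Fs: "Fs \<in> form_tuples ds" and pos: "\<forall>d\<in>set ds. 1 \<le> d" and min: "minimal_generators Fs"
    and js: "distinct (js @ [l])" "set (js @ [l]) = {..<length ds}"
    and l: "\<And>j. j < length ds \<Longrightarrow> ds ! j \<le> ds ! l"
    and rank: "prefix_maximal_rank N ds (js @ [l]) Fs"
    and N: "forms (int N) \<subseteq> lincombs ((!) Fs) {..<length ds}"
  defines "c \<equiv> max_socle_degree (ideal_generated (set Fs))"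
  shows "\<And>i t. i \<ge> 1 \<Longrightarrow> t \<le> int c + int i - 1 \<Longrightarrow>
      koszul_exact (\<lambda>j. int (ds ! j)) ((!) Fs) {..<length ds} i t"
    and "\<And>j. j < length ds \<Longrightarrow> ds ! j = Suc c \<Longrightarrow>
      koszul_exact (\<lambda>j. int (ds ! j)) ((!) Fs) {..<length ds} 1 (int (Suc c))"
proof -
  note socle = max_socle_degree[OF Fs pos N, folded c_def]
  show "koszul_exact (\<lambda>j. int (ds ! j)) ((!) Fs) {..<length ds} i t" if "i \<ge> 1" "t \<le> int c + int i - 1" for i t
    using koszul_exact_prefix[OF Fs pos js(1) _ rank _ _ that] socle js(2) by auto
  fix j assume j: "j < length ds" "ds ! j = Suc c"
  have l_lt: "l < length ds" using js by auto
  \<comment> \<open>The largest degree is at least \<open>c + 1\<close> because of \<open>j\<close>,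
    and no minimal generator exceeds \<open>c + 1\<close>.\<close>
  have dl: "ds ! l = Suc c"
    using l[OF j(1)] j(2) degree_le_Suc_socle[OF Fs min l_lt, of c] socle(3) by (simp add: le_antisym)
  have set_js: "set js = {..<length ds} - {l}" "l \<notin> set js" using js by auto
  have Fl: "Fs ! l \<notin> lincombs ((!) Fs) (set js)"
    using minimal_generatorsD[OF min, of l] l_lt form_tuples_length[OF Fs] set_js by simp
  \<comment> \<open>Here \<open>g\<close> has degree 0; if it were a nonzero constant, the last form
    would lie in the ideal of the others.\<close>
  have inj: "g \<in> lincombs ((!) Fs) (set js)"
    if "g \<in> forms (int (Suc c) - int (ds ! l))" "Fs ! l * g \<in> lincombs ((!) Fs) (set js)" for g
  proof -
    have "g \<in> forms 0" using that dl by simp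
    then have g: "g = mterm 0 (coef g 0)" by (rule forms_zero_const)
    show ?thesis
    proof (cases "coef g 0 = 0")
      case True
      then have "g = 0" using g by simp
      then show ?thesis by simp
    next
      case False
      have "mterm 0 (inverse (coef g 0)) * (Fs ! l * g) \<in> lincombs ((!) Fs) (set js)"
        by (rule lincombs_mult[OF that(2)])
      also have "mterm 0 (inverse (coef g 0)) * (Fs ! l * g) =
          (mterm 0 (inverse (coef g 0)) * mterm 0 (coef g 0)) * Fs ! l" 
        by (subst (2) g) (simp only: ac_simps)
      also have "\<dots> = Fs ! l" using False by (simp add: mult_single)
      finally show ?thesis using Fl by simp
    qed
  qed
  have "koszul_exact (\<lambda>j. int (ds ! j)) ((!) Fs) (insert l (set js)) 1 (int (Suc c))"
  proof (rule koszul_exact_insert)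
    show "koszul_exact (\<lambda>j. int (ds ! j)) ((!) Fs) (set js) 1 (int (Suc c))"
    proof (rule koszul_exact_prefix[OF Fs pos])
      show "prefix_maximal_rank N ds js Fs"
        unfolding prefix_maximal_rank_def
      proof (intro allI impI)
        fix s i assume s: "s < length js" and i: "i + ds ! (js ! s) \<le> N"
        then show "mult_injective (lincombs ((!) Fs) (set (take s js))) (Fs ! (js ! s)) i \<or>
          mult_surjective (lincombs ((!) Fs) (set (take s js))) (Fs ! (js ! s)) (ds ! (js ! s)) i"
          using rank[unfolded prefix_maximal_rank_def, rule_format, of s i] by (simp add: nth_append)
      qed
      \<comment> \<open>The last form itself has degree \<open>c + 1\<close> and lies outside this
        ideal, so the other forms have a vanishing range that reaches one degree further.\<close>
      show "\<not> forms (int (Suc c)) \<subseteq> lincombs ((!) Fs) (set js)"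
        using Fl form_tuples_nth[OF Fs l_lt] dl by auto
    qed (use js socle in auto)
  qed (use inj set_js form_tuples_nth[OF Fs] l_lt in auto)
  then show "koszul_exact (\<lambda>j. int (ds ! j)) ((!) Fs) {..<length ds} 1 (int (Suc c))"
    using js(2) by simp
qed

section \<open>The matrices of the Koszul complex\<close>

text \<open>Matrix times column, both as plain functions of indices with \<open>n\<close> columns.
  Only values at valid indices matter, which spares dimension conditions in the diagram
  chases.\<close>

definition lin_map :: "(nat \<Rightarrow> nat \<Rightarrow> 'a::comm_ring_1) \<Rightarrow> nat \<Rightarrow> (nat \<Rightarrow> 'a) \<Rightarrow> nat \<Rightarrow> 'a" where
  "lin_map M n u p = (\<Sum>q<n. M p q * u q)"

definition homogeneous :: "int list \<Rightarrow> int \<Rightarrow> (nat \<Rightarrow> ('v, 'k::zero) mpoly) \<Rightarrow> bool" where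
  "homogeneous a t u \<longleftrightarrow> (\<forall>q<length a. u q \<in> forms (t - a ! q))"

abbreviation koszul_subsets :: "nat \<Rightarrow> nat \<Rightarrow> nat set set" where
  "koszul_subsets r i \<equiv> {S. S \<subseteq> {..<r} \<and> card S = i}"

lemma subseq_subset: "xs \<in> set (subseqs ys) \<Longrightarrow> set xs \<subseteq> set ys"
  using subseqs_powset[of ys] by blast

lemma subseq_sorted: "xs \<in> set (subseqs ys) \<Longrightarrow> sorted ys \<Longrightarrow> distinct ys \<Longrightarrow> sorted xs \<and> distinct xs"
  for ys :: "nat list"
  by (induction ys arbitrary: xs) (fastforce simp: Let_def dest: subseq_subset[THEN subsetD])+

lemma koszul_basis_elem:
  assumes "q < length (koszul_basis r i)"
  shows "sorted (koszul_basis r i ! q)" "distinct (koszul_basis r i ! q)"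
    "length (koszul_basis r i ! q) = i" "set (koszul_basis r i ! q) \<subseteq> {..<r}"
    "card (set (koszul_basis r i ! q)) = i"
proof -
  have "koszul_basis r i ! q \<in> set (koszul_basis r i)" using assms by simp
  then have *: "koszul_basis r i ! q \<in> set (subseqs [0..<r])" "length (koszul_basis r i ! q) = i"
    by (auto simp: koszul_basis_def)
  then show "sorted (koszul_basis r i ! q)" and d: "distinct (koszul_basis r i ! q)"
    and l: "length (koszul_basis r i ! q) = i"
    using subseq_sorted[OF *(1)] by auto
  show "card (set (koszul_basis r i ! q)) = i" using distinct_card[OF d] l by simp
  have "set (koszul_basis r i ! q) \<in> set ` set (subseqs [0..<r])" using *(1) by blast
  then show "set (koszul_basis r i ! q) \<subseteq> {..<r}" unfolding subseqs_powset by auto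
qed

lemma distinct_koszul_basis: "distinct (map set (koszul_basis r i))"
  unfolding koszul_basis_def by (rule distinct_map_filter) (rule distinct_set_subseqs, simp)

text \<open>The bridge between two descriptions of the Koszul complex: matrices indexed by
  increasing lists, as in the statement, and chains on subsets, in which homology was
  computed.\<close>

lemma koszul_basis_bij:
  "bij_betw (\<lambda>q. set (koszul_basis r i ! q)) {..<length (koszul_basis r i)} (koszul_subsets r i)"
  unfolding bij_betw_def
proof
  show "inj_on (\<lambda>q. set (koszul_basis r i ! q)) {..<length (koszul_basis r i)}"
  proof (rule inj_onI)
    fix p q assume "p \<in> {..<length (koszul_basis r i)}" "q \<in> {..<length (koszul_basis r i)}"
      "set (koszul_basis r i ! p) = set (koszul_basis r i ! q)"
    then show "p = q"
      using nth_eq_iff_index_eq[OF distinct_koszul_basis[of r i], of p q] by simp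
  qed
  show "(\<lambda>q. set (koszul_basis r i ! q)) ` {..<length (koszul_basis r i)} = koszul_subsets r i"
  proof (intro equalityI subsetI)
    fix S assume "S \<in> (\<lambda>q. set (koszul_basis r i ! q)) ` {..<length (koszul_basis r i)}"
    then obtain q where "q < length (koszul_basis r i)" "S = set (koszul_basis r i ! q)" by auto
    then show "S \<in> koszul_subsets r i" using koszul_basis_elem[of q r i] by auto
  next
    fix S assume S: "S \<in> koszul_subsets r i"
    then have "S \<in> set ` set (subseqs [0..<r])" unfolding subseqs_powset by auto
    then obtain xs where xs: "xs \<in> set (subseqs [0..<r])" "S = set xs" by auto
    then have "distinct xs" using subseq_sorted[OF xs(1)] by simp
    then have "xs \<in> set (koszul_basis r i)" using xs S distinct_card[of xs] by (simp add: koszul_basis_def)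
    then obtain q where "q < length (koszul_basis r i)" "xs = koszul_basis r i ! q" by (auto simp: in_set_conv_nth)
    then show "S \<in> (\<lambda>q. set (koszul_basis r i ! q)) ` {..<length (koszul_basis r i)}" using xs by auto
  qed
qed

definition koszul_pos :: "nat \<Rightarrow> nat \<Rightarrow> nat set \<Rightarrow> nat" where
  "koszul_pos r i = the_inv_into {..<length (koszul_basis r i)} (\<lambda>q. set (koszul_basis r i ! q))"

lemma koszul_pos_set: "q < length (koszul_basis r i) \<Longrightarrow> koszul_pos r i (set (koszul_basis r i ! q)) = q"
  unfolding koszul_pos_def using koszul_basis_bij[of r i]
  by (intro the_inv_into_f_f) (auto simp: bij_betw_def)

lemma koszul_pos:
  assumes "S \<subseteq> {..<r}" "card S = i"
  shows "koszul_pos r i S < length (koszul_basis r i)" "set (koszul_basis r i ! koszul_pos r i S) = S"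
proof -
  have "S \<in> (\<lambda>q. set (koszul_basis r i ! q)) ` {..<length (koszul_basis r i)}"
    using koszul_basis_bij[of r i] assms by (auto simp: bij_betw_def)
  then obtain q where "q < length (koszul_basis r i)" "S = set (koszul_basis r i ! q)" by auto
  then show "koszul_pos r i S < length (koszul_basis r i)" "set (koszul_basis r i ! koszul_pos r i S) = S"
    by (auto simp: koszul_pos_set)
qed

lemma koszul_module_length [simp]: "length (koszul_module ds i) = length (koszul_basis (length ds) i)"
  by (simp add: koszul_module_def)

lemma koszul_module_nth:
  assumes "q < length (koszul_basis (length ds) i)"
  shows "koszul_module ds i ! q = (\<Sum>j\<in>set (koszul_basis (length ds) i ! q). int (ds ! j))"
  using assms koszul_basis_elem(2)[OF assms] by (simp add: koszul_module_def sum_list_distinct_conv_sum_set)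

text \<open>An increasing list is determined by its set, so the deletion of an entry can be
  recognised on sets.\<close>

lemma delete_nth_iff:
  fixes xs ys :: "nat list"
  assumes xs: "sorted xs" "distinct xs" and ys: "sorted ys" "distinct ys" and l: "l < length ys"
  shows "xs = take l ys @ drop (Suc l) ys \<longleftrightarrow> ys ! l \<notin> set xs \<and> set ys = insert (ys ! l) (set xs)"
proof -
  have split: "ys = take l ys @ ys ! l # drop (Suc l) ys" using l by (rule id_take_nth_drop)
  let ?zs = "take l ys @ drop (Suc l) ys"
  have d: "distinct ?zs" "ys ! l \<notin> set ?zs" "sorted ?zs"
  proof -
    have "distinct (take l ys @ ys ! l # drop (Suc l) ys)" using ys(2) split by metis
    then show "distinct ?zs" "ys ! l \<notin> set ?zs" by auto
    have "sorted (take l ys @ ys ! l # drop (Suc l) ys)" using ys(1) split by metis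
    then show "sorted ?zs" by (auto simp: sorted_append)
  qed
  have s: "set ys = insert (ys ! l) (set ?zs)" by (subst split) auto
  show ?thesis
  proof
    assume "xs = ?zs"
    then show "ys ! l \<notin> set xs \<and> set ys = insert (ys ! l) (set xs)" using d s by simp
  next
    assume "ys ! l \<notin> set xs \<and> set ys = insert (ys ! l) (set xs)"
    then have "set xs = set ?zs" using s d(2) by (metis insert_ident)
    then show "xs = ?zs" using sorted_distinct_set_unique[OF xs d(3,1)] by simp
  qed
qed

text \<open>Identifies the sign given by the position of the deleted entry with
  \<open>koszul_sign\<close>.\<close>

lemma card_less_nth:
  fixes ys :: "nat list"
  assumes ys: "sorted ys" "distinct ys" and l: "l < length ys"
  shows "card {t \<in> set ys. t < ys ! l} = l"
proof -
  have lt: "ys ! i < ys ! j \<longleftrightarrow> i < j" if "i < length ys" "j < length ys" for i j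
    using sorted_nth_mono[OF ys(1), of i j] sorted_nth_mono[OF ys(1), of j i]
      nth_eq_iff_index_eq[OF ys(2), of i j] that by (cases "i < j") (auto simp: not_less less_le)
  have "{t \<in> set ys. t < ys ! l} = (!) ys ` {..<l}"
  proof (intro equalityI subsetI)
    fix t assume "t \<in> {t \<in> set ys. t < ys ! l}"
    then obtain i where "i < length ys" "t = ys ! i" "t < ys ! l" by (auto simp: in_set_conv_nth)
    then show "t \<in> (!) ys ` {..<l}" using lt[of i l] l by auto
  next
    fix t assume "t \<in> (!) ys ` {..<l}"
    then obtain i where "i < l" "t = ys ! i" by auto
    then show "t \<in> {t \<in> set ys. t < ys ! l}" using lt[of i l] l by auto
  qed
  moreover have "inj_on ((!) ys) {..<l}" using ys l by (auto simp: inj_on_def nth_eq_iff_index_eq)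
  ultimately show ?thesis by (simp add: card_image)
qed

lemma koszul_map_dim [simp]:
  "koszul_map Fs i \<in> carrier_mat (length (koszul_basis (length Fs) i)) (length (koszul_basis (length Fs) (Suc i)))"
  by (simp add: koszul_map_def Let_def)

lemma koszul_map_entry:
  assumes p: "p < length (koszul_basis (length Fs) i)" and q: "q < length (koszul_basis (length Fs) (Suc i))"
  defines "T \<equiv> set (koszul_basis (length Fs) i ! p)" and "S \<equiv> set (koszul_basis (length Fs) (Suc i) ! q)"
  shows "koszul_map Fs i $$ (p, q) =
    (\<Sum>j\<in>{..<length Fs} - T. if S = insert j T then koszul_sign j T * Fs ! j else 0)"
proof -
  let ?xs = "koszul_basis (length Fs) i ! p" and ?ys = "koszul_basis (length Fs) (Suc i) ! q"
  note xs = koszul_basis_elem[OF p] and ys = koszul_basis_elem[OF q]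
  let ?g = "\<lambda>j. if j \<notin> T \<and> S = insert j T then koszul_sign j T * Fs ! j else 0"
  have "koszul_map Fs i $$ (p, q) = (\<Sum>l<Suc i. if ?xs = take l ?ys @ drop (Suc l) ?ys
           then (-1) ^ l * Fs ! (?ys ! l) else 0)"
    using p q by (simp add: koszul_map_def Let_def del: sum.lessThan_Suc)
  also have "\<dots> = (\<Sum>l<Suc i. ?g (?ys ! l))"
  proof (rule sum.cong)
    fix l assume "l \<in> {..<Suc i}"
    then have l: "l < length ?ys" using ys(3) by simp
    have "koszul_sign (?ys ! l) T = ((-1) ^ l :: ('a, 'b) mpoly)" if "S = insert (?ys ! l) T"
    proof -
      have "{t\<in>T. t < ?ys ! l} = {t \<in> set ?ys. t < ?ys ! l}" using that unfolding S_def by auto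
      then show ?thesis using card_less_nth[OF ys(1,2) l] by (simp add: koszul_sign_def)
    qed
    then show "(if ?xs = take l ?ys @ drop (Suc l) ?ys then (-1) ^ l * Fs ! (?ys ! l) else 0) = ?g (?ys ! l)"
      unfolding delete_nth_iff[OF xs(1,2) ys(1,2) l] S_def T_def by simp
  qed simp
  also have "\<dots> = sum ?g S"
  proof -
    have "bij_betw ((!) ?ys) {..<Suc i} S"
      using ys(2,3) unfolding S_def by (metis bij_betw_nth)
    then show ?thesis by (rule sum.reindex_bij_betw)
  qed
  also have "\<dots> = sum ?g {..<length Fs}"
    by (rule sum.mono_neutral_left) (use ys(4) in \<open>auto simp: S_def\<close>)
  also have "\<dots> = (\<Sum>j\<in>{..<length Fs} - T. if S = insert j T then koszul_sign j T * Fs ! j else 0)"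
    by (rule sum.mono_neutral_cong_right) auto
  finally show ?thesis .
qed

text \<open>Transports both the vanishing of the square of the differential and exactness from
  chains to matrices. The chain \<open>w\<close> is constrained only on the subsets that index the
  basis.\<close>

lemma lin_map_koszul:
  assumes p: "p < length (koszul_basis (length Fs) i)"
    and w: "\<And>q. q < length (koszul_basis (length Fs) (Suc i)) \<Longrightarrow> w (set (koszul_basis (length Fs) (Suc i) ! q)) = u q"
  shows "lin_map (\<lambda>p q. koszul_map Fs i $$ (p, q)) (length (koszul_basis (length Fs) (Suc i))) u p =
    koszul_diff ((!) Fs) {..<length Fs} w (set (koszul_basis (length Fs) i ! p))"
proof -
  let ?T = "set (koszul_basis (length Fs) i ! p)" and ?m = "length (koszul_basis (length Fs) (Suc i))"
  let ?S = "\<lambda>q. set (koszul_basis (length Fs) (Suc i) ! q)"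
  note T = koszul_basis_elem[OF p]
  have cT: "card ?T = i" using T(5) .
  have "lin_map (\<lambda>p q. koszul_map Fs i $$ (p, q)) ?m u p =
    (\<Sum>q<?m. \<Sum>j\<in>{..<length Fs} - ?T. if ?S q = insert j ?T then koszul_sign j ?T * Fs ! j * u q else 0)"
    unfolding lin_map_def
    by (intro sum.cong refl) (use p in \<open>auto simp: koszul_map_entry sum_distrib_right intro!: sum.cong\<close>)
  also have "\<dots> = (\<Sum>j\<in>{..<length Fs} - ?T. \<Sum>q<?m. if ?S q = insert j ?T then koszul_sign j ?T * Fs ! j * u q else 0)"
    by (rule sum.swap)
  also have "\<dots> = (\<Sum>j\<in>{..<length Fs} - ?T. koszul_sign j ?T * Fs ! j * w (insert j ?T))"
  proof (rule sum.cong)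
    fix j assume j: "j \<in> {..<length Fs} - ?T"
    then have ins: "insert j ?T \<subseteq> {..<length Fs}" "card (insert j ?T) = Suc i" using T(4) cT by auto
    let ?q = "koszul_pos (length Fs) (Suc i) (insert j ?T)"
    note pos = koszul_pos[OF ins]
    have "(\<Sum>q<?m. if ?S q = insert j ?T then koszul_sign j ?T * Fs ! j * u q else 0) =
        (\<Sum>q<?m. if q = ?q then koszul_sign j ?T * Fs ! j * u ?q else 0)"
    proof (intro sum.cong refl)
      fix q assume "q \<in> {..<?m}"
      then have "?S q = insert j ?T \<longleftrightarrow> q = ?q" using pos koszul_pos_set[of q "length Fs" "Suc i"] by auto
      then show "(if ?S q = insert j ?T then koszul_sign j ?T * Fs ! j * u q else 0) =
        (if q = ?q then koszul_sign j ?T * Fs ! j * u ?q else 0)" by auto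
    qed
    also have "\<dots> = koszul_sign j ?T * Fs ! j * u ?q" using pos by simp
    also have "u ?q = w (insert j ?T)" using w[OF pos(1)] pos(2) by simp
    finally show "(\<Sum>q<?m. if ?S q = insert j ?T then koszul_sign j ?T * Fs ! j * u q else 0) =
      koszul_sign j ?T * Fs ! j * w (insert j ?T)" .
  qed simp
  finally show ?thesis by (simp add: koszul_diff_def)
qed

lemma koszul_map_irrelevant:
  fixes Fs :: "('v::finite, 'k::comm_ring_1) mpoly list"
  assumes Fs: "Fs \<in> form_tuples ds" and pos: "\<forall>d\<in>set ds. 1 \<le> d"
    and p: "p < length (koszul_basis (length ds) i)" and q: "q < length (koszul_basis (length ds) (Suc i))"
  shows "koszul_map Fs i $$ (p, q) \<in> irrelevant_ideal"
    "koszul_map Fs i $$ (p, q) \<in> forms (koszul_module ds (Suc i) ! q - koszul_module ds i ! p)"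
proof -
  have len: "length Fs = length ds" using form_tuples_length[OF Fs] .
  let ?T = "set (koszul_basis (length ds) i ! p)" and ?S = "set (koszul_basis (length ds) (Suc i) ! q)"
  have *: "koszul_map Fs i $$ (p, q) =
    (\<Sum>j\<in>{..<length ds} - ?T. if ?S = insert j ?T then koszul_sign j ?T * Fs ! j else 0)"
    using koszul_map_entry[of p Fs i q] p q unfolding len by simp
  have irr: "Fs ! j \<in> irrelevant_ideal" if "j < length ds" for j
  proof (rule forms_irrelevant)
    show "Fs ! j \<in> forms (int (ds ! j))" using form_tuples_nth[OF Fs] that by auto
    have "1 \<le> ds ! j" using pos that by auto
    then show "int (ds ! j) \<noteq> 0" by simp
  qed
  show "koszul_map Fs i $$ (p, q) \<in> irrelevant_ideal"
    unfolding * by (intro irrelevant_sum) (auto intro: irrelevant_mult2 irr)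
  show "koszul_map Fs i $$ (p, q) \<in> forms (koszul_module ds (Suc i) ! q - koszul_module ds i ! p)"
    unfolding * koszul_module_nth[OF p] koszul_module_nth[OF q]
  proof (rule forms_sum)
    fix j assume j: "j \<in> {..<length ds} - ?T"
    show "(if ?S = insert j ?T then koszul_sign j ?T * Fs ! j else 0) \<in>
      forms ((\<Sum>j\<in>?S. int (ds ! j)) - (\<Sum>j\<in>?T. int (ds ! j)))"
    proof (cases "?S = insert j ?T")
      case True
      then have "(\<Sum>j\<in>?S. int (ds ! j)) = int (ds ! j) + (\<Sum>j\<in>?T. int (ds ! j))" using j by simp
      then show ?thesis using True j form_tuples_nth[OF Fs, of j] by (simp add: forms_koszul_sign)
    qed simp
  qed
qed

lemma koszul_map_comp:
  fixes Fs :: "('v, 'k::comm_ring_1) mpoly list"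
  assumes p: "p < length (koszul_basis (length Fs) i)"
  shows "lin_map (\<lambda>p q. koszul_map Fs i $$ (p, q)) (length (koszul_basis (length Fs) (Suc i)))
    (lin_map (\<lambda>p q. koszul_map Fs (Suc i) $$ (p, q)) (length (koszul_basis (length Fs) (Suc (Suc i)))) u) p = 0"
proof -
  let ?w = "\<lambda>S. u (koszul_pos (length Fs) (Suc (Suc i)) S)"
  have "lin_map (\<lambda>p q. koszul_map Fs i $$ (p, q)) (length (koszul_basis (length Fs) (Suc i)))
    (lin_map (\<lambda>p q. koszul_map Fs (Suc i) $$ (p, q)) (length (koszul_basis (length Fs) (Suc (Suc i)))) u) p =
    koszul_diff ((!) Fs) {..<length Fs} (koszul_diff ((!) Fs) {..<length Fs} ?w) (set (koszul_basis (length Fs) i ! p))"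
    by (rule lin_map_koszul[OF p], rule lin_map_koszul[symmetric]) (auto simp: koszul_pos_set)
  then show ?thesis using koszul_diff_diff[of "{..<length Fs}"] koszul_basis_elem(4)[OF p] by auto
qed

lemma koszul_map_exact:
  fixes Fs :: "('v::finite, 'k::field) mpoly list"
  assumes Fs: "Fs \<in> form_tuples ds"
    and ex: "koszul_exact (\<lambda>j. int (ds ! j)) ((!) Fs) {..<length ds} (Suc i) t"
    and u: "homogeneous (koszul_module ds (Suc i)) t u"
    and cycle: "\<And>p. p < length (koszul_basis (length ds) i) \<Longrightarrow>
      lin_map (\<lambda>p q. koszul_map Fs i $$ (p, q)) (length (koszul_basis (length ds) (Suc i))) u p = 0"
  obtains w where "homogeneous (koszul_module ds (Suc (Suc i))) t w"
    "\<And>p. p < length (koszul_basis (length ds) (Suc i)) \<Longrightarrow>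
      u p = lin_map (\<lambda>p q. koszul_map Fs (Suc i) $$ (p, q)) (length (koszul_basis (length ds) (Suc (Suc i)))) w p"
proof -
  have len: "length Fs = length ds" using form_tuples_length[OF Fs] .
  let ?r = "length ds"
  let ?u = "\<lambda>S. u (koszul_pos ?r (Suc i) S)"
  have "koszul_homogeneous (\<lambda>j. int (ds ! j)) {..<?r} (Suc i) t ?u"
    unfolding koszul_homogeneous_def
  proof (intro allI impI)
    fix S assume "S \<subseteq> {..<?r}" "card S = Suc i"
    note pos = koszul_pos[OF this]
    show "?u S \<in> forms (t - (\<Sum>j\<in>S. int (ds ! j)))"
      using u pos koszul_module_nth[OF pos(1)] by (auto simp: homogeneous_def)
  qed
  moreover have "koszul_diff ((!) Fs) {..<?r} ?u T = 0" if T: "T \<subseteq> {..<?r}" "Suc (card T) = Suc i" for T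
  proof -
    have pos: "koszul_pos ?r i T < length (koszul_basis ?r i)" "set (koszul_basis ?r i ! koszul_pos ?r i T) = T"
      using koszul_pos[of T ?r i] T by auto
    have "koszul_diff ((!) Fs) {..<?r} ?u (set (koszul_basis ?r i ! koszul_pos ?r i T)) = 0"
      using lin_map_koszul[of "koszul_pos ?r i T" Fs i ?u u] cycle[OF pos(1)] pos(1) koszul_pos_set
      unfolding len by simp
    then show ?thesis using pos(2) by simp
  qed
  ultimately obtain w where w: "koszul_homogeneous (\<lambda>j. int (ds ! j)) {..<?r} (Suc (Suc i)) t w"
    "\<forall>S\<subseteq>{..<?r}. card S = Suc i \<longrightarrow> ?u S = koszul_diff ((!) Fs) {..<?r} w S"
    using ex unfolding koszul_exact_def by blast
  show ?thesis
  proof (rule that)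
    show "homogeneous (koszul_module ds (Suc (Suc i))) t (\<lambda>q. w (set (koszul_basis ?r (Suc (Suc i)) ! q)))"
      unfolding homogeneous_def
    proof (intro allI impI)
      fix q assume "q < length (koszul_module ds (Suc (Suc i)))"
      then have q: "q < length (koszul_basis ?r (Suc (Suc i)))" by simp
      have "set (koszul_basis ?r (Suc (Suc i)) ! q) \<subseteq> {..<?r}" "card (set (koszul_basis ?r (Suc (Suc i)) ! q)) = Suc (Suc i)"
        using koszul_basis_elem[OF q] by auto
      then show "w (set (koszul_basis ?r (Suc (Suc i)) ! q)) \<in> forms (t - koszul_module ds (Suc (Suc i)) ! q)"
        using w(1) unfolding koszul_module_nth[OF q] koszul_homogeneous_def by blast
    qed
    fix p assume p: "p < length (koszul_basis ?r (Suc i))"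
    have "set (koszul_basis ?r (Suc i) ! p) \<subseteq> {..<?r}" "card (set (koszul_basis ?r (Suc i) ! p)) = Suc i"
      using koszul_basis_elem[OF p] by auto
    then have "?u (set (koszul_basis ?r (Suc i) ! p)) = koszul_diff ((!) Fs) {..<?r} w (set (koszul_basis ?r (Suc i) ! p))"
      using w(2) by blast
    then show "u p = lin_map (\<lambda>p q. koszul_map Fs (Suc i) $$ (p, q)) (length (koszul_basis ?r (Suc (Suc i))))
        (\<lambda>q. w (set (koszul_basis ?r (Suc (Suc i)) ! q))) p"
      using lin_map_koszul[of p Fs "Suc i" w "\<lambda>q. w (set (koszul_basis ?r (Suc (Suc i)) ! q))"] p koszul_pos_set[OF p]
      unfolding len by simp
  qed
qed

lemma koszul_basis_0 [simp]: "koszul_basis r 0 = [[]]"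
proof -
  have "filter (\<lambda>S. length S = 0) (subseqs xs) = [[]]" for xs :: "nat list"
    by (induction xs) (auto simp: Let_def filter_map o_def)
  then show ?thesis by (simp add: koszul_basis_def)
qed

lemma koszul_module_0 [simp]: "koszul_module ds 0 = [0]"
  by (simp add: koszul_module_def)

lemma koszul_map_0_range:
  fixes Fs :: "('v::finite, 'k::comm_ring_1) mpoly list"
  assumes Fs: "Fs \<in> form_tuples ds" and f: "f \<in> lincombs ((!) Fs) {..<length ds}" "f \<in> forms t"
  obtains w where "homogeneous (koszul_module ds 1) t w"
    "f = lin_map (\<lambda>p q. koszul_map Fs 0 $$ (p, q)) (length (koszul_basis (length ds) 1)) w 0"
proof -
  have len: "length Fs = length ds" using form_tuples_length[OF Fs] .
  let ?r = "length ds"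
  obtain c where c: "f = (\<Sum>j<?r. c j * Fs ! j)" "\<And>j. j < ?r \<Longrightarrow> c j \<in> forms (t - int (ds ! j))"
    using lincombs_homogeneous[of f "(!) Fs" "{..<?r}" t "\<lambda>j. int (ds ! j)"] f form_tuples_nth[OF Fs] by auto
  let ?w = "\<lambda>S. c (the_elem S)"
  show ?thesis
  proof (rule that)
    show "homogeneous (koszul_module ds 1) t (\<lambda>q. ?w (set (koszul_basis ?r 1 ! q)))"
      unfolding homogeneous_def
    proof (intro allI impI)
      fix q assume "q < length (koszul_module ds 1)"
      then have q: "q < length (koszul_basis ?r 1)" by simp
      have "card (set (koszul_basis ?r 1 ! q)) = 1" "set (koszul_basis ?r 1 ! q) \<subseteq> {..<?r}"
        using koszul_basis_elem[OF q] by auto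
      then obtain j where "set (koszul_basis ?r 1 ! q) = {j}" "j < ?r" by (auto simp: card_1_singleton_iff)
      then show "?w (set (koszul_basis ?r 1 ! q)) \<in> forms (t - koszul_module ds 1 ! q)"
        using c(2) unfolding koszul_module_nth[OF q] by simp
    qed
    show "f = lin_map (\<lambda>p q. koszul_map Fs 0 $$ (p, q)) (length (koszul_basis ?r 1))
        (\<lambda>q. ?w (set (koszul_basis ?r 1 ! q))) 0"
      using lin_map_koszul[of 0 Fs 0 ?w "\<lambda>q. ?w (set (koszul_basis ?r 1 ! q))"]
      unfolding len by (simp add: koszul_diff_def c(1) mult.commute)
  qed
qed

lemma koszul_map_0_entry:
  assumes len: "length Fs = length ds" and q: "q < length (koszul_basis (length ds) 1)"
  shows "koszul_map Fs 0 $$ (0, q) \<in> lincombs ((!) Fs) {..<length ds}"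
  using koszul_map_entry[of 0 Fs 0 q] q unfolding len
  by (auto intro!: lincombs_sum lincombs_nth[where g = 1, simplified])

section \<open>Graded matrices\<close>

definition graded_matrix :: "int list \<Rightarrow> int list \<Rightarrow> (nat \<Rightarrow> nat \<Rightarrow> ('v, 'k::zero) mpoly) \<Rightarrow> bool" where
  "graded_matrix a b M \<longleftrightarrow> (\<forall>p<length b. \<forall>q<length a. M p q \<in> forms (a ! q - b ! p))"

text \<open>Membership in the submodule spanned by the basis vectors of degree at most
  \<open>\<beta>\<close>; the coefficients are arbitrary polynomials.\<close>

definition supported :: "int list \<Rightarrow> int \<Rightarrow> (nat \<Rightarrow> 'a::zero) \<Rightarrow> bool" where
  "supported a \<beta> u \<longleftrightarrow> (\<forall>q<length a. u q \<noteq> 0 \<longrightarrow> a ! q \<le> \<beta>)"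

lemma lin_map_cong: "(\<And>q. q < n \<Longrightarrow> u q = w q) \<Longrightarrow> lin_map M n u p = lin_map M n w p"
  by (simp add: lin_map_def)

lemma lin_map_diff: "lin_map M n (\<lambda>q. u q - w q) p = lin_map M n u p - lin_map M n w p"
  by (simp add: lin_map_def algebra_simps sum_subtractf)

lemma lin_map_add: "lin_map M n (\<lambda>q. u q + w q) p = lin_map M n u p + lin_map M n w p"
  by (simp add: lin_map_def algebra_simps sum.distrib)

lemma lin_map_sum: "lin_map M n (\<lambda>q. \<Sum>v\<in>A. x v * u v q) p = (\<Sum>v\<in>A. x v * lin_map M n (u v) p)"
  unfolding lin_map_def sum_distrib_left by (subst sum.swap) (simp add: ac_simps)

lemma lin_map_unit: "s < n \<Longrightarrow> lin_map M n (\<lambda>q. if q = s then 1 else 0) p = M p s"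
  by (simp add: lin_map_def if_distrib[of "\<lambda>x. _ * x"] cong: if_cong)

lemma homogeneous_diff: "homogeneous a t u \<Longrightarrow> homogeneous a t w \<Longrightarrow> homogeneous a t (\<lambda>q. u q - w q)"
  for u :: "nat \<Rightarrow> ('v, 'k::comm_ring_1) mpoly"
  by (simp add: homogeneous_def forms_diff)

lemma homogeneous_add: "homogeneous a t u \<Longrightarrow> homogeneous a t w \<Longrightarrow> homogeneous a t (\<lambda>q. u q + w q)"
  for u :: "nat \<Rightarrow> ('v, 'k::comm_ring_1) mpoly"
  by (simp add: homogeneous_def forms_add)

lemma homogeneous_unit: "s < length a \<Longrightarrow> homogeneous a (a ! s) (\<lambda>q. if q = s then 1 else 0)"
  by (simp add: homogeneous_def)

lemma homogeneous_supported: "homogeneous a t u \<Longrightarrow> supported a t u"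
  using forms_neg by (force simp: homogeneous_def supported_def)

lemma homogeneous_var_sum:
  fixes u :: "'v::finite \<Rightarrow> nat \<Rightarrow> ('v, 'k::comm_ring_1) mpoly"
  assumes "\<And>v. homogeneous a (t - 1) (u v)"
  shows "homogeneous a t (\<lambda>q. \<Sum>v\<in>UNIV. var v * u v q)"
  unfolding homogeneous_def
proof (intro allI impI forms_sum)
  fix q and v :: 'v assume "q < length a"
  then have "var v * u v q \<in> forms (1 + (t - 1 - a ! q))"
    using assms by (intro forms_mult) (auto simp: homogeneous_def)
  then show "var v * u v q \<in> forms (t - a ! q)" by simp
qed

lemma lin_map_homogeneous:
  fixes u :: "nat \<Rightarrow> ('v::finite, 'k::comm_ring_1) mpoly"
  assumes "graded_matrix a b M" "homogeneous a t u"
  shows "homogeneous b t (lin_map M (length a) u)"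
  unfolding homogeneous_def lin_map_def
proof (intro allI impI forms_sum)
  fix p q assume "p < length b" "q \<in> {..<length a}"
  then have "M p q * u q \<in> forms ((a ! q - b ! p) + (t - a ! q))"
    using assms by (intro forms_mult) (auto simp: graded_matrix_def homogeneous_def)
  then show "M p q * u q \<in> forms (t - b ! p)" by simp
qed

text \<open>Graded maps commute with taking components, so a preimage of a homogeneous element can
  be made homogeneous.\<close>

lemma lin_map_hcomp:
  fixes u :: "nat \<Rightarrow> ('v::finite, 'k::comm_ring_1) mpoly"
  assumes "graded_matrix a b M" "p < length b"
  shows "lin_map M (length a) (\<lambda>q. hcomp (t - a ! q) (u q)) p = hcomp (t - b ! p) (lin_map M (length a) u p)"
  unfolding lin_map_def hcomp_sum
proof (rule sum.cong)
  fix q assume "q \<in> {..<length a}"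
  then have "M p q \<in> forms (a ! q - b ! p)" using assms by (simp add: graded_matrix_def)
  from hcomp_mult[OF this, of "t - a ! q" "u q"]
  show "M p q * hcomp (t - a ! q) (u q) = hcomp (t - b ! p) (M p q * u q)" by simp
qed simp

lemma lin_map_irrelevant:
  fixes u :: "nat \<Rightarrow> ('v::finite, 'k::comm_ring_1) mpoly"
  assumes "\<And>q. q < n \<Longrightarrow> M p q \<in> irrelevant_ideal"
  shows "lin_map M n u p \<in> irrelevant_ideal"
  unfolding lin_map_def using assms by (intro irrelevant_sum irrelevant_mult) auto

lemma forms_irrelevant_pos:
  fixes f :: "('v::finite, 'k::comm_ring_1) mpoly"
  assumes "f \<in> forms t" "f \<in> irrelevant_ideal" "f \<noteq> 0"
  shows "1 \<le> t"
proof (rule ccontr)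
  assume "\<not> ?thesis"
  then consider "t < 0" | "t = 0" by linarith
  then show False
  proof cases
    case 1
    then show ?thesis using forms_neg[OF assms(1)] assms(3) by simp
  next
    case 2
    then have "f = mterm 0 (coef f 0)" using assms(1) forms_zero_const by blast
    then show ?thesis using assms(2,3) by (simp add: irrelevant_ideal_def)
  qed
qed

text \<open>A nonzero homogeneous entry in the irrelevant ideal has positive degree, so each basis
  vector is sent to combinations of basis vectors of strictly smaller degree.\<close>

lemma lin_map_supported:
  fixes u :: "nat \<Rightarrow> ('v::finite, 'k::comm_ring_1) mpoly"
  assumes M: "graded_matrix a b M" and irr: "\<And>p q. p < length b \<Longrightarrow> q < length a \<Longrightarrow> M p q \<in> irrelevant_ideal"
    and u: "supported a \<beta> u"
  shows "supported b (\<beta> - 1) (lin_map M (length a) u)"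
  unfolding supported_def
proof (intro allI impI)
  fix p assume p: "p < length b" and nz: "lin_map M (length a) u p \<noteq> 0"
  then obtain q where q: "q < length a" "M p q * u q \<noteq> 0"
    unfolding lin_map_def by (meson lessThan_iff sum.neutral)
  then have "1 \<le> a ! q - b ! p"
    using M p irr[OF p q(1)] by (intro forms_irrelevant_pos[of "M p q"]) (auto simp: graded_matrix_def)
  moreover have "a ! q \<le> \<beta>" using u q by (auto simp: supported_def)
  ultimately show "b ! p \<le> \<beta> - 1" by simp
qed

lemma irrelevant_decompose:
  fixes f :: "('v::finite, 'k::comm_ring_1) mpoly"
  assumes "f \<in> forms t" "f \<in> irrelevant_ideal"
  obtains c where "f = (\<Sum>v\<in>UNIV. var v * c v)" "\<And>v. c v \<in> forms (t - 1)"
proof -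
  have "f \<in> lincombs (\<lambda>v. var v) (UNIV :: 'v set)"
    using irrelevant_lincombs[of "\<lambda>v :: 'v. v" UNIV f] assms(2) by simp
  then obtain c where "f = (\<Sum>v\<in>UNIV. c v * var v)" "\<And>v. c v \<in> forms (t - 1)"
    using lincombs_homogeneous[of f "\<lambda>v. var v" UNIV t "\<lambda>_. 1"] assms(1) by auto
  then show thesis using that by (simp add: mult.commute)
qed

lemma homogeneous_irrelevant_decompose:
  fixes w :: "nat \<Rightarrow> ('v::finite, 'k::comm_ring_1) mpoly"
  assumes "homogeneous a t w" "\<And>p. p < length a \<Longrightarrow> w p \<in> irrelevant_ideal"
  obtains c where "\<And>v. homogeneous a (t - 1) (c v)" "\<And>p. p < length a \<Longrightarrow> w p = (\<Sum>v\<in>UNIV. var v * c v p)"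
proof -
  have "\<forall>p\<in>{..<length a}. \<exists>c. w p = (\<Sum>v\<in>UNIV. var v * c v) \<and> (\<forall>v. c v \<in> forms (t - 1 - a ! p))"
  proof
    fix p assume "p \<in> {..<length a}"
    then have "w p \<in> forms (t - a ! p)" "w p \<in> irrelevant_ideal" using assms by (auto simp: homogeneous_def)
    then obtain c where c: "w p = (\<Sum>v\<in>UNIV. var v * c v)" "\<And>v. c v \<in> forms (t - a ! p - 1)"
      using irrelevant_decompose by blast
    have "c v \<in> forms (t - 1 - a ! p)" for v using c(2)[of v] by (simp add: algebra_simps)
    then show "\<exists>c. w p = (\<Sum>v\<in>UNIV. var v * c v) \<and> (\<forall>v. c v \<in> forms (t - 1 - a ! p))"
      using c(1) by (intro exI[of _ c]) simp
  qed
  from bchoice[OF this] obtain c where c: "\<forall>p\<in>{..<length a}. w p = (\<Sum>v\<in>UNIV. var v * c p v) \<and>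
      (\<forall>v. c p v \<in> forms (t - 1 - a ! p))" by (rule exE)
  show thesis
  proof (rule that)
    show "homogeneous a (t - 1) (\<lambda>p. c p v)" for v using c by (simp add: homogeneous_def)
    show "w p = (\<Sum>v\<in>UNIV. var v * c p v)" if "p < length a" for p using c that by simp
  qed
qed

text \<open>Induction on the degree. After subtracting a lift modulo the irrelevant ideal, the
  remainder is a sum of variables times elements of degree \<open>t - 1\<close>, which are lifted by
  the induction hypothesis.\<close>

lemma graded_nakayama:
  fixes M :: "nat \<Rightarrow> nat \<Rightarrow> ('v::finite, 'k::comm_ring_1) mpoly"
  assumes M: "graded_matrix k a M"
    and surj: "\<And>t v. t \<le> \<beta> \<Longrightarrow> homogeneous a t v \<Longrightarrow>
      \<exists>u. homogeneous k t u \<and> (\<forall>p<length a. v p - lin_map M (length k) u p \<in> irrelevant_ideal)"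
    and v: "t \<le> \<beta>" "homogeneous a t v"
  shows "\<exists>u. homogeneous k t u \<and> (\<forall>p<length a. v p = lin_map M (length k) u p)"
proof -
  \<comment> \<open>Below \<open>L\<close> the target has no nonzero homogeneous elements, which
    starts the induction.\<close>
  define L where "L = Min (insert 0 (set a))"
  have L: "L \<le> a ! p" if "p < length a" for p using that by (simp add: L_def)
  have "t < L + int n \<Longrightarrow> t \<le> \<beta> \<Longrightarrow> homogeneous a t v \<Longrightarrow>
    \<exists>u. homogeneous k t u \<and> (\<forall>p<length a. v p = lin_map M (length k) u p)" for n
  proof (induction n arbitrary: t v)
    case 0
    have "v p = 0" if "p < length a" for p
      using forms_neg[of "v p" "t - a ! p"] 0 L[OF that] that by (auto simp: homogeneous_def)
    then show ?case by (intro exI[of _ "\<lambda>_. 0"]) (auto simp: homogeneous_def lin_map_def)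
  next
    case (Suc n)
    obtain u where u: "homogeneous k t u" "\<And>p. p < length a \<Longrightarrow> v p - lin_map M (length k) u p \<in> irrelevant_ideal"
      using surj[OF Suc.prems(2,3)] by blast
    have "homogeneous a t (\<lambda>p. v p - lin_map M (length k) u p)"
      using Suc.prems(3) lin_map_homogeneous[OF M u(1)] by (rule homogeneous_diff)
    from homogeneous_irrelevant_decompose[OF this u(2)]
    obtain c where c: "\<And>v. homogeneous a (t - 1) (c v)"
      "\<And>p. p < length a \<Longrightarrow> v p - lin_map M (length k) u p = (\<Sum>v\<in>UNIV. var v * c v p)" by blast
    have "\<forall>v. \<exists>w. homogeneous k (t - 1) w \<and> (\<forall>p<length a. c v p = lin_map M (length k) w p)"
      using Suc.IH[OF _ _ c(1)] Suc.prems by auto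
    from choice[OF this] obtain w where w: "\<forall>v. homogeneous k (t - 1) (w v) \<and>
      (\<forall>p<length a. c v p = lin_map M (length k) (w v) p)" by (rule exE)
    show ?case
    proof (intro exI[of _ "\<lambda>q. u q + (\<Sum>v\<in>UNIV. var v * w v q)"] conjI allI impI)
      show "homogeneous k t (\<lambda>q. u q + (\<Sum>v\<in>UNIV. var v * w v q))"
        using w by (intro homogeneous_add u(1) homogeneous_var_sum) simp
      fix p assume p: "p < length a"
      have "lin_map M (length k) (\<lambda>q. u q + (\<Sum>v\<in>UNIV. var v * w v q)) p =
        lin_map M (length k) u p + (\<Sum>v\<in>UNIV. var v * c v p)"
        using w p by (simp add: lin_map_add lin_map_sum)
      then show "v p = lin_map M (length k) (\<lambda>q. u q + (\<Sum>v\<in>UNIV. var v * w v q)) p"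
        using c(2)[OF p] by (simp add: algebra_simps)
    qed
  qed
  from this[of "nat (t - L + 1)"] v show ?thesis by simp
qed

text \<open>The matrix \<open>M\<close> restricts to an isomorphism between the submodules spanned by the basis
  vectors of degree at most \<open>\<beta>\<close>.\<close>

definition bijective_upto :: "int list \<Rightarrow> int list \<Rightarrow> (nat \<Rightarrow> nat \<Rightarrow> ('v, 'k::comm_ring_1) mpoly) \<Rightarrow> int \<Rightarrow> bool" where
  "bijective_upto k a M \<beta> \<longleftrightarrow>
     (\<forall>u. supported k \<beta> u \<longrightarrow> (\<forall>p<length a. lin_map M (length k) u p = 0) \<longrightarrow> (\<forall>q<length k. u q = 0)) \<and>
     (\<forall>v. supported a \<beta> v \<longrightarrow> (\<exists>u. supported k \<beta> u \<and> (\<forall>t. homogeneous a t v \<longrightarrow> homogeneous k t u) \<and>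
        (\<forall>p<length a. v p = lin_map M (length k) u p)))"

text \<open>Lifting the basis vectors of the target gives a right inverse of \<open>M\<close>. Composed with \<open>M\<close> in the
  other order it differs from the identity by a matrix that strictly lowers the degrees of the
  basis vectors, so it is injective.\<close>

lemma bijective_uptoI:
  fixes M :: "nat \<Rightarrow> nat \<Rightarrow> ('v::finite, 'k::comm_ring_1) mpoly"
  assumes M: "graded_matrix k a M"
    and surj: "\<And>t v. t \<le> \<beta> \<Longrightarrow> homogeneous a t v \<Longrightarrow>
      \<exists>u. homogeneous k t u \<and> (\<forall>p<length a. v p - lin_map M (length k) u p \<in> irrelevant_ideal)"
    and inj: "\<And>t u q. t \<le> \<beta> \<Longrightarrow> homogeneous k t u \<Longrightarrow>
      (\<And>p. p < length a \<Longrightarrow> lin_map M (length k) u p = 0) \<Longrightarrow> q < length k \<Longrightarrow> u q \<in> irrelevant_ideal"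
  shows "bijective_upto k a M \<beta>"
proof -
  let ?M = "lin_map M (length k)"
  have "\<forall>p. \<exists>u. p < length a \<longrightarrow> a ! p \<le> \<beta> \<longrightarrow>
    homogeneous k (a ! p) u \<and> (\<forall>p'<length a. (if p' = p then 1 else 0) = ?M u p')"
    using graded_nakayama[OF M surj _ homogeneous_unit] by blast
  from choice[OF this] obtain U0 where U0: "\<And>p. p < length a \<Longrightarrow> a ! p \<le> \<beta> \<Longrightarrow>
    homogeneous k (a ! p) (U0 p) \<and> (\<forall>p'<length a. (if p' = p then 1 else 0) = ?M (U0 p) p')"
    by blast
  \<comment> \<open>Basis vectors of degree above \<open>\<beta>\<close> are sent to zero;
    \<open>U\<close> is a right inverse of \<open>M\<close> on the part supported up to
    \<open>\<beta>\<close>.\<close>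
  define U where "U p q = (if a ! p \<le> \<beta> then U0 p q else 0)" for p q
  have U_hom: "homogeneous k (a ! p) (U p)" if "p < length a" for p
    using U0[OF that] by (cases "a ! p \<le> \<beta>") (auto simp: U_def [abs_def] homogeneous_def)
  have MU: "?M (U p) p' = (if p' = p then 1 else 0)" if "p < length a" "a ! p \<le> \<beta>" "p' < length a" for p p'
    using U0[of p] that by (simp add: U_def [abs_def])
  have U_supp: "U p q = 0" if "p < length a" "q < length k" "\<not> k ! q \<le> \<beta>" for p q
  proof (cases "a ! p \<le> \<beta>")
    case True
    then show ?thesis using homogeneous_supported[OF U_hom[OF that(1)]] that by (auto simp: supported_def)
  qed (simp add: U_def)
  have inverse: "?M (\<lambda>q. \<Sum>p<length a. v p * U p q) p' = v p'"
    if v: "supported a \<beta> v" and p': "p' < length a" for v p'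
  proof -
    have "?M (\<lambda>q. \<Sum>p<length a. v p * U p q) p' = (\<Sum>p<length a. v p * ?M (U p) p')"
      by (rule lin_map_sum)
    also have "\<dots> = (\<Sum>p<length a. if p = p' then v p' else 0)"
    proof (rule sum.cong)
      fix p assume p: "p \<in> {..<length a}"
      show "v p * ?M (U p) p' = (if p = p' then v p' else 0)"
      proof (cases "v p = 0")
        case False
        then have "a ! p \<le> \<beta>" using v p by (auto simp: supported_def)
        then show ?thesis using MU[of p p'] p p' by auto
      qed auto
    qed simp
    also have "\<dots> = v p'" using p' by simp
    finally show ?thesis .
  qed
  have "\<forall>q<length k. u q = 0"
    if u: "supported k \<beta> u" and ker: "\<forall>p<length a. ?M u p = 0" for u
  proof (rule ccontr)
    assume "\<not> (\<forall>q<length k. u q = 0)"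
    then have ne: "{q. q < length k \<and> u q \<noteq> 0} \<noteq> {}" by auto
    \<comment> \<open>The largest degree of a basis vector that occurs in the kernel element
      \<open>u\<close>; the coefficient at such a vector \<open>q\<close> will be shown to
      vanish.\<close>
    define \<delta> where "\<delta> = Max ((!) k ` {q. q < length k \<and> u q \<noteq> 0})"
    have fin: "finite ((!) k ` {q. q < length k \<and> u q \<noteq> 0})" by simp
    have "\<delta> \<in> (!) k ` {q. q < length k \<and> u q \<noteq> 0}" unfolding \<delta>_def by (rule Max_in[OF fin]) (use ne in simp)
    then obtain q where q: "q < length k" "u q \<noteq> 0" "k ! q = \<delta>" by auto
    have max: "k ! s \<le> \<delta>" if "s < length k" "u s \<noteq> 0" for s
      unfolding \<delta>_def using that by (intro Max_ge[OF fin]) auto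
    \<comment> \<open>Column \<open>s\<close> of \<open>U M - 1\<close>. It lies in the kernel of
      \<open>M\<close>, so its entries are in the irrelevant ideal; the entry at \<open>q\<close>
      has degree \<open>k ! s - k ! q\<close>, at most 0 by the choice of \<open>q\<close>, and so
      it is zero.\<close>
    define n where "n s q = (\<Sum>p<length a. M p s * U p q) - (if q = s then 1 else 0)" for s q
    have n0: "u s * n s q = 0" if s: "s < length k" for s
    proof (cases "u s = 0")
      case False
      then have ks: "k ! s \<le> \<beta>" using u s by (auto simp: supported_def)
      have col_hom: "homogeneous a (k ! s) (\<lambda>p. M p s)"
        using M s by (auto simp: homogeneous_def graded_matrix_def)
      then have col: "supported a \<beta> (\<lambda>p. M p s)"
        using homogeneous_supported[OF col_hom] ks by (auto simp: supported_def)
      have n_hom: "homogeneous k (k ! s) (n s)"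
        unfolding n_def [abs_def]
      proof (rule homogeneous_diff[OF _ homogeneous_unit[OF s]], unfold homogeneous_def, intro allI impI forms_sum)
        fix q p assume "q < length k" "p \<in> {..<length a}"
        then have "M p s * U p q \<in> forms ((k ! s - a ! p) + (a ! p - k ! q))"
          using col_hom U_hom by (intro forms_mult) (auto simp: homogeneous_def)
        then show "M p s * U p q \<in> forms (k ! s - k ! q)" by simp
      qed
      have "n s q \<in> irrelevant_ideal"
      proof (rule inj[OF ks n_hom _ q(1)])
        fix p assume "p < length a"
        then show "?M (n s) p = 0"
          unfolding n_def [abs_def] lin_map_diff using inverse[OF col] by (simp add: lin_map_unit[OF s])
      qed
      moreover have "n s q \<in> forms (k ! s - k ! q)" using n_hom q(1) by (simp add: homogeneous_def)
      ultimately have "n s q = 0"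
        using forms_irrelevant_pos[of "n s q" "k ! s - k ! q"] max[OF s False] q(3) by force
      then show ?thesis by simp
    qed simp
    \<comment> \<open>Row \<open>q\<close> of \<open>U M u = 0\<close>: the deviation of
      \<open>U M\<close> from the identity contributes nothing there, and \<open>u q\<close>
      remains.\<close>
    have "0 = (\<Sum>p<length a. ?M u p * U p q)" using ker by simp
    also have "\<dots> = (\<Sum>s<length k. u s * (\<Sum>p<length a. M p s * U p q))"
      unfolding lin_map_def sum_distrib_right sum_distrib_left
      by (subst sum.swap) (simp add: ac_simps)
    also have "\<dots> = (\<Sum>s<length k. u s * n s q + (if s = q then u q else 0))"
      by (rule sum.cong) (auto simp: n_def algebra_simps)
    also have "\<dots> = u q" using n0 q(1) by (simp add: sum.distrib)
    finally show False using q(2) by simp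
  qed
  moreover have "\<exists>u. supported k \<beta> u \<and> (\<forall>t. homogeneous a t v \<longrightarrow> homogeneous k t u) \<and>
        (\<forall>p<length a. v p = ?M u p)" if v: "supported a \<beta> v" for v
  proof (intro exI[of _ "\<lambda>q. \<Sum>p<length a. v p * U p q"] conjI allI impI)
    show "supported k \<beta> (\<lambda>q. \<Sum>p<length a. v p * U p q)"
      unfolding supported_def
    proof (intro allI impI)
      fix q assume q: "q < length k" "(\<Sum>p<length a. v p * U p q) \<noteq> 0"
      show "k ! q \<le> \<beta>"
      proof (rule ccontr)
        assume "\<not> k ! q \<le> \<beta>"
        then have "(\<Sum>p<length a. v p * U p q) = 0" using U_supp q(1) by (intro sum.neutral) simp
        then show False using q(2) by simp
      qed
    qed
    show "homogeneous k t (\<lambda>q. \<Sum>p<length a. v p * U p q)" if t: "homogeneous a t v" for t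
      unfolding homogeneous_def
    proof (intro allI impI forms_sum)
      fix q p assume "q < length k" "p \<in> {..<length a}"
      then have "v p * U p q \<in> forms ((t - a ! p) + (a ! p - k ! q))"
        using t U_hom by (intro forms_mult) (auto simp: homogeneous_def)
      then show "v p * U p q \<in> forms (t - k ! q)" by simp
    qed
    show "v p = ?M (\<lambda>q. \<Sum>p<length a. v p * U p q) p" if "p < length a" for p
      using inverse[OF v that] by simp
  qed
  ultimately show ?thesis unfolding bijective_upto_def by blast
qed

lemma bijective_uptoD:
  assumes "bijective_upto K A M \<beta>"
  shows "supported K \<beta> u \<Longrightarrow> (\<And>p. p < length A \<Longrightarrow> lin_map M (length K) u p = 0) \<Longrightarrow> q < length K \<Longrightarrow> u q = 0"
    and "supported A \<beta> v \<Longrightarrow> \<exists>u. supported K \<beta> u \<and> (\<forall>t. homogeneous A t v \<longrightarrow> homogeneous K t u) \<and>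
        (\<forall>p<length A. v p = lin_map M (length K) u p)"
  using assms unfolding bijective_upto_def by simp_all

section \<open>Minimal resolutions\<close>

text \<open>The case \<open>l = 0\<close> is included: H_0 of the variables is the field, and an
  element of the irrelevant ideal is a boundary. This is where minimality of the resolution will
  enter.\<close>

lemma koszul_var_lift:
  fixes u :: "nat set \<Rightarrow> ('v::finite, 'k::comm_ring_1) mpoly"
  assumes \<nu>: "bij_betw \<nu> {..<n} (UNIV :: 'v set)"
    and u: "koszul_homogeneous (\<lambda>_. 1) {..<n} l t u"
    and u0: "l = 0 \<Longrightarrow> u {} \<in> irrelevant_ideal"
    and cycle: "\<And>T. T \<subseteq> {..<n} \<Longrightarrow> Suc (card T) = l \<Longrightarrow> koszul_diff (\<lambda>j. var (\<nu> j)) {..<n} u T = 0"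
  shows "\<exists>w. koszul_homogeneous (\<lambda>_. 1) {..<n} (Suc l) t w \<and>
    (\<forall>S\<subseteq>{..<n}. card S = l \<longrightarrow> u S = koszul_diff (\<lambda>j. var (\<nu> j)) {..<n} w S)"
proof (cases "l = 0")
  case True
  have "u {} \<in> lincombs (\<lambda>j. var (\<nu> j)) {..<n}"
    using irrelevant_lincombs[of \<nu> "{..<n}" "u {}"] \<nu> u0 True by (simp add: bij_betw_def)
  moreover have "u {} \<in> forms t"
    using u[unfolded koszul_homogeneous_def, rule_format, of "{}"] True by simp
  ultimately obtain c where c: "u {} = (\<Sum>j<n. c j * var (\<nu> j))" "\<And>j. j \<in> {..<n} \<Longrightarrow> c j \<in> forms (t - 1)"
    using lincombs_homogeneous[of "u {}" "\<lambda>j. var (\<nu> j)" "{..<n}" t "\<lambda>_. 1"] by auto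
  show ?thesis
  proof (intro exI[of _ "\<lambda>S. c (the_elem S)"] conjI allI impI)
    show "koszul_homogeneous (\<lambda>_. 1) {..<n} (Suc l) t (\<lambda>S. c (the_elem S))"
      unfolding koszul_homogeneous_def True using c(2) by (auto simp: card_1_singleton_iff)
    fix S assume "S \<subseteq> {..<n}" "card S = l"
    then have "S = {}" using True finite_subset[of S "{..<n}"] by auto
    then show "u S = koszul_diff (\<lambda>j. var (\<nu> j)) {..<n} (\<lambda>S. c (the_elem S)) S"
      using c(1) by (simp add: koszul_diff_def mult.commute)
  qed
next
  case False
  then have "koszul_exact (\<lambda>_. 1) (\<lambda>j. var (\<nu> j) :: ('v, 'k) mpoly) {..<n} l t"
    using \<nu> by (intro koszul_exact_var) (auto simp: bij_betw_def)
  then show ?thesis using u cycle unfolding koszul_exact_def by blast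
qed

lemma koszul_diff_lin_map:
  "koszul_diff f A (\<lambda>S. lin_map M n (z S) p) T = lin_map M n (\<lambda>q. koszul_diff f A (\<lambda>S. z S q) T) p"
  unfolding koszul_diff_def lin_map_def sum_distrib_left by (subst sum.swap) (simp add: ac_simps)

locale minimal_resolution =
  fixes a :: "nat \<Rightarrow> int list" and d :: "nat \<Rightarrow> nat \<Rightarrow> nat \<Rightarrow> ('v::finite, 'k::field) mpoly"
    and I :: "('v, 'k) mpoly set"
  assumes a_0: "a 0 = [0]"
    and graded_d: "graded_matrix (a (Suc i)) (a i) (d (Suc i))"
    and irrelevant_d: "p < length (a i) \<Longrightarrow> q < length (a (Suc i)) \<Longrightarrow> d (Suc i) p q \<in> irrelevant_ideal"
    and d_d: "p < length (a i) \<Longrightarrow>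
      lin_map (d (Suc i)) (length (a (Suc i))) (lin_map (d (Suc (Suc i))) (length (a (Suc (Suc i)))) u) p = 0"
    and exact: "(\<And>p. p < length (a i) \<Longrightarrow> lin_map (d (Suc i)) (length (a (Suc i))) u p = 0) \<Longrightarrow>
      \<exists>w. \<forall>q<length (a (Suc i)). u q = lin_map (d (Suc (Suc i))) (length (a (Suc (Suc i)))) w q"
    and range: "f \<in> I \<longleftrightarrow> (\<exists>w. f = lin_map (d (Suc 0)) (length (a (Suc 0))) w 0)"
begin

abbreviation D :: "nat \<Rightarrow> (nat \<Rightarrow> ('v, 'k) mpoly) \<Rightarrow> nat \<Rightarrow> ('v, 'k) mpoly" where
  "D i \<equiv> lin_map (d i) (length (a i))"

text \<open>The required components of an arbitrary preimage form a homogeneous one.\<close>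

lemma exact_homogeneous:
  assumes u: "homogeneous (a (Suc i)) t u" and ker: "\<And>p. p < length (a i) \<Longrightarrow> D (Suc i) u p = 0"
  obtains w where "homogeneous (a (Suc (Suc i))) t w" "\<And>q. q < length (a (Suc i)) \<Longrightarrow> u q = D (Suc (Suc i)) w q"
proof -
  obtain w where w: "\<And>q. q < length (a (Suc i)) \<Longrightarrow> u q = D (Suc (Suc i)) w q" using exact[OF ker] by blast
  show thesis
  proof (rule that)
    show "homogeneous (a (Suc (Suc i))) t (\<lambda>q. hcomp (t - a (Suc (Suc i)) ! q) (w q))"
      by (simp add: homogeneous_def)
    fix q assume q: "q < length (a (Suc i))"
    have "u q = hcomp (t - a (Suc i) ! q) (u q)" using u q by (simp add: homogeneous_def hcomp_id)
    then show "u q = D (Suc (Suc i)) (\<lambda>q. hcomp (t - a (Suc (Suc i)) ! q) (w q)) q"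
      using lin_map_hcomp[OF graded_d q] w[OF q] by simp
  qed
qed

lemma range_homogeneous:
  assumes f: "f \<in> I" "f \<in> forms t"
  obtains w where "homogeneous (a (Suc 0)) t w" "f = D (Suc 0) w 0"
proof -
  obtain w where w: "f = D (Suc 0) w 0" using f(1) range by blast
  show thesis
  proof (rule that)
    show "homogeneous (a (Suc 0)) t (\<lambda>q. hcomp (t - a (Suc 0) ! q) (w q))"
      by (simp add: homogeneous_def)
    have "f = hcomp t f" using f(2) by (simp add: hcomp_id)
    then show "f = D (Suc 0) (\<lambda>q. hcomp (t - a (Suc 0) ! q) (w q)) 0"
      using lin_map_hcomp[OF graded_d[of 0], of 0] a_0 w by simp
  qed
qed

text \<open>A diagram chase in the double complex of the resolution and the Koszul complex of the variables:
  it plays the role of computing \<open>Tor(R/I, k)\<close> by the Koszul complex.\<close>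

lemma zigzag:
  assumes \<nu>: "bij_betw \<nu> {..<n} (UNIV :: 'v set)"
    and c: "\<And>j. c < j \<Longrightarrow> forms (int j) \<subseteq> I"
    and t: "t > int c + int j + int l"
    and z: "\<And>S. S \<subseteq> {..<n} \<Longrightarrow> card S = l \<Longrightarrow> homogeneous (a j) (t - int l) (z S)"
    and cycle: "\<And>j' T p. j = Suc j' \<Longrightarrow> T \<subseteq> {..<n} \<Longrightarrow> Suc (card T) = l \<Longrightarrow> p < length (a j') \<Longrightarrow>
      koszul_diff (\<lambda>j. var (\<nu> j)) {..<n} (\<lambda>S. D j (z S) p) T = 0"
  shows "\<exists>y y'. (\<forall>S\<subseteq>{..<n}. card S = l \<longrightarrow> homogeneous (a (Suc j)) (t - int l) (y S)) \<and>
    (\<forall>S\<subseteq>{..<n}. card S = l \<longrightarrow> (\<forall>p<length (a j).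
      z S p = D (Suc j) (y S) p + koszul_diff (\<lambda>j. var (\<nu> j)) {..<n} (\<lambda>S. y' S p) S))"
  using t z cycle
proof (induction j arbitrary: l z)
  case 0
  have "\<forall>S. \<exists>y. S \<subseteq> {..<n} \<longrightarrow> card S = l \<longrightarrow> homogeneous (a (Suc 0)) (t - int l) y \<and> z S 0 = D (Suc 0) y 0"
  proof (intro allI)
    fix S show "\<exists>y. S \<subseteq> {..<n} \<longrightarrow> card S = l \<longrightarrow> homogeneous (a (Suc 0)) (t - int l) y \<and> z S 0 = D (Suc 0) y 0"
    proof (cases "S \<subseteq> {..<n} \<and> card S = l")
      case True
      then have zS: "z S 0 \<in> forms (t - int l)" using "0.prems"(2)[of S] a_0 by (auto simp: homogeneous_def)
      \<comment> \<open>The degree \<open>t - l\<close> exceeds \<open>c\<close>, where every form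
        lies in the ideal and so comes from the first module.\<close>
      have "c < nat (t - int l)" "int (nat (t - int l)) = t - int l" using "0.prems"(1) by auto
      then have "z S 0 \<in> I" using c[of "nat (t - int l)"] zS by auto
      then obtain y where "homogeneous (a (Suc 0)) (t - int l) y" "z S 0 = D (Suc 0) y 0"
        using range_homogeneous zS by blast
      then show ?thesis by blast
    qed auto
  qed
  from choice[OF this] obtain y where y: "\<forall>S. S \<subseteq> {..<n} \<longrightarrow> card S = l \<longrightarrow>
      homogeneous (a (Suc 0)) (t - int l) (y S) \<and> z S 0 = D (Suc 0) (y S) 0" by (rule exE)
  show ?case
    by (rule exI[of _ y], rule exI[of _ "\<lambda>_ _. 0"]) (use y a_0 in auto)
next
  case (Suc j)
  let ?A = "{..<n}" and ?x = "\<lambda>j. var (\<nu> j) :: ('v, 'k) mpoly"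
  \<comment> \<open>Pushed down the resolution, \<open>z\<close> becomes a Koszul cycle of the
    variables; for \<open>l = 0\<close> its entries are in the irrelevant ideal by minimality. In
    both cases it is a Koszul boundary.\<close>
  define u where "u p S = D (Suc j) (z S) p" for p S
  have u_hom: "homogeneous (a j) (t - int l) (\<lambda>p. u p S)" if "S \<subseteq> ?A" "card S = l" for S
    unfolding u_def using lin_map_homogeneous[OF graded_d Suc.prems(2)[OF that]] by simp
  have "\<forall>p. \<exists>w. p < length (a j) \<longrightarrow> koszul_homogeneous (\<lambda>_. 1) ?A (Suc l) (t - a j ! p) w \<and>
    (\<forall>S\<subseteq>?A. card S = l \<longrightarrow> u p S = koszul_diff ?x ?A w S)"
  proof
    fix p
    show "\<exists>w. p < length (a j) \<longrightarrow> koszul_homogeneous (\<lambda>_. 1) ?A (Suc l) (t - a j ! p) w \<and>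
      (\<forall>S\<subseteq>?A. card S = l \<longrightarrow> u p S = koszul_diff ?x ?A w S)"
    proof (cases "p < length (a j)")
      case True
      have "\<exists>w. koszul_homogeneous (\<lambda>_. 1) ?A (Suc l) (t - a j ! p) w \<and>
        (\<forall>S\<subseteq>?A. card S = l \<longrightarrow> u p S = koszul_diff ?x ?A w S)"
      proof (rule koszul_var_lift[OF \<nu>])
        show "koszul_homogeneous (\<lambda>_. 1) ?A l (t - a j ! p) (u p)"
          unfolding koszul_homogeneous_def
        proof (intro allI impI)
          fix S assume S: "S \<subseteq> ?A" "card S = l"
          then show "u p S \<in> forms (t - a j ! p - (\<Sum>j\<in>S. 1))"
            using u_hom[OF S] True by (simp add: homogeneous_def algebra_simps)
        qed
        show "u p {} \<in> irrelevant_ideal" if "l = 0"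
          unfolding u_def by (intro lin_map_irrelevant irrelevant_d True)
        show "koszul_diff ?x ?A (u p) T = 0" if "T \<subseteq> ?A" "Suc (card T) = l" for T
          unfolding u_def using Suc.prems(3)[OF refl that True] .
      qed
      then show ?thesis by blast
    qed auto
  qed
  from choice[OF this] obtain w where w: "\<forall>p. p < length (a j) \<longrightarrow>
      koszul_homogeneous (\<lambda>_. 1) ?A (Suc l) (t - a j ! p) (w p) \<and>
    (\<forall>S\<subseteq>?A. card S = l \<longrightarrow> u p S = koszul_diff ?x ?A (w p) S)" by (rule exE)
  define z' where "z' S p = w p S" for S p
  have "\<exists>y y'. (\<forall>S\<subseteq>?A. card S = Suc l \<longrightarrow> homogeneous (a (Suc j)) (t - int (Suc l)) (y S)) \<and>
    (\<forall>S\<subseteq>?A. card S = Suc l \<longrightarrow> (\<forall>p<length (a j).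
      z' S p = D (Suc j) (y S) p + koszul_diff ?x ?A (\<lambda>S. y' S p) S))"
  proof (rule Suc.IH)
    \<comment> \<open>One step down in the resolution is paid for by one step up in the Koszul
      complex, so the sum in the bound stays the same.\<close>
    show "t > int c + int j + int (Suc l)" using Suc.prems(1) by simp
    show "homogeneous (a j) (t - int (Suc l)) (z' S)" if S: "S \<subseteq> ?A" "card S = Suc l" for S
      unfolding homogeneous_def z'_def
    proof (intro allI impI)
      fix p assume "p < length (a j)"
      then have "w p S \<in> forms (t - a j ! p - (\<Sum>j\<in>S. 1))" using w S unfolding koszul_homogeneous_def by blast
      then show "w p S \<in> forms (t - int (Suc l) - a j ! p)" using S by (simp add: algebra_simps)
    qed
    show "koszul_diff ?x ?A (\<lambda>S. D j (z' S) p) T = 0"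
      if j: "j = Suc j'" and T: "T \<subseteq> ?A" "Suc (card T) = Suc l" and p: "p < length (a j')" for j' T p
    proof -
      have "koszul_diff ?x ?A (\<lambda>S. D j (z' S) p) T = D j (\<lambda>q. koszul_diff ?x ?A (\<lambda>S. z' S q) T) p"
        by (rule koszul_diff_lin_map)
      also have "\<dots> = D j (D (Suc j) (z T)) p"
        by (rule lin_map_cong) (use w T in \<open>simp add: z'_def u_def\<close>)
      also have "\<dots> = 0" using d_d[OF p] j by simp
      finally show ?thesis .
    qed
  qed
  then obtain y y' where yy0: "\<forall>S\<subseteq>?A. card S = Suc l \<longrightarrow> homogeneous (a (Suc j)) (t - int (Suc l)) (y S)"
    "\<forall>S\<subseteq>?A. card S = Suc l \<longrightarrow> (\<forall>p<length (a j).
      z' S p = D (Suc j) (y S) p + koszul_diff ?x ?A (\<lambda>S. y' S p) S)"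
    by (elim exE conjE) (rule that)
  have y: "homogeneous (a (Suc j)) (t - int (Suc l)) (y S)" if "S \<subseteq> ?A" "card S = Suc l" for S
    using yy0(1) that by simp
  have yy': "z' S p = D (Suc j) (y S) p + koszul_diff ?x ?A (\<lambda>S. y' S p) S"
    if "S \<subseteq> ?A" "card S = Suc l" "p < length (a j)" for S p
    using yy0(2) that by simp
  \<comment> \<open>Subtracting the Koszul boundary of \<open>y\<close> makes \<open>z S\<close> a
    cycle of the resolution, hence a boundary.\<close>
  have "\<forall>S. \<exists>v. S \<subseteq> ?A \<longrightarrow> card S = l \<longrightarrow> homogeneous (a (Suc (Suc j))) (t - int l) v \<and>
    (\<forall>q<length (a (Suc j)). z S q - koszul_diff ?x ?A (\<lambda>S. y S q) S = D (Suc (Suc j)) v q)"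
  proof
    fix S
    show "\<exists>v. S \<subseteq> ?A \<longrightarrow> card S = l \<longrightarrow> homogeneous (a (Suc (Suc j))) (t - int l) v \<and>
      (\<forall>q<length (a (Suc j)). z S q - koszul_diff ?x ?A (\<lambda>S. y S q) S = D (Suc (Suc j)) v q)"
    proof (cases "S \<subseteq> ?A \<and> card S = l")
      case True
      then have S: "S \<subseteq> ?A" "card S = l" by auto
      have fS: "finite S" using S(1) finite_subset by blast
      let ?u = "\<lambda>q. z S q - koszul_diff ?x ?A (\<lambda>S. y S q) S"
      have hom: "homogeneous (a (Suc j)) (t - int l) ?u"
      proof (rule homogeneous_diff[OF Suc.prems(2)[OF S]], unfold homogeneous_def koszul_diff_def, intro allI impI forms_sum)
        fix q i assume q: "q < length (a (Suc j))" and i: "i \<in> ?A - S"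
        have "insert i S \<subseteq> ?A" "card (insert i S) = Suc l" using S i fS by auto
        then have "y (insert i S) q \<in> forms (t - int (Suc l) - a (Suc j) ! q)"
          using y q by (auto simp: homogeneous_def)
        then have "?x i * y (insert i S) q \<in> forms (1 + (t - int (Suc l) - a (Suc j) ! q))"
          by (intro forms_mult) auto
        then have "koszul_sign i S * (?x i * y (insert i S) q) \<in> forms (1 + (t - int (Suc l) - a (Suc j) ! q))"
          by (rule forms_koszul_sign)
        then show "koszul_sign i S * ?x i * y (insert i S) q \<in> forms (t - int l - a (Suc j) ! q)"
          by (simp add: mult.assoc algebra_simps)
      qed
      have ker: "D (Suc j) ?u p = 0" if p: "p < length (a j)" for p
      proof -
        have "koszul_diff ?x ?A (w p) S =
          koszul_diff ?x ?A (\<lambda>S. D (Suc j) (y S) p + koszul_diff ?x ?A (\<lambda>S. y' S p) S) S"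
        proof (rule koszul_diff_cong)
          fix i assume i: "i \<in> ?A - S"
          have "insert i S \<subseteq> ?A" "card (insert i S) = Suc l" using S i fS by auto
          from yy'[OF this p]
          show "w p (insert i S) = D (Suc j) (y (insert i S)) p + koszul_diff ?x ?A (\<lambda>S. y' S p) (insert i S)"
            by (simp add: z'_def)
        qed
        also have "\<dots> = D (Suc j) (\<lambda>q. koszul_diff ?x ?A (\<lambda>S. y S q) S) p"
          unfolding koszul_diff_add koszul_diff_lin_map using S(1) by (simp add: koszul_diff_diff)
        finally have "D (Suc j) (z S) p = D (Suc j) (\<lambda>q. koszul_diff ?x ?A (\<lambda>S. y S q) S) p"
          using w p S by (simp add: u_def)
        then show ?thesis by (simp add: lin_map_diff)
      qed
      obtain v where "homogeneous (a (Suc (Suc j))) (t - int l) v"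
        "\<And>q. q < length (a (Suc j)) \<Longrightarrow> ?u q = D (Suc (Suc j)) v q"
        using exact_homogeneous[OF hom ker] by blast
      then show ?thesis by blast
    qed auto
  qed
  from choice[OF this] obtain v where v: "\<forall>S. S \<subseteq> ?A \<longrightarrow> card S = l \<longrightarrow> homogeneous (a (Suc (Suc j))) (t - int l) (v S) \<and>
    (\<forall>q<length (a (Suc j)). z S q - koszul_diff ?x ?A (\<lambda>S. y S q) S = D (Suc (Suc j)) (v S) q)" by (rule exE)
  show ?case
  proof (rule exI[of _ v], rule exI[of _ y], intro conjI allI impI)
    fix S assume S: "S \<subseteq> ?A" "card S = l"
    show "homogeneous (a (Suc (Suc j))) (t - int l) (v S)" using v S by blast
    fix p assume p: "p < length (a (Suc j))"
    have "z S p - koszul_diff ?x ?A (\<lambda>S. y S p) S = D (Suc (Suc j)) (v S) p" using v S p by blast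
    then show "z S p = D (Suc (Suc j)) (v S) p + koszul_diff ?x ?A (\<lambda>S. y S p) S" by (simp add: algebra_simps)
  qed
qed

text \<open>A basis vector of larger degree, taken in Koszul degree 0, would be a boundary of the
  resolution plus a combination of variables. Both lie in the irrelevant ideal, but one coordinate
  of the vector is 1.\<close>

lemma generator_degree_le:
  assumes c: "\<And>j. c < j \<Longrightarrow> forms (int j) \<subseteq> I" and p: "p < length (a (Suc i))"
  shows "a (Suc i) ! p \<le> int c + int (Suc i)"
proof (rule ccontr)
  assume "\<not> ?thesis"
  then have t: "a (Suc i) ! p > int c + int (Suc i) + int 0" by simp
  obtain \<nu> :: "nat \<Rightarrow> 'v" where \<nu>: "bij_betw \<nu> {..<CARD('v)} UNIV"
    using ex_bij_betw_nat_finite[of "UNIV :: 'v set"] by (auto simp: atLeast0LessThan)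
  let ?z = "\<lambda>S :: nat set. \<lambda>q. if q = p then 1 else 0 :: ('v, 'k) mpoly"
  have "\<exists>y y'. (\<forall>S\<subseteq>{..<CARD('v)}. card S = 0 \<longrightarrow> homogeneous (a (Suc (Suc i))) (a (Suc i) ! p - int 0) (y S)) \<and>
    (\<forall>S\<subseteq>{..<CARD('v)}. card S = 0 \<longrightarrow> (\<forall>q<length (a (Suc i)).
      ?z S q = D (Suc (Suc i)) (y S) q + koszul_diff (\<lambda>j. var (\<nu> j)) {..<CARD('v)} (\<lambda>S. y' S q) S))"
    by (rule zigzag[OF \<nu> c t]) (use p in \<open>auto intro: homogeneous_unit\<close>)
  then obtain y y' where yy: "\<forall>S\<subseteq>{..<CARD('v)}. card S = 0 \<longrightarrow> (\<forall>q<length (a (Suc i)).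
      ?z S q = D (Suc (Suc i)) (y S) q + koszul_diff (\<lambda>j. var (\<nu> j)) {..<CARD('v)} (\<lambda>S. y' S q) S)"
    by blast
  have "1 = D (Suc (Suc i)) (y {}) p + koszul_diff (\<lambda>j. var (\<nu> j)) {..<CARD('v)} (\<lambda>S. y' S p) {}"
    using yy[rule_format, of "{}" p] p by simp
  moreover have "D (Suc (Suc i)) (y {}) p \<in> irrelevant_ideal"
    by (intro lin_map_irrelevant irrelevant_d p)
  moreover have "koszul_diff (\<lambda>j. var (\<nu> j)) {..<CARD('v)} (\<lambda>S. y' S p) {} \<in> irrelevant_ideal"
    unfolding koszul_diff_def
  proof (rule irrelevant_sum, rule irrelevant_mult, rule irrelevant_mult2)
    show "(var (\<nu> j) :: ('v, 'k) mpoly) \<in> irrelevant_ideal" for j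
      by (rule forms_irrelevant[OF var_forms]) simp
  qed
  ultimately show False using irrelevant_add one_not_irrelevant by metis
qed

text \<open>If \<open>M u\<close> has the same image in the ideal as \<open>v\<close>, the
  difference is a cycle, hence a boundary, with entries in the irrelevant ideal by minimality. The
  matrix \<open>M\<close> is left open: it will be the comparison map or a lift of the given
  generators.\<close>

lemma first_surjective:
  assumes M: "graded_matrix k (a (Suc 0)) M"
    and range_M: "\<And>f t. f \<in> I \<Longrightarrow> f \<in> forms t \<Longrightarrow>
      \<exists>w. homogeneous k t w \<and> f = D (Suc 0) (lin_map M (length k) w) 0"
    and v: "homogeneous (a (Suc 0)) t v"
  shows "\<exists>u. homogeneous k t u \<and> (\<forall>p<length (a (Suc 0)). v p - lin_map M (length k) u p \<in> irrelevant_ideal)"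
proof -
  have "D (Suc 0) v 0 \<in> I" using range by blast
  moreover have "D (Suc 0) v 0 \<in> forms t"
    using lin_map_homogeneous[OF graded_d[of 0] v] a_0 by (simp add: homogeneous_def)
  ultimately obtain w where w: "homogeneous k t w" "D (Suc 0) v 0 = D (Suc 0) (lin_map M (length k) w) 0"
    using range_M by blast
  have hom: "homogeneous (a (Suc 0)) t (\<lambda>p. v p - lin_map M (length k) w p)"
    by (rule homogeneous_diff[OF v lin_map_homogeneous[OF M w(1)]])
  have ker: "D (Suc 0) (\<lambda>p. v p - lin_map M (length k) w p) p = 0" if "p < length (a 0)" for p
    using that a_0 w(2) by (simp add: lin_map_diff)
  obtain x where x: "\<And>q. q < length (a (Suc 0)) \<Longrightarrow> v q - lin_map M (length k) w q = D (Suc (Suc 0)) x q"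
    using exact_homogeneous[OF hom ker] by blast
  show ?thesis
  proof (intro exI[of _ w] conjI allI impI w(1))
    fix p assume p: "p < length (a (Suc 0))"
    show "v p - lin_map M (length k) w p \<in> irrelevant_ideal"
      unfolding x[OF p] by (intro lin_map_irrelevant irrelevant_d p)
  qed
qed

end

section \<open>Comparison of a second minimal complex with the resolution\<close>

locale comparison = minimal_resolution a d I
  for a :: "nat \<Rightarrow> int list" and d :: "nat \<Rightarrow> nat \<Rightarrow> nat \<Rightarrow> ('v::finite, 'k::field) mpoly" and I +
  fixes k :: "nat \<Rightarrow> int list" and e \<phi> :: "nat \<Rightarrow> nat \<Rightarrow> nat \<Rightarrow> ('v, 'k) mpoly"
  assumes k_0: "k 0 = [0]"
    and graded_e: "graded_matrix (k (Suc i)) (k i) (e (Suc i))"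
    and irrelevant_e: "p < length (k i) \<Longrightarrow> q < length (k (Suc i)) \<Longrightarrow> e (Suc i) p q \<in> irrelevant_ideal"
    and range_e: "f \<in> I \<Longrightarrow> f \<in> forms t \<Longrightarrow>
      \<exists>w. homogeneous (k (Suc 0)) t w \<and> f = lin_map (e (Suc 0)) (length (k (Suc 0))) w 0"
    and \<phi>_0: "\<phi> 0 0 0 = 1"
    and graded_\<phi>: "graded_matrix (k i) (a i) (\<phi> i)"
    and commute: "p < length (a i) \<Longrightarrow>
      lin_map (d (Suc i)) (length (a (Suc i))) (lin_map (\<phi> (Suc i)) (length (k (Suc i))) u) p =
      lin_map (\<phi> i) (length (k i)) (lin_map (e (Suc i)) (length (k (Suc i))) u) p"
begin

abbreviation E :: "nat \<Rightarrow> (nat \<Rightarrow> ('v, 'k) mpoly) \<Rightarrow> nat \<Rightarrow> ('v, 'k) mpoly" where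
  "E i \<equiv> lin_map (e i) (length (k i))"

abbreviation \<Phi> :: "nat \<Rightarrow> (nat \<Rightarrow> ('v, 'k) mpoly) \<Rightarrow> nat \<Rightarrow> ('v, 'k) mpoly" where
  "\<Phi> i \<equiv> lin_map (\<phi> i) (length (k i))"

text \<open>Mind the shift: this is exactness at \<open>k (Suc i)\<close>, the vanishing of H_{i+1}.
  The range \<open>t\<close> up to \<open>c + i\<close> below is therefore the range
  \<open>c + (i + 1) - 1\<close> for the Koszul homology.\<close>

definition exact_at :: "nat \<Rightarrow> int \<Rightarrow> bool" where
  "exact_at i t \<longleftrightarrow> (\<forall>u. homogeneous (k (Suc i)) t u \<longrightarrow> (\<forall>p<length (k i). E (Suc i) u p = 0) \<longrightarrow>
     (\<exists>w. homogeneous (k (Suc (Suc i))) t w \<and> (\<forall>q<length (k (Suc i)). u q = E (Suc (Suc i)) w q)))"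

lemma \<Phi>_0: "\<Phi> 0 u 0 = u 0"
  by (simp add: lin_map_def k_0 \<phi>_0)

lemma bijective_0: "bijective_upto (k 0) (a 0) (\<phi> 0) \<beta>"
  unfolding bijective_upto_def
proof (intro conjI allI impI)
  fix v :: "nat \<Rightarrow> ('v, 'k) mpoly" assume "supported (a 0) \<beta> v"
  then show "\<exists>u. supported (k 0) \<beta> u \<and> (\<forall>t. homogeneous (a 0) t v \<longrightarrow> homogeneous (k 0) t u) \<and>
        (\<forall>p<length (a 0). v p = \<Phi> 0 u p)"
    by (intro exI[of _ v]) (auto simp: k_0 a_0 lin_map_def \<phi>_0)
qed (auto simp: k_0 a_0 lin_map_def \<phi>_0)

lemma first_range:
  assumes "f \<in> I" "f \<in> forms t"
  shows "\<exists>w. homogeneous (k (Suc 0)) t w \<and> f = D (Suc 0) (\<Phi> (Suc 0) w) 0"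
proof -
  obtain w where "homogeneous (k (Suc 0)) t w" "f = E (Suc 0) w 0" using range_e[OF assms] by blast
  moreover have "D (Suc 0) (\<Phi> (Suc 0) w) 0 = E (Suc 0) w 0"
    using commute[of 0 0 w] a_0 \<Phi>_0 by simp
  ultimately show ?thesis by auto
qed

text \<open>If the boundary of \<open>v\<close> corresponds to a cycle \<open>u\<close> of the
  second complex, then \<open>u\<close> bounds some \<open>w\<close>. The difference of
  \<open>v\<close> and the image of \<open>w\<close> is a cycle of the resolution, hence a boundary,
  with entries in the irrelevant ideal.\<close>

lemma lift_boundary:
  assumes v: "homogeneous (a (Suc (Suc i))) t v"
    and u: "homogeneous (k (Suc i)) t u" "\<And>p. p < length (a (Suc i)) \<Longrightarrow> D (Suc (Suc i)) v p = \<Phi> (Suc i) u p"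
    and ker: "\<And>p. p < length (k i) \<Longrightarrow> E (Suc i) u p = 0"
    and ex: "exact_at i t"
  shows "\<exists>w. homogeneous (k (Suc (Suc i))) t w \<and>
    (\<forall>p<length (a (Suc (Suc i))). v p - \<Phi> (Suc (Suc i)) w p \<in> irrelevant_ideal)"
proof -
  obtain w where w: "homogeneous (k (Suc (Suc i))) t w" "\<And>q. q < length (k (Suc i)) \<Longrightarrow> u q = E (Suc (Suc i)) w q"
    using ex u(1) ker unfolding exact_at_def by blast
  let ?v = "\<lambda>p. v p - \<Phi> (Suc (Suc i)) w p"
  have hom: "homogeneous (a (Suc (Suc i))) t ?v"
    by (rule homogeneous_diff[OF v lin_map_homogeneous[OF graded_\<phi> w(1)]])
  have ker': "D (Suc (Suc i)) ?v p = 0" if p: "p < length (a (Suc i))" for p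
  proof -
    have "D (Suc (Suc i)) (\<Phi> (Suc (Suc i)) w) p = \<Phi> (Suc i) (E (Suc (Suc i)) w) p" by (rule commute[OF p])
    also have "\<dots> = \<Phi> (Suc i) u p" by (rule lin_map_cong) (simp add: w(2))
    finally show ?thesis using u(2)[OF p] by (simp add: lin_map_diff)
  qed
  obtain x where x: "\<And>q. q < length (a (Suc (Suc i))) \<Longrightarrow> ?v q = D (Suc (Suc (Suc i))) x q"
    using exact_homogeneous[OF hom ker'] by blast
  show ?thesis
  proof (intro exI[of _ w] conjI allI impI w(1))
    fix p assume p: "p < length (a (Suc (Suc i)))"
    show "?v p \<in> irrelevant_ideal" unfolding x[OF p] by (intro lin_map_irrelevant irrelevant_d p)
  qed
qed

text \<open>In homological degree 1 the comparison is surjective in every degree, so only the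
  vanishing of H_1 in the single degree \<open>t\<close> enters. This serves the degree
  \<open>c + 1\<close>, which \<open>bijective\<close> does not reach for the second module.\<close>

lemma second_surjective:
  assumes "exact_at 0 t" and v: "homogeneous (a (Suc (Suc 0))) t v"
  shows "\<exists>w. homogeneous (k (Suc (Suc 0))) t w \<and>
    (\<forall>p<length (a (Suc (Suc 0))). v p - \<Phi> (Suc (Suc 0)) w p \<in> irrelevant_ideal)"
proof -
  have "homogeneous (a (Suc 0)) t (D (Suc (Suc 0)) v)" by (rule lin_map_homogeneous[OF graded_d v])
  then obtain u where u: "homogeneous (k (Suc 0)) t u"
    "\<And>p. p < length (a (Suc 0)) \<Longrightarrow> D (Suc (Suc 0)) v p = \<Phi> (Suc 0) u p"
    using graded_nakayama[OF graded_\<phi> first_surjective[OF graded_\<phi> first_range], of t t] by blast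
  have "E (Suc 0) u p = 0" if "p < length (k 0)" for p
  proof -
    have "E (Suc 0) u 0 = \<Phi> 0 (E (Suc 0) u) 0" by (simp add: \<Phi>_0)
    also have "\<dots> = D (Suc 0) (\<Phi> (Suc 0) u) 0" using commute[of 0 0 u] a_0 by simp
    also have "\<dots> = D (Suc 0) (D (Suc (Suc 0)) v) 0" by (rule lin_map_cong) (simp add: u(2))
    also have "\<dots> = 0" using d_d[of 0 0] a_0 by simp
    finally show ?thesis using that k_0 by simp
  qed
  then show ?thesis using lift_boundary[OF v u _ assms(1)] by blast
qed

lemma supported_E: "supported (k (Suc i)) \<beta> u \<Longrightarrow> supported (k i) (\<beta> - 1) (E (Suc i) u)"
  by (rule lin_map_supported[OF graded_e]) (auto intro: irrelevant_e)

lemma supported_D: "supported (a (Suc i)) \<beta> u \<Longrightarrow> supported (a i) (\<beta> - 1) (D (Suc i) u)"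
  by (rule lin_map_supported[OF graded_d]) (auto intro: irrelevant_d)

text \<open>Modulo the irrelevant ideal. Injectivity: by the isomorphism one step below, a kernel
  element is a cycle, hence a boundary with entries in the ideal. Surjectivity: the boundary of
  \<open>v\<close> lifts by the isomorphism one step below, and the lift is a cycle by the
  isomorphism two steps below. Each differential costs one degree, which matches the bounds at
  consecutive steps.\<close>

lemma bijective_Suc:
  assumes ex: "\<And>i t. t \<le> c + int i \<Longrightarrow> exact_at i t"
    and IH: "bijective_upto (k i) (a i) (\<phi> i) (c + int i - 2)"
    and IH': "\<And>j. i = Suc j \<Longrightarrow> bijective_upto (k j) (a j) (\<phi> j) (c + int j - 2)"
  shows "bijective_upto (k (Suc i)) (a (Suc i)) (\<phi> (Suc i)) (c + int (Suc i) - 2)"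
proof (rule bijective_uptoI[OF graded_\<phi>])
  let ?\<beta> = "c + int (Suc i) - 2"
  fix t u q
  assume t: "t \<le> ?\<beta>" and u: "homogeneous (k (Suc i)) t u"
    and ker: "\<And>p. p < length (a (Suc i)) \<Longrightarrow> \<Phi> (Suc i) u p = 0" and q: "q < length (k (Suc i))"
  have "supported (k (Suc i)) ?\<beta> u" using homogeneous_supported[OF u] t by (force simp: supported_def)
  then have "supported (k i) (?\<beta> - 1) (E (Suc i) u)"
    by (rule supported_E)
  then have supp: "supported (k i) (c + int i - 2) (E (Suc i) u)" by (simp add: algebra_simps)
  have "\<Phi> i (E (Suc i) u) p = 0" if p: "p < length (a i)" for p
    unfolding commute[OF p, symmetric] by (simp add: lin_map_def[of "d _"] ker)
  then have "\<forall>p<length (k i). E (Suc i) u p = 0"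
    using bijective_uptoD(1)[OF IH supp] by simp
  moreover have "exact_at i t" using ex t by simp
  ultimately obtain w where "\<And>q. q < length (k (Suc i)) \<Longrightarrow> u q = E (Suc (Suc i)) w q"
    using u unfolding exact_at_def by blast
  then show "u q \<in> irrelevant_ideal" using q by (simp add: lin_map_irrelevant irrelevant_e)
next
  let ?\<beta> = "c + int (Suc i) - 2"
  fix t and v :: "nat \<Rightarrow> ('v, 'k) mpoly"
  assume t: "t \<le> ?\<beta>" and v: "homogeneous (a (Suc i)) t v"
  show "\<exists>u. homogeneous (k (Suc i)) t u \<and> (\<forall>p<length (a (Suc i)). v p - \<Phi> (Suc i) u p \<in> irrelevant_ideal)"
  proof (cases i)
    case 0
    \<comment> \<open>At the first module, the fact that the second complex also maps onto the ideal
      takes the place of the lift.\<close>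
    then show ?thesis using first_surjective[OF graded_\<phi> first_range] v by simp
  next
    case (Suc j)
    have "supported (a (Suc i)) ?\<beta> v" using homogeneous_supported[OF v] t by (force simp: supported_def)
    then have "supported (a i) (?\<beta> - 1) (D (Suc i) v)"
      by (rule supported_D)
    then have "supported (a i) (c + int i - 2) (D (Suc i) v)" by (simp add: algebra_simps)
    moreover have "homogeneous (a i) t (D (Suc i) v)" by (rule lin_map_homogeneous[OF graded_d v])
    ultimately obtain u where u: "supported (k i) (c + int i - 2) u" "homogeneous (k i) t u"
      "\<And>p. p < length (a i) \<Longrightarrow> D (Suc i) v p = \<Phi> i u p"
      using bijective_uptoD(2)[OF IH] by blast
    have "supported (k j) (c + int i - 2 - 1) (E i u)"
      unfolding Suc using u(1)[unfolded Suc] by (rule supported_E)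
    then have supp: "supported (k j) (c + int j - 2) (E i u)" by (simp add: Suc algebra_simps)
    have "\<Phi> j (E i u) p = 0" if p: "p < length (a j)" for p
    proof -
      have "\<Phi> j (E i u) p = D i (\<Phi> i u) p" using commute[OF p] Suc by simp
      also have "\<dots> = D i (D (Suc i) v) p" by (rule lin_map_cong) (simp add: u(3))
      also have "\<dots> = 0" using d_d[OF p] Suc by simp
      finally show ?thesis .
    qed
    then have "\<forall>p<length (k j). E i u p = 0" using bijective_uptoD(1)[OF IH'[OF Suc] supp] by simp
    moreover have "exact_at j t" using ex t Suc by simp
    ultimately show ?thesis using lift_boundary[of j t v u] v u Suc by simp
  qed
qed

lemma bijective:
  assumes ex: "\<And>i t. t \<le> c + int i \<Longrightarrow> exact_at i t"
  shows "bijective_upto (k i) (a i) (\<phi> i) (c + int i - 2)"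
proof (induction i rule: less_induct)
  case (less i)
  then show ?case using bijective_0 bijective_Suc[OF ex] by (cases i) auto
qed

end

section \<open>Matrices and vectors\<close>

lemma mult_mat_vec_lin_map:
  assumes "M \<in> carrier_mat m n" "v \<in> carrier_vec n" "p < m"
  shows "(M *\<^sub>v v) $ p = lin_map (\<lambda>p q. M $$ (p, q)) n (($) v) p"
  using assms by (auto simp: lin_map_def scalar_prod_def atLeast0LessThan)

lemma mult_mat_vec_vec:
  assumes "M \<in> carrier_mat m n" "p < m"
  shows "(M *\<^sub>v vec n u) $ p = lin_map (\<lambda>p q. M $$ (p, q)) n u p"
  using assms mult_mat_vec_lin_map[of M m n "vec n u" p] by (simp add: lin_map_def)

lemma lin_map_mat_mult:
  assumes "A \<in> carrier_mat m n" "B \<in> carrier_mat n l" "p < m"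
  shows "lin_map (\<lambda>p q. A $$ (p, q)) n (lin_map (\<lambda>p q. B $$ (p, q)) l u) p = lin_map (\<lambda>p q. (A * B) $$ (p, q)) l u p"
proof -
  have "(A * B) $$ (p, s) = (\<Sum>q<n. A $$ (p, q) * B $$ (q, s))" if "s < l" for s
    using assms that by (simp add: scalar_prod_def atLeast0LessThan)
  then show ?thesis
    unfolding lin_map_def sum_distrib_left
    by (subst sum.swap) (simp add: sum_distrib_right mult.assoc)
qed

lemma graded_hom_iff:
  "graded_hom a b M \<longleftrightarrow> M \<in> carrier_mat (length b) (length a) \<and> graded_matrix a b (\<lambda>p q. M $$ (p, q))"
  by (simp add: graded_hom_def graded_matrix_def)

section \<open>From the matrices of the definitions to functions of indices\<close>

lemma minimal_free_resolution_locale: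
  fixes D :: "nat \<Rightarrow> ('v::finite, 'k::field) mpoly mat"
  assumes "minimal_free_resolution I a D"
  shows "minimal_resolution a (\<lambda>i p q. D i $$ (p, q)) I"
proof -
  note res = assms[unfolded minimal_free_resolution_def]
  have a0: "a 0 = [0]" using res by blast
  have gr: "graded_hom (a (Suc i)) (a i) (D (Suc i))" for i using res by blast
  have car: "D (Suc i) \<in> carrier_mat (length (a i)) (length (a (Suc i)))" for i
    using gr[of i] by (simp add: graded_hom_def)
  have ker: "mat_kernel (D (Suc i)) = mat_image (D (Suc (Suc i)))" for i using res by simp
  have img: "(\<lambda>v. v $ 0) ` mat_image (D (Suc 0)) = I" using res by simp
  show ?thesis
  proof
    show "a 0 = [0]" by (rule a0)
    show "graded_matrix (a (Suc i)) (a i) (\<lambda>p q. D (Suc i) $$ (p, q))" for i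
      using gr[of i] by (simp add: graded_hom_iff)
    show "D (Suc i) $$ (p, q) \<in> irrelevant_ideal" if "p < length (a i)" "q < length (a (Suc i))" for p q i
      using res that by blast
  next
    fix p i and u :: "nat \<Rightarrow> ('v, 'k) mpoly" assume p: "p < length (a i)"
    let ?v = "D (Suc (Suc i)) *\<^sub>v vec (length (a (Suc (Suc i)))) u"
    have "?v \<in> mat_image (D (Suc (Suc i)))" using car[of "Suc i"] by (auto simp: mat_image_def)
    then have v: "D (Suc i) *\<^sub>v ?v = 0\<^sub>v (length (a i))" "?v \<in> carrier_vec (length (a (Suc i)))"
      using ker[of i] car[of i] by (auto simp: mat_kernel_def)
    have "(D (Suc i) *\<^sub>v ?v) $ p = 0" using v(1) p by simp
    then show "lin_map (\<lambda>p q. D (Suc i) $$ (p, q)) (length (a (Suc i)))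
        (lin_map (\<lambda>p q. D (Suc (Suc i)) $$ (p, q)) (length (a (Suc (Suc i)))) u) p = 0"
      unfolding mult_mat_vec_lin_map[OF car v(2) p]
      by (subst (asm) lin_map_cong[where w = "lin_map (\<lambda>p q. D (Suc (Suc i)) $$ (p, q)) (length (a (Suc (Suc i)))) u"])
        (simp_all add: mult_mat_vec_vec[OF car])
  next
    fix i and u :: "nat \<Rightarrow> ('v, 'k) mpoly"
    assume *: "\<And>p. p < length (a i) \<Longrightarrow> lin_map (\<lambda>p q. D (Suc i) $$ (p, q)) (length (a (Suc i))) u p = 0"
    let ?u = "vec (length (a (Suc i))) u"
    have "D (Suc i) *\<^sub>v ?u = 0\<^sub>v (length (a i))"
    proof (rule eq_vecI)
      fix p assume "p < dim_vec (0\<^sub>v (length (a i)) :: ('v, 'k) mpoly vec)"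
      then have p: "p < length (a i)" by simp
      then show "(D (Suc i) *\<^sub>v ?u) $ p = 0\<^sub>v (length (a i)) $ p"
        unfolding mult_mat_vec_vec[OF car p] using * by simp
    qed (use car[of i] in simp)
    then have "?u \<in> mat_kernel (D (Suc i))" using car[of i] by (auto simp: mat_kernel_def)
    then obtain v where v: "v \<in> carrier_vec (length (a (Suc (Suc i))))" "?u = D (Suc (Suc i)) *\<^sub>v v"
      using ker[of i] car[of "Suc i"] by (auto simp: mat_image_def)
    have "u q = lin_map (\<lambda>p q. D (Suc (Suc i)) $$ (p, q)) (length (a (Suc (Suc i)))) (($) v) q"
      if "q < length (a (Suc i))" for q
      using mult_mat_vec_lin_map[OF car v(1) that] v(2) that by (metis index_vec)
    then show "\<exists>w. \<forall>q<length (a (Suc i)). u q = lin_map (\<lambda>p q. D (Suc (Suc i)) $$ (p, q)) (length (a (Suc (Suc i)))) w q"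
      by blast
  next
    fix f
    show "f \<in> I \<longleftrightarrow> (\<exists>w. f = lin_map (\<lambda>p q. D (Suc 0) $$ (p, q)) (length (a (Suc 0))) w 0)"
    proof
      assume "f \<in> I"
      then obtain v where "v \<in> carrier_vec (length (a (Suc 0)))" "f = (D (Suc 0) *\<^sub>v v) $ 0"
        using img car[of 0] by (auto simp: mat_image_def)
      then show "\<exists>w. f = lin_map (\<lambda>p q. D (Suc 0) $$ (p, q)) (length (a (Suc 0))) w 0"
        using mult_mat_vec_lin_map[OF car[of 0], of v 0] a0 by auto
    next
      assume "\<exists>w. f = lin_map (\<lambda>p q. D (Suc 0) $$ (p, q)) (length (a (Suc 0))) w 0"
      then obtain w where w: "f = lin_map (\<lambda>p q. D (Suc 0) $$ (p, q)) (length (a (Suc 0))) w 0" by blast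
      have "f = (D (Suc 0) *\<^sub>v vec (length (a (Suc 0))) w) $ 0"
        using mult_mat_vec_vec[OF car[of 0], of 0 w] a0 w by simp
      moreover have "D (Suc 0) *\<^sub>v vec (length (a (Suc 0))) w \<in> mat_image (D (Suc 0))"
        using car[of 0] by (auto simp: mat_image_def)
      ultimately show "f \<in> I" using img by blast
    qed
  qed
qed

lemma comparison_locale:
  fixes Fs :: "('v::finite, 'k::field) mpoly list"
  assumes res: "minimal_free_resolution (ideal_generated (set Fs)) a D"
    and Fs: "Fs \<in> form_tuples ds" and pos: "\<forall>d\<in>set ds. 1 \<le> d"
    and \<phi>: "comparison_map ds Fs a D \<phi>"
  shows "comparison a (\<lambda>i p q. D i $$ (p, q)) (ideal_generated (set Fs)) (koszul_module ds)
    (\<lambda>i p q. koszul_map Fs (i - 1) $$ (p, q)) (\<lambda>i p q. \<phi> i $$ (p, q))"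
proof -
  interpret minimal_resolution a "\<lambda>i p q. D i $$ (p, q)" "ideal_generated (set Fs)"
    by (rule minimal_free_resolution_locale[OF res])
  have len: "length Fs = length ds" using form_tuples_length[OF Fs] .
  have gr: "graded_hom (koszul_module ds i) (a i) (\<phi> i)" for i using \<phi> by (simp add: comparison_map_def)
  have car\<phi>: "\<phi> i \<in> carrier_mat (length (a i)) (length (koszul_module ds i))" for i
    using gr[of i] by (simp add: graded_hom_def)
  have carD: "D (Suc i) \<in> carrier_mat (length (a i)) (length (a (Suc i)))" for i
    using res by (simp add: minimal_free_resolution_def graded_hom_def)
  have carK: "koszul_map Fs i \<in> carrier_mat (length (koszul_module ds i)) (length (koszul_module ds (Suc i)))" for i
    using koszul_map_dim[of Fs i] len by simp
  show ?thesis
  proof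
    show "koszul_module ds 0 = [0]" by simp
    show "graded_matrix (koszul_module ds (Suc i)) (koszul_module ds i) (\<lambda>p q. koszul_map Fs (Suc i - 1) $$ (p, q))" for i
      using koszul_map_irrelevant(2)[OF Fs pos] by (simp add: graded_matrix_def)
    show "koszul_map Fs (Suc i - 1) $$ (p, q) \<in> irrelevant_ideal"
      if "p < length (koszul_module ds i)" "q < length (koszul_module ds (Suc i))" for p q i
      using koszul_map_irrelevant(1)[OF Fs pos] that by simp
    show "\<exists>w. homogeneous (koszul_module ds (Suc 0)) t w \<and>
        f = lin_map (\<lambda>p q. koszul_map Fs (Suc 0 - 1) $$ (p, q)) (length (koszul_module ds (Suc 0))) w 0"
      if "f \<in> ideal_generated (set Fs)" "f \<in> forms t" for f t
      using koszul_map_0_range[OF Fs, of f t] that unfolding ideal_generated_set len by auto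
    show "\<phi> 0 $$ (0, 0) = 1" using \<phi> by (simp add: comparison_map_def)
    show "graded_matrix (koszul_module ds i) (a i) (\<lambda>p q. \<phi> i $$ (p, q))" for i
      using gr[of i] by (simp add: graded_hom_iff)
    show "lin_map (\<lambda>p q. D (Suc i) $$ (p, q)) (length (a (Suc i)))
        (lin_map (\<lambda>p q. \<phi> (Suc i) $$ (p, q)) (length (koszul_module ds (Suc i))) u) p =
      lin_map (\<lambda>p q. \<phi> i $$ (p, q)) (length (koszul_module ds i))
        (lin_map (\<lambda>p q. koszul_map Fs (Suc i - 1) $$ (p, q)) (length (koszul_module ds (Suc i))) u) p"
      if p: "p < length (a i)" for p i u
      using lin_map_mat_mult[OF carD car\<phi> p, of u] lin_map_mat_mult[OF car\<phi> carK p, of u] \<phi>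
      by (simp add: comparison_map_def)
  qed
qed

text \<open>Ensures that the statements about all comparison maps have content. The map is built one
  degree at a time, by lifting columns along the exact resolution.\<close>

lemma comparison_map_exists:
  fixes Fs :: "('v::finite, 'k::field) mpoly list"
  assumes res: "minimal_free_resolution (ideal_generated (set Fs)) a M"
    and Fs: "Fs \<in> form_tuples ds" and pos: "\<forall>d\<in>set ds. 1 \<le> d"
  shows "\<exists>\<phi>. comparison_map ds Fs a M \<phi>"
proof -
  interpret minimal_resolution a "\<lambda>i p q. M i $$ (p, q)" "ideal_generated (set Fs)"
    by (rule minimal_free_resolution_locale[OF res])
  let ?k = "koszul_module ds"
  have len: "length Fs = length ds" using form_tuples_length[OF Fs] .
  have carD: "M (Suc i) \<in> carrier_mat (length (a i)) (length (a (Suc i)))" for i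
    using res by (simp add: minimal_free_resolution_def graded_hom_def)
  have carK: "koszul_map Fs i \<in> carrier_mat (length (?k i)) (length (?k (Suc i)))" for i
    using koszul_map_dim[of Fs i] len by simp
  \<comment> \<open>The invariant of the recursion: besides the grading it records that
    \<open>\<phi>\<close> composed with the Koszul map consists of cycles, since these are what the
    next step has to lift.\<close>
  define P where "P n \<phi> \<longleftrightarrow> graded_hom (?k n) (a n) \<phi> \<and> (n = 0 \<longrightarrow> \<phi> = 1\<^sub>m 1) \<and>
    (\<forall>m. n = Suc m \<longrightarrow> (\<forall>p<length (a m). \<forall>s<length (?k (Suc n)).
      lin_map (\<lambda>p q. M n $$ (p, q)) (length (a n)) (\<lambda>q. (\<phi> * koszul_map Fs n) $$ (q, s)) p = 0))" for n \<phi>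
  have "\<exists>\<phi>. \<forall>n. P n (\<phi> n) \<and> M (Suc n) * \<phi> (Suc n) = \<phi> n * koszul_map Fs n"
  proof (rule dependent_nat_choice)
    have "graded_hom (?k 0) (a 0) (1\<^sub>m 1 :: ('v, 'k) mpoly mat)" by (simp add: graded_hom_def a_0)
    then show "\<exists>\<phi>. P 0 \<phi>" unfolding P_def by auto
  next
    fix \<phi> n assume P: "P n \<phi>"
    then have gr: "graded_hom (?k n) (a n) \<phi>" by (simp add: P_def)
    then have car: "\<phi> \<in> carrier_mat (length (a n)) (length (?k n))" by (simp add: graded_hom_def)
    have carP: "\<phi> * koszul_map Fs n \<in> carrier_mat (length (a n)) (length (?k (Suc n)))" using car carK by auto
    have entry: "(\<phi> * koszul_map Fs n) $$ (q, s) =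
        lin_map (\<lambda>p q. \<phi> $$ (p, q)) (length (?k n)) (\<lambda>p. koszul_map Fs n $$ (p, s)) q"
      if "q < length (a n)" "s < length (?k (Suc n))" for q s
      using that car carK[of n] by (auto simp: lin_map_def scalar_prod_def atLeast0LessThan)
    have col: "homogeneous (a n) (?k (Suc n) ! s) (\<lambda>q. (\<phi> * koszul_map Fs n) $$ (q, s))"
      if s: "s < length (?k (Suc n))" for s
    proof -
      have "homogeneous (?k n) (?k (Suc n) ! s) (\<lambda>p. koszul_map Fs n $$ (p, s))"
        using koszul_map_irrelevant(2)[OF Fs pos] s by (simp add: homogeneous_def)
      then have "homogeneous (a n) (?k (Suc n) ! s)
          (lin_map (\<lambda>p q. \<phi> $$ (p, q)) (length (?k n)) (\<lambda>p. koszul_map Fs n $$ (p, s)))"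
        using gr by (intro lin_map_homogeneous) (auto simp: graded_hom_iff)
      then show ?thesis using entry s by (simp add: homogeneous_def)
    qed
    have "\<forall>s. \<exists>w. s < length (?k (Suc n)) \<longrightarrow> homogeneous (a (Suc n)) (?k (Suc n) ! s) w \<and>
      (\<forall>q<length (a n). (\<phi> * koszul_map Fs n) $$ (q, s) = D (Suc n) w q)"
    proof
      fix s
      show "\<exists>w. s < length (?k (Suc n)) \<longrightarrow> homogeneous (a (Suc n)) (?k (Suc n) ! s) w \<and>
        (\<forall>q<length (a n). (\<phi> * koszul_map Fs n) $$ (q, s) = D (Suc n) w q)"
      proof (cases "s < length (?k (Suc n))")
        case s: True
        show ?thesis
        proof (cases n)
          case 0
          have "\<phi> = 1\<^sub>m 1" using P 0 by (simp add: P_def)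
          then have e: "(\<phi> * koszul_map Fs n) $$ (0, s) = koszul_map Fs 0 $$ (0, s)"
            using 0 carK[of 0] by simp
          have "(\<phi> * koszul_map Fs n) $$ (0, s) \<in> ideal_generated (set Fs)"
            unfolding e ideal_generated_set len using koszul_map_0_entry[OF len] s 0 by simp
          moreover have "(\<phi> * koszul_map Fs n) $$ (0, s) \<in> forms (?k (Suc n) ! s)"
            using col[OF s] 0 a_0 by (simp add: homogeneous_def)
          ultimately obtain w where "homogeneous (a (Suc 0)) (?k (Suc n) ! s) w"
            "(\<phi> * koszul_map Fs n) $$ (0, s) = D (Suc 0) w 0" by (rule range_homogeneous)
          then show ?thesis using 0 a_0 by auto
        next
          case (Suc m)
          have "D (Suc m) (\<lambda>q. (\<phi> * koszul_map Fs n) $$ (q, s)) p = 0" if "p < length (a m)" for p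
            using P Suc that s by (simp add: P_def)
          then obtain w where "homogeneous (a (Suc (Suc m))) (?k (Suc n) ! s) w"
            "\<And>q. q < length (a (Suc m)) \<Longrightarrow> (\<phi> * koszul_map Fs n) $$ (q, s) = D (Suc (Suc m)) w q"
            using exact_homogeneous[OF col[OF s, unfolded Suc]] Suc by auto
          then show ?thesis using Suc by auto
        qed
      qed auto
    qed
    from choice[OF this] obtain W where W: "\<forall>s. s < length (?k (Suc n)) \<longrightarrow> homogeneous (a (Suc n)) (?k (Suc n) ! s) (W s) \<and>
      (\<forall>q<length (a n). (\<phi> * koszul_map Fs n) $$ (q, s) = D (Suc n) (W s) q)" by (rule exE)
    define \<psi> where "\<psi> = mat (length (a (Suc n))) (length (?k (Suc n))) (\<lambda>(p, s). W s p)"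
    have car\<psi>: "\<psi> \<in> carrier_mat (length (a (Suc n))) (length (?k (Suc n)))" by (simp add: \<psi>_def)
    have Q: "M (Suc n) * \<psi> = \<phi> * koszul_map Fs n"
    proof (rule eq_matI)
      fix q s assume "q < dim_row (\<phi> * koszul_map Fs n)" "s < dim_col (\<phi> * koszul_map Fs n)"
      then have qs: "q < length (a n)" "s < length (?k (Suc n))" using carP by auto
      have "(M (Suc n) * \<psi>) $$ (q, s) = D (Suc n) (W s) q"
        using qs carD[of n] car\<psi> by (auto simp: lin_map_def scalar_prod_def atLeast0LessThan \<psi>_def intro!: sum.cong)
      then show "(M (Suc n) * \<psi>) $$ (q, s) = (\<phi> * koszul_map Fs n) $$ (q, s)" using W qs by simp
    qed (use carP carD[of n] car\<psi> in auto)
    have gr\<psi>: "graded_hom (?k (Suc n)) (a (Suc n)) \<psi>"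
      using W by (auto simp: graded_hom_def \<psi>_def homogeneous_def)
    have "lin_map (\<lambda>p q. M (Suc n) $$ (p, q)) (length (a (Suc n))) (\<lambda>q. (\<psi> * koszul_map Fs (Suc n)) $$ (q, s)) p = 0"
      if p: "p < length (a n)" and s: "s < length (?k (Suc (Suc n)))" for p s
    proof -
      let ?c = "\<lambda>q. koszul_map Fs (Suc n) $$ (q, s)"
      have "lin_map (\<lambda>p q. M (Suc n) $$ (p, q)) (length (a (Suc n))) (\<lambda>q. (\<psi> * koszul_map Fs (Suc n)) $$ (q, s)) p =
        D (Suc n) (lin_map (\<lambda>p q. \<psi> $$ (p, q)) (length (?k (Suc n))) ?c) p"
        by (rule lin_map_cong) (use s car\<psi> carK[of "Suc n"] in \<open>auto simp: lin_map_def scalar_prod_def atLeast0LessThan\<close>)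
      also have "\<dots> = lin_map (\<lambda>p q. (M (Suc n) * \<psi>) $$ (p, q)) (length (?k (Suc n))) ?c p"
        by (rule lin_map_mat_mult[OF carD car\<psi> p])
      also have "\<dots> = lin_map (\<lambda>p q. \<phi> $$ (p, q)) (length (?k n)) (lin_map (\<lambda>p q. koszul_map Fs n $$ (p, q)) (length (?k (Suc n))) ?c) p"
        unfolding Q by (rule lin_map_mat_mult[OF car carK p, symmetric])
      also have "\<dots> = lin_map (\<lambda>p q. \<phi> $$ (p, q)) (length (?k n)) (\<lambda>_. 0) p"
      proof (rule lin_map_cong)
        fix q assume q: "q < length (?k n)"
        \<comment> \<open>Column \<open>s\<close> is the image of a unit vector, so the vanishing of
          the square of the Koszul differential applies to it.\<close>
        have "lin_map (\<lambda>p q. koszul_map Fs n $$ (p, q)) (length (?k (Suc n))) ?c q =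
          lin_map (\<lambda>p q. koszul_map Fs n $$ (p, q)) (length (?k (Suc n)))
            (lin_map (\<lambda>p q. koszul_map Fs (Suc n) $$ (p, q)) (length (?k (Suc (Suc n)))) (\<lambda>q. if q = s then 1 else 0)) q"
          by (rule lin_map_cong) (simp only: lin_map_unit[OF s])
        also have "\<dots> = 0" using koszul_map_comp[of q Fs n] q len by simp
        finally show "lin_map (\<lambda>p q. koszul_map Fs n $$ (p, q)) (length (?k (Suc n))) ?c q = 0" .
      qed
      also have "\<dots> = 0" by (simp add: lin_map_def)
      finally show ?thesis .
    qed
    then have "P (Suc n) \<psi>" unfolding P_def using gr\<psi> by auto
    then show "\<exists>\<psi>. P (Suc n) \<psi> \<and> M (Suc n) * \<psi> = \<phi> * koszul_map Fs n" using Q by blast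
  qed
  then obtain \<phi> where "\<forall>n. P n (\<phi> n) \<and> M (Suc n) * \<phi> (Suc n) = \<phi> n * koszul_map Fs n" by (rule exE)
  then have "comparison_map ds Fs a M \<phi>" by (auto simp: comparison_map_def P_def)
  then show ?thesis by blast
qed

section \<open>Resolutions of general forms\<close>

lemma bijective_upto_surjective:
  assumes "bijective_upto k a M \<beta>" "t \<le> \<beta>" "homogeneous a t v"
  shows "\<exists>u. homogeneous k t u \<and> (\<forall>p<length a. v p = lin_map M (length k) u p)"
proof -
  have "supported a \<beta> v" using homogeneous_supported[OF assms(3)] assms(2) by (force simp: supported_def)
  then show ?thesis using bijective_uptoD(2)[OF assms(1)] assms(3) by blast
qed

lemma koszul_surjectiveI:
  fixes \<phi> :: "nat \<Rightarrow> ('v, 'k::comm_ring_1) mpoly mat"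
  assumes car: "\<phi> j \<in> carrier_mat (length (a j)) (length (koszul_module ds j))"
    and surj: "\<And>v. homogeneous (a j) t v \<Longrightarrow> \<exists>u. homogeneous (koszul_module ds j) t u \<and>
      (\<forall>p<length (a j). v p - lin_map (\<lambda>p q. \<phi> j $$ (p, q)) (length (koszul_module ds j)) u p \<in> irrelevant_ideal)"
  shows "koszul_surjective ds a \<phi> j t"
  unfolding koszul_surjective_def
proof
  fix v :: "('v, 'k) mpoly vec" assume v: "v \<in> homogeneous_elements (a j) t"
  then have "homogeneous (a j) t (($) v)" by (simp add: homogeneous_elements_def homogeneous_def)
  then obtain u where u: "homogeneous (koszul_module ds j) t u"
      "\<And>p. p < length (a j) \<Longrightarrow>
        v $ p - lin_map (\<lambda>p q. \<phi> j $$ (p, q)) (length (koszul_module ds j)) u p \<in> irrelevant_ideal"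
    using surj by blast
  show "\<exists>u\<in>homogeneous_elements (koszul_module ds j) t.
        \<forall>p<length (a j). (v - \<phi> j *\<^sub>v u) $ p \<in> irrelevant_ideal"
  proof (intro bexI[of _ "vec (length (koszul_module ds j)) u"] allI impI)
    show "vec (length (koszul_module ds j)) u \<in> homogeneous_elements (koszul_module ds j) t"
      using u(1) by (simp add: homogeneous_elements_def homogeneous_def del: koszul_module_length)
    fix p assume p: "p < length (a j)"
    have "(v - \<phi> j *\<^sub>v vec (length (koszul_module ds j)) u) $ p =
        v $ p - (\<phi> j *\<^sub>v vec (length (koszul_module ds j)) u) $ p"
      using p car by (intro index_minus_vec) simp
    then show "(v - \<phi> j *\<^sub>v vec (length (koszul_module ds j)) u) $ p \<in> irrelevant_ideal"
      unfolding mult_mat_vec_vec[OF car p] using u(2)[OF p] by simp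
  qed
qed

lemma bijective_upto_bij_betw:
  fixes M :: "('v, 'k::comm_ring_1) mpoly mat"
  assumes car: "M \<in> carrier_mat (length a) (length k)"
    and bij: "bijective_upto k a (\<lambda>p q. M $$ (p, q)) \<beta>"
    and k: "\<And>q. q < length k \<Longrightarrow> k ! q \<le> \<beta>" and a: "\<And>p. p < length a \<Longrightarrow> a ! p \<le> \<beta>"
  shows "bij_betw (\<lambda>v. M *\<^sub>v v) (carrier_vec (length k)) (carrier_vec (length a))"
  unfolding bij_betw_def
proof
  show "inj_on (\<lambda>v. M *\<^sub>v v) (carrier_vec (length k))"
  proof (rule inj_onI)
    fix x y assume x: "x \<in> carrier_vec (length k)" and y: "y \<in> carrier_vec (length k)" and eq: "M *\<^sub>v x = M *\<^sub>v y"
    have z: "lin_map (\<lambda>p q. M $$ (p, q)) (length k) (\<lambda>q. x $ q - y $ q) p = 0" if "p < length a" for p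
      using mult_mat_vec_lin_map[OF car x that] mult_mat_vec_lin_map[OF car y that] eq by (simp add: lin_map_diff)
    have s: "supported k \<beta> (\<lambda>q. x $ q - y $ q)" using k by (simp add: supported_def)
    have "x $ q - y $ q = 0" if "q < length k" for q
      by (rule bijective_uptoD(1)[OF bij s z that])
    then show "x = y" using x y by (intro eq_vecI) auto
  qed
  show "(\<lambda>v. M *\<^sub>v v) ` carrier_vec (length k) = carrier_vec (length a)"
  proof (intro equalityI subsetI)
    fix v assume "v \<in> (\<lambda>v. M *\<^sub>v v) ` carrier_vec (length k)"
    then show "v \<in> carrier_vec (length a)" using car by auto
  next
    fix v :: "('v, 'k) mpoly vec" assume v: "v \<in> carrier_vec (length a)"
    have "supported a \<beta> (($) v)" using a by (simp add: supported_def)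
    then obtain u where u: "\<And>p. p < length a \<Longrightarrow> v $ p = lin_map (\<lambda>p q. M $$ (p, q)) (length k) u p"
      using bijective_uptoD(2)[OF bij] by blast
    have "v = M *\<^sub>v vec (length k) u"
    proof (rule eq_vecI)
      fix p assume "p < dim_vec (M *\<^sub>v vec (length k) u)"
      then have p: "p < length a" using car by simp
      show "v $ p = (M *\<^sub>v vec (length k) u) $ p" unfolding mult_mat_vec_vec[OF car p] by (rule u[OF p])
    qed (use v car in simp)
    then show "v \<in> (\<lambda>v. M *\<^sub>v v) ` carrier_vec (length k)" by auto
  qed
qed

text \<open>The basis of the module is split at \<open>c + i - 2\<close>. Up to there it is
  accounted for by \<open>\<phi>\<close>; by the upper bound the other basis vectors have degree
  \<open>c + i\<close> or \<open>c + i - 1\<close>, and \<open>B\<close> is the inclusion of their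
  coordinates.\<close>

lemma koszul_decompositionI:
  fixes \<phi> :: "('v::finite, 'k::comm_ring_1) mpoly mat"
  assumes gr: "graded_hom (koszul_module ds i) a \<phi>"
    and bij: "bijective_upto (koszul_module ds i) a (\<lambda>p q. \<phi> $$ (p, q)) (c + int i - 2)"
    and le: "\<And>p. p < length a \<Longrightarrow> a ! p \<le> c + int i"
  shows "koszul_decomposition ds c i a \<phi>"
proof -
  let ?\<beta> = "c + int i - 2" and ?k = "koszul_module ds i" and ?N = "length a"
  have car: "\<phi> \<in> carrier_mat ?N (length ?k)" and grm: "graded_matrix ?k a (\<lambda>p q. \<phi> $$ (p, q))"
    using gr by (simp_all add: graded_hom_iff)
  define ps where "ps = filter (\<lambda>p. a ! p = c + int i) [0..<?N] @ filter (\<lambda>p. a ! p = c + int i - 1) [0..<?N]"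
  define x where "x = length (filter (\<lambda>p. a ! p = c + int i) [0..<?N])"
  define y where "y = length (filter (\<lambda>p. a ! p = c + int i - 1) [0..<?N])"
  define L where "L = replicate x (c + int i) @ replicate y (c + int i - 1)"
  have L: "L = map ((!) a) ps"
  proof -
    have "map ((!) a) (filter (\<lambda>p. a ! p = e) [0..<?N]) = replicate (length (filter (\<lambda>p. a ! p = e) [0..<?N])) e" for e
      by (rule replicate_eqI) auto
    then show ?thesis by (simp add: L_def ps_def x_def y_def)
  qed
  then have lenL: "length L = length ps" by simp
  have dist: "distinct ps" by (auto simp: ps_def)
  have set_ps: "set ps = {p. p < ?N \<and> a ! p > ?\<beta>}" using le by (force simp: ps_def)
  define B :: "('v, 'k) mpoly mat" where "B = mat ?N (length ps) (\<lambda>(p, q). if p = ps ! q then 1 else 0)"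
  have carB: "B \<in> carrier_mat ?N (length L)" by (simp add: B_def lenL)
  have B_in: "(B *\<^sub>v w) $ (ps ! q) = w $ q" if w: "w \<in> carrier_vec (length L)" and q: "q < length ps" for w q
  proof -
    have p: "ps ! q < ?N" using nth_mem[OF q] set_ps by auto
    have "(B *\<^sub>v w) $ (ps ! q) = (\<Sum>s<length ps. if s = q then w $ q else 0)"
      unfolding mult_mat_vec_lin_map[OF carB w p] lin_map_def lenL
      by (rule sum.cong) (use p q dist in \<open>auto simp: B_def nth_eq_iff_index_eq\<close>)
    then show ?thesis using q by simp
  qed
  have B_out: "(B *\<^sub>v w) $ p = 0" if w: "w \<in> carrier_vec (length L)" and p: "p < ?N" "p \<notin> set ps" for w p
    unfolding mult_mat_vec_lin_map[OF carB w p(1)] lin_map_def lenL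
    by (rule sum.neutral) (use p in \<open>auto simp: B_def\<close>)
  \<comment> \<open>An entry of \<open>\<phi>\<close> from a basis vector of degree at most
    \<open>?\<beta>\<close> to one of larger degree would have negative degree. So the image of the
    Koszul syzygies has no coordinates in common with \<open>B\<close>, and the sum is
    direct.\<close>
  have \<phi>_out: "(\<phi> *\<^sub>v u) $ p = 0" if u: "u \<in> koszul_syzygies ds i ?\<beta>" and p: "p < ?N" "p \<in> set ps" for u p
  proof -
    have cu: "u \<in> carrier_vec (length ?k)" using u by (simp add: koszul_syzygies_def)
    have "(\<phi> *\<^sub>v u) $ p = (\<Sum>q<length ?k. \<phi> $$ (p, q) * u $ q)"
      unfolding mult_mat_vec_lin_map[OF car cu p(1)] lin_map_def ..
    also have "\<dots> = 0"
    proof (rule sum.neutral, rule ballI)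
      fix q assume q: "q \<in> {..<length ?k}"
      show "\<phi> $$ (p, q) * u $ q = 0"
      proof (cases "u $ q = 0")
        case False
        then have "?k ! q \<le> ?\<beta>" using u q by (simp add: koszul_syzygies_def del: koszul_module_length)
        moreover have "\<phi> $$ (p, q) \<in> forms (?k ! q - a ! p)" using grm q p(1) by (simp add: graded_matrix_def)
        moreover have "?\<beta> < a ! p" using p(2) set_ps by simp
        ultimately have "\<phi> $$ (p, q) = 0" by (intro forms_neg[of "\<phi> $$ (p, q)" "?k ! q - a ! p"]) simp_all
        then show ?thesis by simp
      qed simp
    qed
    finally show ?thesis .
  qed
  have supp: "supported ?k ?\<beta> (($) u)" if "u \<in> koszul_syzygies ds i ?\<beta>" for u :: "('v, 'k) mpoly vec"
    using that by (simp add: koszul_syzygies_def supported_def)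
  have grB: "graded_hom L a B"
    unfolding graded_hom_def
  proof (intro conjI allI impI carB)
    fix p q assume "p < length a" "q < length L"
    then show "B $$ (p, q) \<in> forms (L ! q - a ! p)" using L by (auto simp: B_def)
  qed
  have bijB: "bij_betw (\<lambda>(w, u). B *\<^sub>v w + \<phi> *\<^sub>v u) (carrier_vec (length L) \<times> koszul_syzygies ds i ?\<beta>) (carrier_vec ?N)"
    unfolding bij_betw_def
  proof
    have sum_nth: "(B *\<^sub>v w + \<phi> *\<^sub>v u) $ p = (B *\<^sub>v w) $ p + (\<phi> *\<^sub>v u) $ p" if "p < ?N" for p w u
      using that car by simp
    show "inj_on (\<lambda>(w, u). B *\<^sub>v w + \<phi> *\<^sub>v u) (carrier_vec (length L) \<times> koszul_syzygies ds i ?\<beta>)"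
    proof (rule inj_onI, clarify)
      fix w u w' u'
      assume w: "w \<in> carrier_vec (length L)" "w' \<in> carrier_vec (length L)"
        and u: "u \<in> koszul_syzygies ds i ?\<beta>" "u' \<in> koszul_syzygies ds i ?\<beta>"
        and eq: "B *\<^sub>v w + \<phi> *\<^sub>v u = B *\<^sub>v w' + \<phi> *\<^sub>v u'"
      have cu: "u \<in> carrier_vec (length ?k)" "u' \<in> carrier_vec (length ?k)" using u by (auto simp: koszul_syzygies_def)
      have eqp: "(B *\<^sub>v w) $ p + (\<phi> *\<^sub>v u) $ p = (B *\<^sub>v w') $ p + (\<phi> *\<^sub>v u') $ p" if "p < ?N" for p
        using sum_nth[OF that] eq by metis
      have "w $ q = w' $ q" if q: "q < length ps" for q
      proof -
        have p: "ps ! q < ?N" "ps ! q \<in> set ps" using nth_mem[OF q] set_ps by auto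
        show ?thesis using eqp[OF p(1)] B_in w q \<phi>_out[OF u(1) p] \<phi>_out[OF u(2) p] by simp
      qed
      then have ww: "w = w'" using w lenL by (intro eq_vecI) auto
      have z: "lin_map (\<lambda>p q. \<phi> $$ (p, q)) (length ?k) (\<lambda>q. u $ q - u' $ q) p = 0" if p: "p < ?N" for p
        using mult_mat_vec_lin_map[OF car cu(1) p] mult_mat_vec_lin_map[OF car cu(2) p] eqp[OF p] ww
        by (simp add: lin_map_diff)
      have s: "supported ?k ?\<beta> (\<lambda>q. u $ q - u' $ q)"
        using supp[OF u(1)] supp[OF u(2)] unfolding supported_def by (metis diff_zero)
      have "u $ q - u' $ q = 0" if "q < length ?k" for q
        by (rule bijective_uptoD(1)[OF bij s z that])
      then have "u = u'" using cu by (intro eq_vecI) auto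
      then show "w = w' \<and> u = u'" using ww by simp
    qed
    show "(\<lambda>(w, u). B *\<^sub>v w + \<phi> *\<^sub>v u) ` (carrier_vec (length L) \<times> koszul_syzygies ds i ?\<beta>) = carrier_vec ?N"
    proof (intro equalityI subsetI)
      fix v assume "v \<in> (\<lambda>(w, u). B *\<^sub>v w + \<phi> *\<^sub>v u) ` (carrier_vec (length L) \<times> koszul_syzygies ds i ?\<beta>)"
      then obtain w u where "v = B *\<^sub>v w + \<phi> *\<^sub>v u" by auto
      moreover have "\<phi> *\<^sub>v u \<in> carrier_vec ?N" by (rule carrier_vecI) (use car in simp)
      ultimately show "v \<in> carrier_vec ?N" by (simp add: carrier_dim_vec)
    next
      fix v :: "('v, 'k) mpoly vec" assume v: "v \<in> carrier_vec ?N"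
      \<comment> \<open>Only the low part of \<open>v\<close> is lifted to the Koszul syzygies; the
        high coordinates are supplied by \<open>B\<close> unchanged.\<close>
      let ?v = "\<lambda>p. if a ! p \<le> ?\<beta> then v $ p else 0"
      have "supported a ?\<beta> ?v" by (simp add: supported_def)
      then obtain u where u: "supported ?k ?\<beta> u"
        "\<And>p. p < ?N \<Longrightarrow> ?v p = lin_map (\<lambda>p q. \<phi> $$ (p, q)) (length ?k) u p"
        using bijective_uptoD(2)[OF bij] by blast
      let ?u = "vec (length ?k) u" and ?w = "vec (length L) (\<lambda>q. v $ (ps ! q))"
      have uu: "?u \<in> koszul_syzygies ds i ?\<beta>"
        using u(1) by (simp add: koszul_syzygies_def supported_def del: koszul_module_length)
      have "B *\<^sub>v ?w + \<phi> *\<^sub>v ?u = v"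
      proof (rule eq_vecI)
        fix p assume "p < dim_vec v"
        then have p: "p < ?N" using v by simp
        show "(B *\<^sub>v ?w + \<phi> *\<^sub>v ?u) $ p = v $ p"
        proof (cases "p \<in> set ps")
          case True
          then obtain q where q: "q < length ps" "p = ps ! q" by (auto simp: in_set_conv_nth)
          have "(B *\<^sub>v ?w) $ p = v $ p" using B_in[of ?w q] q lenL by simp
          then show ?thesis using sum_nth[OF p] \<phi>_out[OF uu p True] by simp
        next
          case False
          then have "a ! p \<le> ?\<beta>" using p set_ps by auto
          then have "(\<phi> *\<^sub>v ?u) $ p = v $ p" unfolding mult_mat_vec_vec[OF car p] using u(2)[OF p] by simp
          then show ?thesis using sum_nth[OF p] B_out[OF _ p False, of ?w] by simp
        qed
      qed (use v car in simp)
      then show "v \<in> (\<lambda>(w, u). B *\<^sub>v w + \<phi> *\<^sub>v u) ` (carrier_vec (length L) \<times> koszul_syzygies ds i ?\<beta>)"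
        using uu by (auto intro!: image_eqI[of _ _ "(?w, ?u)"])
    qed
  qed
  show ?thesis
    unfolding koszul_decomposition_def Let_def
    using grB bijB unfolding L_def by blast
qed

text \<open>A homogeneous coefficient outside the irrelevant ideal is a nonzero constant; dividing
  by it would express one form through the others.\<close>

lemma minimal_generators_relation:
  fixes Fs :: "('v::finite, 'k::field) mpoly list"
  assumes min: "minimal_generators Fs" and len: "length Fs = length ds"
    and u: "homogeneous (map int ds) t u" and rel: "(\<Sum>j<length ds. u j * Fs ! j) = 0" and q: "q < length ds"
  shows "u q \<in> irrelevant_ideal"
proof (rule ccontr)
  assume n: "u q \<notin> irrelevant_ideal"
  have uq: "u q \<in> forms (t - int (ds ! q))" using u q by (simp add: homogeneous_def)
  then have "t - int (ds ! q) = 0" using forms_irrelevant n by blast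
  then have const: "u q = mterm 0 (coef (u q) 0)" using uq forms_zero_const by metis
  have nz: "coef (u q) 0 \<noteq> 0" using n by (simp add: irrelevant_ideal_def)
  let ?c = "mterm 0 (inverse (coef (u q) 0)) :: ('v, 'k) mpoly" and ?A = "{..<length ds} - {q}"
  have "?c * u q = 1" by (subst const) (use nz in \<open>simp add: mult_single\<close>)
  have "u q * Fs ! q + (\<Sum>j\<in>?A. u j * Fs ! j) = 0"
    using rel q by (simp add: sum.remove)
  then have "u q * Fs ! q = (\<Sum>j\<in>?A. - u j * Fs ! j)" by (simp add: add_eq_0_iff2 sum_negf)
  then have "?c * (u q * Fs ! q) = (\<Sum>j\<in>?A. (?c * - u j) * Fs ! j)"
    by (simp add: sum_distrib_left mult.assoc)
  then have "Fs ! q = (\<Sum>j\<in>?A. (?c * - u j) * Fs ! j)"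
    using \<open>?c * u q = 1\<close> by (simp add: mult.assoc [symmetric])
  then have "Fs ! q \<in> lincombs ((!) Fs) ?A" by (rule lincombsI)
  then show False using minimal_generatorsD[OF min, of q] q len by simp
qed

text \<open>Lifting each form to the first module defines the matrix. It is surjective modulo the
  irrelevant ideal because the forms generate, and injective modulo it because they generate
  minimally.\<close>

lemma first_module_iso:
  fixes Fs :: "('v::finite, 'k::field) mpoly list"
  assumes res: "minimal_free_resolution (ideal_generated (set Fs)) a D"
    and Fs: "Fs \<in> form_tuples ds" and min: "minimal_generators Fs"
  shows "\<exists>M :: ('v, 'k) mpoly mat. graded_iso (map int ds) (a 1) M"
proof -
  interpret minimal_resolution a "\<lambda>i p q. D i $$ (p, q)" "ideal_generated (set Fs)"
    by (rule minimal_free_resolution_locale[OF res])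
  let ?d = "lin_map (\<lambda>p q. D (Suc 0) $$ (p, q)) (length (a (Suc 0)))"
  have len: "length Fs = length ds" using form_tuples_length[OF Fs] .
  have I: "ideal_generated (set Fs) = lincombs ((!) Fs) {..<length ds}" by (simp add: ideal_generated_set len)
  have "\<forall>j. \<exists>w. j < length ds \<longrightarrow> homogeneous (a (Suc 0)) (int (ds ! j)) w \<and> Fs ! j = ?d w 0"
  proof
    fix j
    show "\<exists>w. j < length ds \<longrightarrow> homogeneous (a (Suc 0)) (int (ds ! j)) w \<and> Fs ! j = ?d w 0"
    proof (cases "j < length ds")
      case True
      then have "Fs ! j \<in> ideal_generated (set Fs)" unfolding I by (intro lincombs_gen) auto
      then obtain w where "homogeneous (a (Suc 0)) (int (ds ! j)) w" "Fs ! j = ?d w 0"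
        using range_homogeneous form_tuples_nth[OF Fs True] by blast
      then show ?thesis by blast
    qed auto
  qed
  from choice[OF this] obtain W where W: "\<forall>j. j < length ds \<longrightarrow>
    homogeneous (a (Suc 0)) (int (ds ! j)) (W j) \<and> Fs ! j = ?d (W j) 0" by (rule exE)
  define M where "M = mat (length (a 1)) (length ds) (\<lambda>(p, j). W j p)"
  let ?M = "\<lambda>p q. M $$ (p, q)" and ?k = "map int ds"
  have gr: "graded_hom ?k (a 1) M"
    using W by (auto simp: graded_hom_def M_def homogeneous_def)
  then have grm: "graded_matrix ?k (a (Suc 0)) ?M" by (simp add: graded_hom_iff)
  have dM: "?d (lin_map ?M (length ?k) u) 0 = (\<Sum>j<length ds. u j * Fs ! j)" for u
  proof -
    have "?d (lin_map ?M (length ?k) u) 0 = ?d (\<lambda>p. \<Sum>j<length ds. u j * W j p) 0"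
      by (rule lin_map_cong) (auto simp: lin_map_def M_def mult.commute intro!: sum.cong)
    also have "\<dots> = (\<Sum>j<length ds. u j * ?d (W j) 0)" by (rule lin_map_sum)
    also have "\<dots> = (\<Sum>j<length ds. u j * Fs ! j)" using W by (intro sum.cong) auto
    finally show ?thesis .
  qed
  \<comment> \<open>Above all degrees of basis vectors on both sides, so that the restricted
    isomorphism is one of the whole modules.\<close>
  define \<beta> where "\<beta> = Max (set ?k \<union> set (a 1) \<union> {0})"
  have bij: "bijective_upto ?k (a (Suc 0)) ?M \<beta>"
  proof (rule bijective_uptoI[OF grm first_surjective[OF grm]])
    fix f t assume f: "f \<in> ideal_generated (set Fs)" "f \<in> forms t"
    obtain c where c: "f = (\<Sum>j<length ds. c j * Fs ! j)" "\<And>j. j < length ds \<Longrightarrow> c j \<in> forms (t - int (ds ! j))"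
      using lincombs_homogeneous[of f "(!) Fs" "{..<length ds}" t "\<lambda>j. int (ds ! j)"] f
        form_tuples_nth[OF Fs] I by auto
    show "\<exists>w. homogeneous ?k t w \<and> f = ?d (lin_map ?M (length ?k) w) 0"
    proof (intro exI[of _ c] conjI)
      show "homogeneous ?k t c" using c(2) by (simp add: homogeneous_def)
      show "f = ?d (lin_map ?M (length ?k) c) 0" unfolding dM by (rule c(1))
    qed
  next
    fix t u q assume u: "homogeneous ?k t u" and q: "q < length ?k"
      and ker: "\<And>p. p < length (a (Suc 0)) \<Longrightarrow> lin_map ?M (length ?k) u p = 0"
    have "(\<Sum>j<length ds. u j * Fs ! j) = ?d (\<lambda>_. 0) 0"
      unfolding dM [symmetric] by (rule lin_map_cong) (rule ker)
    then have "(\<Sum>j<length ds. u j * Fs ! j) = 0" by (simp add: lin_map_def)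
    then show "u q \<in> irrelevant_ideal" using minimal_generators_relation[OF min len u] q by simp
  qed
  have "bij_betw (\<lambda>v. M *\<^sub>v v) (carrier_vec (length ?k)) (carrier_vec (length (a 1)))"
  proof (rule bijective_upto_bij_betw)
    show "bijective_upto ?k (a 1) ?M \<beta>" using bij by simp
    show "?k ! q \<le> \<beta>" if "q < length ?k" for q
      unfolding \<beta>_def by (rule Max_ge) (use nth_mem[OF that] in auto)
    show "a 1 ! p \<le> \<beta>" if "p < length (a 1)" for p
      unfolding \<beta>_def by (rule Max_ge) (use nth_mem[OF that] in auto)
  qed (simp add: M_def)
  then show ?thesis using gr unfolding graded_iso_def by blast
qed

text \<open>Otherwise all entries in the row of a basis vector of degree \<open>t\<close> would have
  nonzero degree, hence lie in the irrelevant ideal, and that basis vector would not be in the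
  image.\<close>

lemma graded_iso_degree:
  fixes M :: "('v::finite, 'k::comm_ring_1) mpoly mat"
  assumes iso: "graded_iso k a M" and t: "t \<in> set a"
  shows "t \<in> set k"
proof (rule ccontr)
  assume n: "t \<notin> set k"
  obtain p where p: "p < length a" "t = a ! p" using t by (auto simp: in_set_conv_nth)
  have car: "M \<in> carrier_mat (length a) (length k)" and gr: "graded_matrix k a (\<lambda>p q. M $$ (p, q))"
    using iso by (auto simp: graded_iso_def graded_hom_iff)
  have "unit_vec (length a) p \<in> carrier_vec (length a)" by simp
  then obtain u where u: "u \<in> carrier_vec (length k)" "unit_vec (length a) p = M *\<^sub>v u"
    using iso unfolding graded_iso_def bij_betw_def by blast
  have "1 = (M *\<^sub>v u) $ p" using u(2) p(1) by (metis index_unit_vec(1))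
  also have "\<dots> = lin_map (\<lambda>p q. M $$ (p, q)) (length k) (($) u) p" by (rule mult_mat_vec_lin_map[OF car u(1) p(1)])
  also have "\<dots> \<in> irrelevant_ideal"
  proof (rule lin_map_irrelevant)
    fix q assume q: "q < length k"
    then have "k ! q \<noteq> t" using n by auto
    then show "M $$ (p, q) \<in> irrelevant_ideal"
      using gr p q by (intro forms_irrelevant[of _ "k ! q - a ! p"]) (auto simp: graded_matrix_def)
  qed
  finally show False using one_not_irrelevant by blast
qed

lemma resolution_of_general_forms:
  fixes Fs :: "('v::finite, 'k::field) mpoly list"
  assumes Fs: "Fs \<in> form_tuples ds" and pos: "\<forall>d\<in>set ds. 1 \<le> d" and min: "minimal_generators Fs"
    and res: "minimal_free_resolution (ideal_generated (set Fs)) a D"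
    and c: "\<And>j. c < j \<Longrightarrow> forms (int j) \<subseteq> ideal_generated (set Fs)"
    and ex: "\<And>i t. i \<ge> 1 \<Longrightarrow> t \<le> int c + int i - 1 \<Longrightarrow>
      koszul_exact (\<lambda>j. int (ds ! j)) ((!) Fs) {..<length ds} i t"
    and ex1: "\<And>j. j < length ds \<Longrightarrow> ds ! j = Suc c \<Longrightarrow>
      koszul_exact (\<lambda>j. int (ds ! j)) ((!) Fs) {..<length ds} 1 (int (Suc c))"
    and \<phi>: "comparison_map ds Fs a D \<phi>"
  shows "\<forall>i\<ge>2. koszul_decomposition ds (int c) i (a i) (\<phi> i)"
    and "\<forall>i\<ge>2. \<forall>t. non_koszul_ghost_term ds a \<phi> i t \<longrightarrow> t = int c + int i"
    and "\<forall>t. \<not> non_koszul_ghost_term ds a \<phi> 1 t"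
proof -
  let ?k = "koszul_module ds"
  interpret comparison a "\<lambda>i p q. D i $$ (p, q)" "ideal_generated (set Fs)" ?k
    "\<lambda>i p q. koszul_map Fs (i - 1) $$ (p, q)" "\<lambda>i p q. \<phi> i $$ (p, q)"
    by (rule comparison_locale[OF res Fs pos \<phi>])
  have gr: "graded_hom (?k i) (a i) (\<phi> i)" for i using \<phi> by (simp add: comparison_map_def)
  have car: "\<phi> i \<in> carrier_mat (length (a i)) (length (?k i))" for i
    using gr[of i] by (simp add: graded_hom_def)
  have exact_atI: "exact_at i t" if ke: "koszul_exact (\<lambda>j. int (ds ! j)) ((!) Fs) {..<length ds} (Suc i) t" for i t
    unfolding exact_at_def
  proof (intro allI impI)
    fix u assume u: "homogeneous (?k (Suc i)) t u"
      "\<forall>p<length (?k i). lin_map (\<lambda>p q. koszul_map Fs (Suc i - 1) $$ (p, q)) (length (?k (Suc i))) u p = 0"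
    obtain w where "homogeneous (?k (Suc (Suc i))) t w"
      "\<And>p. p < length (koszul_basis (length ds) (Suc i)) \<Longrightarrow>
        u p = lin_map (\<lambda>p q. koszul_map Fs (Suc i) $$ (p, q)) (length (koszul_basis (length ds) (Suc (Suc i)))) w p"
      by (rule koszul_map_exact[OF Fs ke u(1)]) (use u(2) in auto)
    then show "\<exists>w. homogeneous (?k (Suc (Suc i))) t w \<and> (\<forall>q<length (?k (Suc i)).
      u q = lin_map (\<lambda>p q. koszul_map Fs (Suc (Suc i) - 1) $$ (p, q)) (length (?k (Suc (Suc i)))) w q)"
      by auto
  qed
  have bij: "bijective_upto (?k i) (a i) (\<lambda>p q. \<phi> i $$ (p, q)) (int c + int i - 2)" for i
    by (rule bijective, rule exact_atI, rule ex) auto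
  have deg: "a i ! p \<le> int c + int i" if "i \<ge> 1" "p < length (a i)" for i p
    using generator_degree_le[where c = c and p = p and i = "i - 1", OF c] that by simp
  have deg': "t \<le> int c + int i" if "i \<ge> 1" "t \<in> set (a i)" for i t
    using deg that by (auto simp: in_set_conv_nth)
  have surj: "koszul_surjective ds a \<phi> j t" if t: "t \<le> int c + int j - 2" for j t
  proof (rule koszul_surjectiveI[where \<phi> = \<phi>, OF car])
    fix v :: "nat \<Rightarrow> ('v, 'k) mpoly" assume "homogeneous (a j) t v"
    then obtain u where "homogeneous (?k j) t u"
      "\<And>p. p < length (a j) \<Longrightarrow> v p = lin_map (\<lambda>p q. \<phi> j $$ (p, q)) (length (?k j)) u p"
      using bijective_upto_surjective[OF bij t] by blast
    then show "\<exists>u. homogeneous (?k j) t u \<and>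
      (\<forall>p<length (a j). v p - lin_map (\<lambda>p q. \<phi> j $$ (p, q)) (length (?k j)) u p \<in> irrelevant_ideal)"
      by (intro exI[of _ u]) simp
  qed
  show "\<forall>i\<ge>2. koszul_decomposition ds (int c) i (a i) (\<phi> i)"
    using koszul_decompositionI[OF gr bij deg] by simp
  show "\<forall>i\<ge>2. \<forall>t. non_koszul_ghost_term ds a \<phi> i t \<longrightarrow> t = int c + int i"
  proof (intro allI impI)
    fix i t assume i: "2 \<le> i" and g: "non_koszul_ghost_term ds a \<phi> i t"
    then have t: "t \<in> set (a i)" and nk: "\<not> koszul_surjective ds a \<phi> (Suc i) t"
      by (auto simp: non_koszul_ghost_term_def ghost_term_def)
    \<comment> \<open>The comparison forces a non-Koszul degree of the next module to be at least
      \<open>c + i\<close>, while the generators of the present module stop at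
      \<open>c + i\<close>.\<close>
    have "\<not> t \<le> int c + int (Suc i) - 2" using surj nk by blast
    moreover have "t \<le> int c + int i" using deg' t i by simp
    ultimately show "t = int c + int i" by simp
  qed
  show "\<forall>t. \<not> non_koszul_ghost_term ds a \<phi> 1 t"
  proof (intro allI notI)
    fix t assume "non_koszul_ghost_term ds a \<phi> 1 t"
    then have t: "t \<in> set (a 1)" and nk: "\<not> koszul_surjective ds a \<phi> (Suc 1) t"
      by (auto simp: non_koszul_ghost_term_def ghost_term_def)
    have "\<not> t \<le> int c + int (Suc 1) - 2" using surj nk by blast
    moreover have "t \<le> int c + int 1" using deg'[OF _ t] by simp
    ultimately have tc: "t = int (Suc c)" by simp
    \<comment> \<open>A generator of the first module in degree \<open>c + 1\<close> means that one
      of the given forms has this degree, the situation in which H_1 also vanishes there.\<close>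
    obtain M :: "('v, 'k) mpoly mat" where "graded_iso (map int ds) (a 1) M"
      using first_module_iso[OF res Fs min] by blast
    then have "t \<in> set (map int ds)" using graded_iso_degree t by blast
    then obtain j where "j < length ds" "ds ! j = Suc c" using tc by (auto simp: in_set_conv_nth)
    then have ex0: "exact_at 0 t" using exact_atI[of 0 t] ex1 tc by simp
    have "koszul_surjective ds a \<phi> (Suc (Suc 0)) t"
      by (rule koszul_surjectiveI[where \<phi> = \<phi>, OF car]) (rule second_surjective[OF ex0])
    then show False using nk by simp
  qed
qed

theorem theorem3p15:
  fixes ds :: "nat list"
  assumes infinite_field: "infinite (UNIV :: 'k::field set)"
    and many_forms: "CARD('v::finite) \<le> length ds"
    and positive_degrees: "\<forall>d\<in>set ds. 1 \<le> d"
    and maximal_rank: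
      "\<And>es :: nat list. length es < length ds \<Longrightarrow> \<forall>e\<in>set es. 1 \<le> e \<Longrightarrow>
         for_general_forms es
           (\<lambda>Gs :: ('v, 'k) mpoly list. maximal_rank_property (ideal_generated (set Gs)))"
  shows "for_general_forms ds (\<lambda>Fs :: ('v, 'k) mpoly list.
     minimal_generators Fs \<longrightarrow>
     (\<forall>a D. minimal_free_resolution (ideal_generated (set Fs)) a D \<longrightarrow>
       (let c = int (max_socle_degree (ideal_generated (set Fs))) in
          (\<exists>M :: ('v, 'k) mpoly mat. graded_iso (map int ds) (a 1) M) \<and>
          (\<exists>\<phi>. comparison_map ds Fs a D \<phi>) \<and>
          (\<forall>\<phi>. comparison_map ds Fs a D \<phi> \<longrightarrow>
             (\<forall>i\<ge>2. koszul_decomposition ds c i (a i) (\<phi> i)) \<and>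
             (\<forall>i\<ge>2. \<forall>t. non_koszul_ghost_term ds a \<phi> i t \<longrightarrow> t = c + int i) \<and>
             (\<forall>t. \<not> non_koszul_ghost_term ds a \<phi> 1 t)))))"
proof -
  \<comment> \<open>A bound for the socle degree of every tuple in the open set, available before a
    tuple is chosen.\<close>
  let ?N = "sum_list ds"
  have "{..<length ds} \<noteq> {}"
    using many_forms zero_less_card_finite[where 'a = 'v] by (metis empty_iff lessThan_iff less_le_trans)
  then have "Max ((!) ds ` {..<length ds}) \<in> (!) ds ` {..<length ds}" by (intro Max_in) auto
  then obtain l where l: "l < length ds" "Max ((!) ds ` {..<length ds}) = ds ! l" by auto
  have l_max: "ds ! j \<le> ds ! l" if "j < length ds" for j
    unfolding l(2) [symmetric] using that by (intro Max_ge) auto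
  \<comment> \<open>The socle degree is not known yet; with a form of largest degree last, the last
    form has degree \<open>c + 1\<close> whenever some form does.\<close>
  define js where "js = filter (\<lambda>j. j \<noteq> l) [0..<length ds]"
  have js: "distinct (js @ [l])" "set (js @ [l]) = {..<length ds}" using l(1) by (auto simp: js_def)
  have "for_general_forms ds (\<lambda>Fs :: ('v, 'k) mpoly list. prefix_maximal_rank ?N ds (js @ [l]) Fs \<and>
      forms (int ?N) \<subseteq> lincombs ((!) Fs) {..<length ds})"
    by (intro for_general_forms_conj infinite_field artinian_generic many_forms positive_degrees
        prefix_maximal_rank_generic maximal_rank js)
  then show ?thesis
  proof (rule for_general_forms_mono, intro impI allI)
    fix Fs :: "('v, 'k) mpoly list" and a D
    assume Fs: "Fs \<in> form_tuples ds"
      and gen: "prefix_maximal_rank ?N ds (js @ [l]) Fs \<and> forms (int ?N) \<subseteq> lincombs ((!) Fs) {..<length ds}"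
      and min: "minimal_generators Fs" and res: "minimal_free_resolution (ideal_generated (set Fs)) a D"
    note ex = koszul_exact_socle[OF Fs positive_degrees min js l_max conjunct1[OF gen] conjunct2[OF gen]]
    have socle: "forms (int j) \<subseteq> ideal_generated (set Fs)" if "max_socle_degree (ideal_generated (set Fs)) < j" for j
      using max_socle_degree(3)[OF Fs positive_degrees conjunct2[OF gen] that] form_tuples_length[OF Fs]
      by (simp add: ideal_generated_set)
    let ?c = "max_socle_degree (ideal_generated (set Fs))"
    note R = resolution_of_general_forms[where c = ?c, OF Fs positive_degrees min res]
    show "let c = int (max_socle_degree (ideal_generated (set Fs))) in
          (\<exists>M :: ('v, 'k) mpoly mat. graded_iso (map int ds) (a 1) M) \<and>
          (\<exists>\<phi>. comparison_map ds Fs a D \<phi>) \<and>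
          (\<forall>\<phi>. comparison_map ds Fs a D \<phi> \<longrightarrow>
             (\<forall>i\<ge>2. koszul_decomposition ds c i (a i) (\<phi> i)) \<and>
             (\<forall>i\<ge>2. \<forall>t. non_koszul_ghost_term ds a \<phi> i t \<longrightarrow> t = c + int i) \<and>
             (\<forall>t. \<not> non_koszul_ghost_term ds a \<phi> 1 t))"
      unfolding Let_def
    proof (rule conjI[OF first_module_iso[OF res Fs min]],
        rule conjI[OF comparison_map_exists[OF res Fs positive_degrees]], rule allI, rule impI)
      fix \<phi> assume \<phi>: "comparison_map ds Fs a D \<phi>"
      show "(\<forall>i\<ge>2. koszul_decomposition ds (int (max_socle_degree (ideal_generated (set Fs)))) i (a i) (\<phi> i)) \<and>
             (\<forall>i\<ge>2. \<forall>t. non_koszul_ghost_term ds a \<phi> i t \<longrightarrow>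
               t = int (max_socle_degree (ideal_generated (set Fs))) + int i) \<and>
             (\<forall>t. \<not> non_koszul_ghost_term ds a \<phi> 1 t)"
      proof (rule conjI[OF _ conjI])
        show "\<forall>i\<ge>2. koszul_decomposition ds (int ?c) i (a i) (\<phi> i)"
          by (rule R(1)[OF _ _ _ \<phi>]) (erule socle, rule ex(1), assumption+, rule ex(2), assumption+)
        show "\<forall>i\<ge>2. \<forall>t. non_koszul_ghost_term ds a \<phi> i t \<longrightarrow> t = int ?c + int i"
          by (rule R(2)[OF _ _ _ \<phi>]) (erule socle, rule ex(1), assumption+, rule ex(2), assumption+)
        show "\<forall>t. \<not> non_koszul_ghost_term ds a \<phi> 1 t"
          by (rule R(3)[OF _ _ _ \<phi>]) (erule socle, rule ex(1), assumption+, rule ex(2), assumption+)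
      qed
    qed
  qed
qed

end
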